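(* Let $\Lambda$ be a domestic string algebra and let $u$ be a weak arch bridge. Then there is a path $P$ in the arch bridge quiver $\mathcal{HQ}^{\mathrm{Ba}}$ such that $u=\mathfrak h(P)$.
   Context: STRINGS. $\mathcal K$ is an algebraically closed field. A string algebra is $\Lambda=\mathcal K\mathcal Q/\langle\rho\rangle$ with $\mathcal Q=(Q_0,Q_1,s,t)$ a finite quiver and $\rho$ a set of paths of length $\ge2$, none a subpath of another, such that: every vertex is the source of at most two and the target of at most two arrows; for every arrow $b$ there is at most one arrow $a$ with $s(a)=t(b)$, $ab\notin\rho$, and at most one arrow $c$ with $t(c)=s(b)$, $bc\notin\rho$; all sufficiently long paths have a subpath in $\rho$. Words are composed from right to left. Fix $\sigma,\varepsilon:Q_1\to\{1,-1\}$ with $\sigma(a)=-\sigma(b)$ for distinct arrows with the same source, $\varepsilon(a)=-\varepsilon(b)$ for distinct arrows with the same target, and $\sigma(a)=-\varepsilon(b)$ whenever $s(a)=t(b)$ and $ab\notin\rho$. Syllables are arrows (direct) and their formal inverses (inverse), with $s(a^{-1})=t(a)$, $t(a^{-1})=s(a)$, $\sigma(a^{-1})=\varepsilon(a)$, $\varepsilon(a^{-1})=\sigma(a)$. A string of length $n>0$ is a word $\alpha_n\cdots\alpha_1$ of syllables with $s(\alpha_{i+1})=t(\alpha_i)$, $\alpha_{i+1}\ne\alpha_i^{-1}$, and no subword in $\rho\cup\rho^{-1}$; its first syllable is $\alpha_1$ (determining $s,\sigma$) and its last is $\alpha_n$ (determining $t,\varepsilon$). For each vertex $v$ and $i\in\{1,-1\}$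 there is a length-$0$ string $1_{(v,i)}$ with $s=t=v$, $\sigma=-i$, $\varepsilon=i$; $x1_{(v,i)}=x$ is defined iff $s(x)=v,\sigma(x)=-i$, and $1_{(v,i)}x=x$ is defined iff $t(x)=v,\varepsilon(x)=i$. A band is a string $b$ with $s(b)=t(b)$ whose first syllable is inverse and last syllable is direct, such that $b^n$ is a string for all $n\ge1$ and $b$ is not a proper power of a string. $\Lambda$ is domestic if it has only finitely many bands. A string is band-free if no substring of it is a cyclic permutation of a band. REDUCTIONS. For a band $b$ and a string $y$, $N(b,y)$ is the largest $n$ with $y=y_2(b')^ny_1$ for some strings $y_1,y_2$ and some cyclic permutation $b'$ of $b$; $\mathfrak B(y)$ is the set of bands $b$ (up to cyclic permutation) with $N(b,y)>0$. A 1-step $b$-reduction of $y$ is a string of the form $y_2y_1$ where $y=y_2b'y_1$ with $b'$ a cyclic permutation of $b$; when it exists it is denoted $\mathrm R_b(y)$. The skeleton $\{y\}$ of $y$ is obtained by applying, for every $b\in\mathfrak B(y)$, the operation $\mathrm R_b$ exactly $N(b,y)-1$ times. H-REDUCTIONS. Strings $y_1,y_2$ are H-equivalent, $y_1\equiv_H y_2$, if $t(y_1)=t(y_2)$ and for each string $x$ with $s(x)=t(y_1)$, $xy_1$ is a string iff $xy_2$ is a string. A 1-step H-reduction of $y$ is a string $y_2y_1$, where $y=y_2b'y_1$ with $b'$ a cyclic permutation of a band and $b'y_1\equiv_H y_1$. For a band $b$, set $\mathfrak h_b(y)=\mathrm R_b(y)$ if $b\in\mathfrak B(y)$, $\mathrm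 R_b(y)$ exists and is a 1-step H-reduction of $y$; otherwise $\mathfrak h_b(y)=y$. WEAK BRIDGES. Fix a set $Q_0^{\mathrm{Ba}}$ of representatives of bands up to cyclic permutation. For $b_1,b_2\in Q_0^{\mathrm{Ba}}$, a weak bridge $u:b_1\to b_2$ is a band-free string $u$ such that $b_2ub_1$ is a string, excluding the trivial ones $1_{(t(b),\varepsilon(b))}:b\to b$; write $\mathfrak s(u)=b_1$, $\mathfrak t(u)=b_2$. The weak bridge quiver $\overline{\mathcal Q}^{\mathrm{Ba}}$ has vertex set $Q_0^{\mathrm{Ba}}$ and the weak bridges as arrows. (WEAK) ARCH BRIDGES. For a path $P=(u_1,\dots,u_n)$, $n\ge1$, in $\overline{\mathcal Q}^{\mathrm{Ba}}$ (so $\mathfrak t(u_j)=\mathfrak s(u_{j+1})$), with $\mathfrak s(P)=\mathfrak s(u_1)$ and $\mathfrak t(P)=\mathfrak t(u_n)$, the string $\mathfrak h(P)$ is defined by $$\mathfrak t(P)\,\mathfrak h(P)\,\mathfrak s(P)=\mathfrak h_{\mathfrak t(u_1)}\cdots\mathfrak h_{\mathfrak t(u_{n-1})}\big(\{\mathfrak t(u_n)u_n\cdots\mathfrak t(u_1)u_1\mathfrak s(u_1)\}\big).$$ A weak arch bridge $b_1\to b_2$ is a string $\mathfrak h(P)$ for some such path $P$ with $\mathfrak s(P)=b_1$, $\mathfrak t(P)=b_2$; it is regarded as an arrow with source $b_1$ and target $b_2$. A weak arch bridge $u:b_1\to b_2$ is an arch bridge if $u\ne\mathfrak h(P)$ for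 every path $P$ of length at least $2$ from $b_1$ to $b_2$ in $\overline{\mathcal Q}^{\mathrm{Ba}}$. (Every arch bridge is therefore $\mathfrak h((u))=u$ for a single weak bridge $u$, so paths of arch bridges are paths in $\overline{\mathcal Q}^{\mathrm{Ba}}$.) The arch bridge quiver $\mathcal{HQ}^{\mathrm{Ba}}$ has vertex set $Q_0^{\mathrm{Ba}}$ and the arch bridges as arrows. An equality $u=\mathfrak h(P)$ is an equality of arrows, i.e. includes equality of sources and targets. *)

theory Defs
  imports Main "HOL-Library.Sublist" "HOL-Computational_Algebra.Polynomial"
begin

section \<open>String algebras\<close>

text \<open>
  A presentation of a string algebra by a quiver and a set of monomial relations, together with
  the sign functions on its arrows. Composition is from right to left, and words are stored as
  they are written: the list \<open>[a\<^sub>n, \<dots>, a\<^sub>1]\<close> is the word \<open>a\<^sub>n \<cdots> a\<^sub>1\<close>,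
  so its first letter in the sense of composition is the last entry of the list.
\<close>

record ('v, 'a) presentation =
  vertices :: "'v set"
  arrows :: "'a set"
  src :: "'a \<Rightarrow> 'v"
  tgt :: "'a \<Rightarrow> 'v"
  relations :: "'a list set"
  sgn_src :: "'a \<Rightarrow> int"  \<comment> \<open>\<open>\<sigma>\<close> on arrows\<close>
  sgn_tgt :: "'a \<Rightarrow> int"  \<comment> \<open>\<open>\<epsilon>\<close> on arrows\<close>

definition quiver_path :: "('v, 'a) presentation \<Rightarrow> 'a list \<Rightarrow> bool" where
  "quiver_path \<Lambda> p \<longleftrightarrow>
     p \<noteq> [] \<and> set p \<subseteq> arrows \<Lambda> \<and> successively (\<lambda>a b. src \<Lambda> a = tgt \<Lambda> b) p"

text \<open>
  The first argument is the ground field of \<open>\<Lambda> = K Q / \<langle>\<rho>\<rangle>\<close>. It imposes no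
  condition: everything below depends on the pair \<open>(Q, \<rho>)\<close> and the signs only.
\<close>

definition string_algebra :: "'k::alg_closed_field itself \<Rightarrow> ('v, 'a) presentation \<Rightarrow> bool" where
  "string_algebra K \<Lambda> \<longleftrightarrow>
     finite (vertices \<Lambda>) \<and> finite (arrows \<Lambda>) \<and>
     (\<forall>a\<in>arrows \<Lambda>. src \<Lambda> a \<in> vertices \<Lambda> \<and> tgt \<Lambda> a \<in> vertices \<Lambda>) \<and>
     (\<forall>p\<in>relations \<Lambda>. quiver_path \<Lambda> p \<and> length p \<ge> 2) \<and>
     (\<forall>p\<in>relations \<Lambda>. \<forall>q\<in>relations \<Lambda>. sublist p q \<longrightarrow> p = q) \<and>
     (\<forall>v\<in>vertices \<Lambda>. card {a \<in> arrows \<Lambda>. src \<Lambda> a = v} \<le> 2 \<and>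
                      card {a \<in> arrows \<Lambda>. tgt \<Lambda> a = v} \<le> 2) \<and>
     (\<forall>b\<in>arrows \<Lambda>.
        card {a \<in> arrows \<Lambda>. src \<Lambda> a = tgt \<Lambda> b \<and> [a, b] \<notin> relations \<Lambda>} \<le> 1 \<and>
        card {c \<in> arrows \<Lambda>. tgt \<Lambda> c = src \<Lambda> b \<and> [b, c] \<notin> relations \<Lambda>} \<le> 1) \<and>
     (\<exists>m. \<forall>p. quiver_path \<Lambda> p \<and> length p \<ge> m \<longrightarrow> (\<exists>r\<in>relations \<Lambda>. sublist r p))"

definition sign_choice :: "('v, 'a) presentation \<Rightarrow> bool" where
  "sign_choice \<Lambda> \<longleftrightarrow>
     (\<forall>a\<in>arrows \<Lambda>. sgn_src \<Lambda> a \<in> {1, -1} \<and> sgn_tgt \<Lambda> a \<in> {1, -1}) \<and>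
     (\<forall>a\<in>arrows \<Lambda>. \<forall>b\<in>arrows \<Lambda>.
        (a \<noteq> b \<and> src \<Lambda> a = src \<Lambda> b \<longrightarrow> sgn_src \<Lambda> a = - sgn_src \<Lambda> b) \<and>
        (a \<noteq> b \<and> tgt \<Lambda> a = tgt \<Lambda> b \<longrightarrow> sgn_tgt \<Lambda> a = - sgn_tgt \<Lambda> b) \<and>
        (src \<Lambda> a = tgt \<Lambda> b \<and> [a, b] \<notin> relations \<Lambda> \<longrightarrow> sgn_src \<Lambda> a = - sgn_tgt \<Lambda> b))"

section \<open>Strings and bands\<close>

datatype 'a syllable = Dir (arrow_of: 'a) | Inv (arrow_of: 'a)

fun syl_inv :: "'a syllable \<Rightarrow> 'a syllable" where
  "syl_inv (Dir a) = Inv a"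
| "syl_inv (Inv a) = Dir a"

fun syl_src :: "('v, 'a) presentation \<Rightarrow> 'a syllable \<Rightarrow> 'v" where
  "syl_src \<Lambda> (Dir a) = src \<Lambda> a"
| "syl_src \<Lambda> (Inv a) = tgt \<Lambda> a"

fun syl_tgt :: "('v, 'a) presentation \<Rightarrow> 'a syllable \<Rightarrow> 'v" where
  "syl_tgt \<Lambda> (Dir a) = tgt \<Lambda> a"
| "syl_tgt \<Lambda> (Inv a) = src \<Lambda> a"

fun syl_sigma :: "('v, 'a) presentation \<Rightarrow> 'a syllable \<Rightarrow> int" where
  "syl_sigma \<Lambda> (Dir a) = sgn_src \<Lambda> a"
| "syl_sigma \<Lambda> (Inv a) = sgn_tgt \<Lambda> a"

fun syl_eps :: "('v, 'a) presentation \<Rightarrow> 'a syllable \<Rightarrow> int" where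
  "syl_eps \<Lambda> (Dir a) = sgn_tgt \<Lambda> a"
| "syl_eps \<Lambda> (Inv a) = sgn_src \<Lambda> a"

text \<open>\<open>Triv v i\<close> is the string \<open>1\<^bsub>(v,i)\<^esub>\<close> of length 0.\<close>

datatype ('v, 'a) str = Triv 'v int | Letters "'a syllable list"

fun is_string :: "('v, 'a) presentation \<Rightarrow> ('v, 'a) str \<Rightarrow> bool" where
  "is_string \<Lambda> (Triv v i) \<longleftrightarrow> v \<in> vertices \<Lambda> \<and> i \<in> {1, -1}"
| "is_string \<Lambda> (Letters w) \<longleftrightarrow>
     w \<noteq> [] \<and> arrow_of ` set w \<subseteq> arrows \<Lambda> \<and>
     successively (\<lambda>\<alpha> \<beta>. syl_src \<Lambda> \<alpha> = syl_tgt \<Lambda> \<beta> \<and> \<alpha> \<noteq> syl_inv \<beta>) w \<and>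
     (\<forall>r\<in>relations \<Lambda>. \<not> sublist (map Dir r) w \<and> \<not> sublist (rev (map Inv r)) w)"

fun str_src :: "('v, 'a) presentation \<Rightarrow> ('v, 'a) str \<Rightarrow> 'v" where
  "str_src \<Lambda> (Triv v i) = v"
| "str_src \<Lambda> (Letters w) = syl_src \<Lambda> (last w)"

fun str_tgt :: "('v, 'a) presentation \<Rightarrow> ('v, 'a) str \<Rightarrow> 'v" where
  "str_tgt \<Lambda> (Triv v i) = v"
| "str_tgt \<Lambda> (Letters w) = syl_tgt \<Lambda> (hd w)"

fun str_sigma :: "('v, 'a) presentation \<Rightarrow> ('v, 'a) str \<Rightarrow> int" where
  "str_sigma \<Lambda> (Triv v i) = - i"
| "str_sigma \<Lambda> (Letters w) = syl_sigma \<Lambda> (last w)"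

fun str_eps :: "('v, 'a) presentation \<Rightarrow> ('v, 'a) str \<Rightarrow> int" where
  "str_eps \<Lambda> (Triv v i) = i"
| "str_eps \<Lambda> (Letters w) = syl_eps \<Lambda> (hd w)"

text \<open>
  The partial product of two strings; \<open>None\<close> means that it is not defined, or not a string.
\<close>

fun str_mult :: "('v, 'a) presentation \<Rightarrow> ('v, 'a) str \<Rightarrow> ('v, 'a) str \<Rightarrow> ('v, 'a) str option" where
  "str_mult \<Lambda> x (Triv v i) =
     (if is_string \<Lambda> x \<and> is_string \<Lambda> (Triv v i) \<and> str_src \<Lambda> x = v \<and> str_sigma \<Lambda> x = - i
      then Some x else None)"
| "str_mult \<Lambda> (Triv v i) x =
     (if is_string \<Lambda> x \<and> is_string \<Lambda> (Triv v i) \<and> str_tgt \<Lambda> x = v \<and> str_eps \<Lambda> x = i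
      then Some x else None)"
| "str_mult \<Lambda> (Letters w) (Letters w') =
     (if is_string \<Lambda> (Letters w) \<and> is_string \<Lambda> (Letters w') \<and> is_string \<Lambda> (Letters (w @ w'))
      then Some (Letters (w @ w')) else None)"

text \<open>
  \<open>str_prod \<Lambda> [x\<^sub>1, \<dots>, x\<^sub>n]\<close> is the product \<open>x\<^sub>1 \<cdots> x\<^sub>n\<close> if it is a string. The bracketing
  is irrelevant, since products of strings associate.
\<close>

fun str_prod :: "('v, 'a) presentation \<Rightarrow> ('v, 'a) str list \<Rightarrow> ('v, 'a) str option" where
  "str_prod \<Lambda> [] = None"
| "str_prod \<Lambda> [x] = (if is_string \<Lambda> x then Some x else None)"
| "str_prod \<Lambda> (x # y # ys) = Option.bind (str_prod \<Lambda> (y # ys)) (str_mult \<Lambda> x)"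

definition is_band :: "('v, 'a) presentation \<Rightarrow> ('v, 'a) str \<Rightarrow> bool" where
  "is_band \<Lambda> b \<longleftrightarrow>
     is_string \<Lambda> b \<and> str_src \<Lambda> b = str_tgt \<Lambda> b \<and>
     (\<exists>w. b = Letters w \<and> (\<exists>a. last w = Inv a) \<and> (\<exists>a. hd w = Dir a)) \<and>
     (\<forall>n\<ge>1. str_prod \<Lambda> (replicate n b) \<noteq> None) \<and>
     (\<nexists>z n. n \<ge> 2 \<and> str_prod \<Lambda> (replicate n z) = Some b)"

definition domestic :: "('v, 'a) presentation \<Rightarrow> bool" where
  "domestic \<Lambda> \<longleftrightarrow> finite {b. is_band \<Lambda> b}"

text \<open>A cyclic permutation of a band is a string, but need not itself be a band.\<close>

definition cyc_perm :: "('v, 'a) str \<Rightarrow> ('v, 'a) str \<Rightarrow> bool" where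
  "cyc_perm b b' \<longleftrightarrow> (\<exists>w k. b = Letters w \<and> b' = Letters (rotate k w))"

definition band_free :: "('v, 'a) presentation \<Rightarrow> ('v, 'a) str \<Rightarrow> bool" where
  "band_free \<Lambda> u \<longleftrightarrow>
     is_string \<Lambda> u \<and>
     (\<nexists>y\<^sub>2 z y\<^sub>1 b. str_prod \<Lambda> [y\<^sub>2, z, y\<^sub>1] = Some u \<and> is_band \<Lambda> b \<and> cyc_perm b z)"

text \<open>\<open>B\<close> is a choice of representatives of the bands up to cyclic permutation.\<close>

definition band_reps :: "('v, 'a) presentation \<Rightarrow> ('v, 'a) str set \<Rightarrow> bool" where
  "band_reps \<Lambda> B \<longleftrightarrow>
     (\<forall>b\<in>B. is_band \<Lambda> b) \<and> (\<forall>b. is_band \<Lambda> b \<longrightarrow> (\<exists>!b'. b' \<in> B \<and> cyc_perm b b'))"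

section \<open>Reductions\<close>

definition band_mult :: "('v, 'a) presentation \<Rightarrow> ('v, 'a) str \<Rightarrow> ('v, 'a) str \<Rightarrow> nat" where
  "band_mult \<Lambda> b y =
     Max {n. \<exists>y\<^sub>2 b' y\<^sub>1. cyc_perm b b' \<and>
            str_prod \<Lambda> ([y\<^sub>2] @ replicate n b' @ [y\<^sub>1]) = Some y}"

definition bands_in ::
  "('v, 'a) presentation \<Rightarrow> ('v, 'a) str set \<Rightarrow> ('v, 'a) str \<Rightarrow> ('v, 'a) str set" where
  "bands_in \<Lambda> B y = {b \<in> B. band_mult \<Lambda> b y > 0}"

definition one_step_reduction ::
  "('v, 'a) presentation \<Rightarrow> ('v, 'a) str \<Rightarrow> ('v, 'a) str \<Rightarrow> ('v, 'a) str \<Rightarrow> bool" where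
  "one_step_reduction \<Lambda> b y z \<longleftrightarrow>
     (\<exists>y\<^sub>2 b' y\<^sub>1. cyc_perm b b' \<and> str_prod \<Lambda> [y\<^sub>2, b', y\<^sub>1] = Some y \<and>
                 str_prod \<Lambda> [y\<^sub>2, y\<^sub>1] = Some z)"

text \<open>
  \<open>R\<^sub>b(y)\<close>. The choice operator only names the 1-step \<open>b\<close>-reduction of \<open>y\<close>, as the
  informal notation does; its arguments are meant to be strings over a domestic algebra.
\<close>

definition band_red ::
  "('v, 'a) presentation \<Rightarrow> ('v, 'a) str \<Rightarrow> ('v, 'a) str \<Rightarrow> ('v, 'a) str option" where
  "band_red \<Lambda> b y =
     (if \<exists>z. one_step_reduction \<Lambda> b y z
      then Some (SOME z. one_step_reduction \<Lambda> b y z) else None)"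

fun band_red_seq ::
  "('v, 'a) presentation \<Rightarrow> ('v, 'a) str list \<Rightarrow> ('v, 'a) str \<Rightarrow> ('v, 'a) str option" where
  "band_red_seq \<Lambda> [] y = Some y"
| "band_red_seq \<Lambda> (b # bs) y = Option.bind (band_red \<Lambda> b y) (band_red_seq \<Lambda> bs)"

text \<open>
  The list \<open>bs\<close> is an order in which the operations \<open>R\<^sub>b\<close> are carried out, each \<open>R\<^sub>b\<close> as often
  as prescribed by the multiplicity of \<open>b\<close> in the original string \<open>y\<close>.
\<close>

definition skeleton ::
  "('v, 'a) presentation \<Rightarrow> ('v, 'a) str set \<Rightarrow> ('v, 'a) str \<Rightarrow> ('v, 'a) str" where
  "skeleton \<Lambda> B y =
     (SOME z. \<exists>bs. set bs \<subseteq> bands_in \<Lambda> B y \<and>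
                (\<forall>b\<in>bands_in \<Lambda> B y. count_list bs b = band_mult \<Lambda> b y - 1) \<and>
                band_red_seq \<Lambda> bs y = Some z)"

definition H_equiv ::
  "('v, 'a) presentation \<Rightarrow> ('v, 'a) str \<Rightarrow> ('v, 'a) str \<Rightarrow> bool" where
  "H_equiv \<Lambda> y\<^sub>1 y\<^sub>2 \<longleftrightarrow>
     is_string \<Lambda> y\<^sub>1 \<and> is_string \<Lambda> y\<^sub>2 \<and> str_tgt \<Lambda> y\<^sub>1 = str_tgt \<Lambda> y\<^sub>2 \<and>
     (\<forall>x. is_string \<Lambda> x \<and> str_src \<Lambda> x = str_tgt \<Lambda> y\<^sub>1 \<longrightarrow>
        (str_prod \<Lambda> [x, y\<^sub>1] \<noteq> None \<longleftrightarrow> str_prod \<Lambda> [x, y\<^sub>2] \<noteq> None))"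

definition one_step_H_reduction ::
  "('v, 'a) presentation \<Rightarrow> ('v, 'a) str \<Rightarrow> ('v, 'a) str \<Rightarrow> bool" where
  "one_step_H_reduction \<Lambda> y z \<longleftrightarrow>
     (\<exists>y\<^sub>2 b b' y\<^sub>1 x. is_band \<Lambda> b \<and> cyc_perm b b' \<and>
        str_prod \<Lambda> [y\<^sub>2, b', y\<^sub>1] = Some y \<and> str_prod \<Lambda> [y\<^sub>2, y\<^sub>1] = Some z \<and>
        str_prod \<Lambda> [b', y\<^sub>1] = Some x \<and> H_equiv \<Lambda> x y\<^sub>1)"

definition h_band ::
  "('v, 'a) presentation \<Rightarrow> ('v, 'a) str set \<Rightarrow> ('v, 'a) str \<Rightarrow> ('v, 'a) str \<Rightarrow> ('v, 'a) str" where
  "h_band \<Lambda> B b y =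
     (case band_red \<Lambda> b y of
        None \<Rightarrow> y
      | Some z \<Rightarrow> if b \<in> bands_in \<Lambda> B y \<and> one_step_H_reduction \<Lambda> y z then z else y)"

section \<open>Weak bridges and arch bridges\<close>

text \<open>
  Arrows between bands carry their source and target, so that equality of arrows includes
  equality of end points. A path \<open>(u\<^sub>1, \<dots>, u\<^sub>n)\<close> is the list \<open>[u\<^sub>1, \<dots>, u\<^sub>n]\<close>, in order of
  traversal (unlike words, which are listed from left to right as written).
\<close>

record ('v, 'a) bridge =
  bsrc :: "('v, 'a) str"
  bstr :: "('v, 'a) str"
  btgt :: "('v, 'a) str"

definition weak_bridge ::
  "('v, 'a) presentation \<Rightarrow> ('v, 'a) str set \<Rightarrow> ('v, 'a) bridge \<Rightarrow> bool" where
  "weak_bridge \<Lambda> B u \<longleftrightarrow>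
     bsrc u \<in> B \<and> btgt u \<in> B \<and> band_free \<Lambda> (bstr u) \<and>
     str_prod \<Lambda> [btgt u, bstr u, bsrc u] \<noteq> None \<and>
     \<not> (bsrc u = btgt u \<and> bstr u = Triv (str_tgt \<Lambda> (bsrc u)) (str_eps \<Lambda> (bsrc u)))"

text \<open>Nonempty paths in the quiver on the bands whose arrows are given by the predicate \<open>A\<close>.\<close>

definition bridge_path :: "(('v, 'a) bridge \<Rightarrow> bool) \<Rightarrow> ('v, 'a) bridge list \<Rightarrow> bool" where
  "bridge_path A P \<longleftrightarrow>
     P \<noteq> [] \<and> (\<forall>u\<in>set P. A u) \<and> successively (\<lambda>u u'. btgt u = bsrc u') P"

definition path_src :: "('v, 'a) bridge list \<Rightarrow> ('v, 'a) str" where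
  "path_src P = bsrc (hd P)"

definition path_tgt :: "('v, 'a) bridge list \<Rightarrow> ('v, 'a) str" where
  "path_tgt P = btgt (last P)"

text \<open>The string \<open>t(u\<^sub>n) u\<^sub>n \<cdots> t(u\<^sub>1) u\<^sub>1 s(u\<^sub>1)\<close>.\<close>

definition path_string ::
  "('v, 'a) presentation \<Rightarrow> ('v, 'a) bridge list \<Rightarrow> ('v, 'a) str option" where
  "path_string \<Lambda> P =
     str_prod \<Lambda> (concat (map (\<lambda>u. [btgt u, bstr u]) (rev P)) @ [path_src P])"

text \<open>
  \<open>is_h \<Lambda> B P u\<close> says that the arrow \<open>u\<close> equals \<open>\<hh>(P)\<close>: it has the end points of \<open>P\<close>, and its
  string solves the equation defining \<open>\<hh>(P)\<close>. The \<open>foldr\<close> is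
  \<open>\<hh>\<^bsub>t(u\<^sub>1)\<^esub> \<cdots> \<hh>\<^bsub>t(u\<^sub>n\<^sub>-\<^sub>1)\<^esub>\<close>, whose rightmost factor acts first.
\<close>

definition is_h ::
  "('v, 'a) presentation \<Rightarrow> ('v, 'a) str set \<Rightarrow> ('v, 'a) bridge list \<Rightarrow> ('v, 'a) bridge \<Rightarrow> bool"
where
  "is_h \<Lambda> B P u \<longleftrightarrow>
     bsrc u = path_src P \<and> btgt u = path_tgt P \<and>
     (\<exists>y. path_string \<Lambda> P = Some y \<and>
          str_prod \<Lambda> [path_tgt P, bstr u, path_src P] =
            Some (foldr (h_band \<Lambda> B) (map btgt (butlast P)) (skeleton \<Lambda> B y)))"

definition weak_arch_bridge ::
  "('v, 'a) presentation \<Rightarrow> ('v, 'a) str set \<Rightarrow> ('v, 'a) bridge \<Rightarrow> bool" where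
  "weak_arch_bridge \<Lambda> B u \<longleftrightarrow> (\<exists>P. bridge_path (weak_bridge \<Lambda> B) P \<and> is_h \<Lambda> B P u)"

definition arch_bridge ::
  "('v, 'a) presentation \<Rightarrow> ('v, 'a) str set \<Rightarrow> ('v, 'a) bridge \<Rightarrow> bool" where
  "arch_bridge \<Lambda> B u \<longleftrightarrow>
     weak_arch_bridge \<Lambda> B u \<and>
     (\<nexists>P. bridge_path (weak_bridge \<Lambda> B) P \<and> length P \<ge> 2 \<and> is_h \<Lambda> B P u)"

end

theory Submission
  imports Defs
begin

text \<open>
  In a domestic string algebra a string that leaves the run of a band and meets another band cannot
  return to the first one, since two non-commuting closed words would generate infinitely many bands.
  Hence along a path of weak bridges the bands are distinct, each runs less than one
  period to either side of its marked occurrence, and never into a neighbouring band. Whether a band is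
  removed from \<open>t(u\<^sub>n) u\<^sub>n \<cdots> t(u\<^sub>1) u\<^sub>1 s(u\<^sub>1)\<close>, once or twice (by the skeleton and by \<open>\<hh>\<close>), depends
  on the bridge on its left and on the H-equivalence class of the word on its right. Both are
  unchanged when a bridge \<open>u\<^sub>j\<close> is replaced by a path \<open>P\<close> with \<open>\<hh>(P) = u\<^sub>j\<close>, so such a
  substitution does not change \<open>\<hh>\<close>. As paths of weak bridges have bounded length, a longest path
  representing a given weak arch bridge consists of arch bridges.
\<close>

section \<open>Words\<close>

text \<open>The definition works in two passes: the skeleton deletes periods anywhere in the whole
  word, and only then do the operations \<open>h_band\<close> act, one band after the other.
  Replacing a bridge by a path disturbs both passes. They are therefore merged into a single pass
  \<open>run\<close> from the left, whose decision at a band uses the treated part on its left and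
  the unreduced word on its right. The hard outcome of this pass is the removal of two periods of a
  band \<open>b = k @ h\<close>: it consumes a suffix \<open>h\<close> of the treated part and a
  prefix \<open>k\<close> of the next bridge, so that \<open>k\<close> is missing when an inserted
  path is treated further. \<open>Hred2\<close>, \<open>Hsteps\<close> and
  \<open>simulate_run\<close> exist for this case. Two facts about concatenation carry the rest.
  Relations are directed, so strings overlapping in a word with syllables of both directions can be
  glued (\<open>glue\<close>); hence the H-class of a word depends only on a left part containing
  such a word. And a band begins and ends at a change of direction, where strings may be joined
  without overlap (\<open>glue_cut\<close>).\<close>

definition pow :: "'a list \<Rightarrow> nat \<Rightarrow> 'a list" where
  "pow w n = concat (replicate n w)"

lemma pow_0 [simp]: "pow w 0 = []" and pow_Suc [simp]: "pow w (Suc n) = w @ pow w n"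
  by (simp_all add: pow_def)

lemma pow_add: "pow w (m + n) = pow w m @ pow w n"
  by (induction m) simp_all

lemma pow_Suc_right: "pow w (Suc n) = pow w n @ w"
  using pow_add[of w n 1] by simp

lemma pow_mult: "pow w (m * n) = pow (pow w m) n"
  by (induction n) (simp_all add: pow_add)

lemma length_pow [simp]: "length (pow w n) = n * length w"
  by (induction n) simp_all

lemma set_pow: "n > 0 \<Longrightarrow> set (pow w n) = set w"
  by (auto simp: pow_def)

lemma same_length_prefix_eq: "a @ r = b @ s \<Longrightarrow> length a = length b \<Longrightarrow> a = b"
  by simp

lemma append_eq_split:
  assumes "a @ b = c @ d" "length a \<le> length c"
  obtains r where "c = a @ r" "b = r @ d"
  using assms by (auto simp: append_eq_append_conv2)

lemma append_eq_split_right: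
  assumes "a @ b = c @ d" "length d \<le> length b"
  obtains r where "c = a @ r" "b = r @ d"
proof (rule append_eq_split[OF assms(1)])
  show "length a \<le> length c"
    using arg_cong[OF assms(1), of length] assms(2) by simp
qed (use that in blast)

lemma pow_commute: "x @ y = y @ x \<Longrightarrow> pow x n @ y = y @ pow x n"
proof (induction n)
  case (Suc n)
  assume c: "x @ y = y @ x"
  have "pow x (Suc n) @ y = x @ (pow x n @ y)" by simp
  also have "\<dots> = (x @ y) @ pow x n" using Suc c by simp
  finally show ?case by (simp add: c)
qed simp

text \<open>Some power \<open>z\<close> of \<open>pow x n\<close> is at least as long as
  \<open>y\<close>. Both \<open>x\<close> and \<open>y\<close> commute with \<open>z\<close> and are
  prefixes of it, so \<open>x @ y\<close> and \<open>y @ x\<close> are prefixes of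
  \<open>z @ z\<close> of equal length.\<close>

lemma commute_if_pow_commute:
  assumes "y @ pow x n = pow x n @ y" and "n > 0"
  shows "x @ y = y @ x"
proof (cases "x = [] \<or> y = []")
  case False
  define z where "z = pow (pow x n) (length y)"
  have zc: "z @ y = y @ z" unfolding z_def by (rule pow_commute) (use assms in simp)
  have zx: "z @ x = x @ z"
    unfolding z_def by (intro pow_commute) simp
  have "length z \<ge> length y"
    using False assms(2) unfolding z_def by (cases x; cases n) auto
  then obtain r where r: "z = y @ r"
    using append_eq_split[OF zc[symmetric]] by metis
  obtain m k where "n = Suc m" "length y = Suc k"
    using False assms(2) by (metis gr0_implies_Suc length_greater_0_conv)
  then obtain r2 where r2: "z = x @ r2"
    unfolding z_def by simp
  have "x @ y @ r = z @ x" using r zx by simp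
  then have "(x @ y) @ (r @ r2) = (z @ x) @ r2" by simp
  then have "(x @ y) @ (r @ r2) = z @ z" using r2 by simp
  moreover have "y @ x @ r2 = z @ y" using r2 zc by simp
  then have "(y @ x) @ (r2 @ r) = (z @ y) @ r" by simp
  then have "(y @ x) @ (r2 @ r) = z @ z" using r by simp
  ultimately have "(x @ y) @ (r @ r2) = (y @ x) @ (r2 @ r)" by (rule trans[OF _ sym])
  then show ?thesis
    by (rule same_length_prefix_eq) simp
qed auto

lemma commute_common_root:
  assumes "x @ y = y @ x"
  obtains z m n where "x = pow z m" "y = pow z n"
  using comm_append_are_replicate[OF assms] unfolding pow_def by metis

section \<open>Conjugate words and primitive words\<close>

definition rot :: "'a list \<Rightarrow> 'a list \<Rightarrow> bool" where
  "rot b c \<longleftrightarrow> (\<exists>x y. b = x @ y \<and> c = y @ x)"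

lemma rot_iff: "rot b c \<longleftrightarrow> (\<exists>k. c = rotate k b)"
proof
  assume "rot b c"
  then obtain x y where "b = x @ y" "c = y @ x" by (auto simp: rot_def)
  then have "c = rotate (length x) b" by (simp add: rotate_append)
  then show "\<exists>k. c = rotate k b" ..
next
  assume "\<exists>k. c = rotate k b"
  then obtain k where "c = rotate k b" ..
  then have "c = drop (k mod length b) b @ take (k mod length b) b"
    by (simp add: rotate_drop_take)
  then show "rot b c" unfolding rot_def by (metis append_take_drop_id)
qed

lemma rot_refl [simp, intro]: "rot b b"
  by (auto simp: rot_def)

lemma rot_sym: "rot b c \<Longrightarrow> rot c b"
  by (auto simp: rot_def)

lemma rot_trans: "rot b c \<Longrightarrow> rot c d \<Longrightarrow> rot b d"
  by (auto simp: rot_iff rotate_rotate)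

lemma rot_length: "rot b c \<Longrightarrow> length c = length b"
  by (auto simp: rot_def)

lemma rot_set: "rot b c \<Longrightarrow> set c = set b"
  by (auto simp: rot_def)

lemma rot_append_commute: "rot (x @ y) (y @ x)"
  by (auto simp: rot_def)

text \<open>Peeling \<open>c\<close> off the front of \<open>h\<close> preserves the equation; once
  \<open>h\<close> is shorter than \<open>c\<close>, it reads \<open>c = h @ y\<close> and
  \<open>b = y @ h\<close>.\<close>

lemma rot_if_conj:
  assumes "h @ b = c @ h"
  shows "rot b c"
  using assms
proof (induction "length h" arbitrary: h rule: less_induct)
  case less
  show ?case
  proof (cases "c = [] \<or> length h < length c")
    case True
    show ?thesis
    proof (cases "c = []")
      case False
      then have "length h < length c" using True by auto
      then obtain y where y: "c = h @ y" "b = y @ h"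
        using append_eq_split[OF less.prems] by auto
      with y show ?thesis by (auto simp: rot_def)
    qed (use less.prems in auto)
  next
    case False
    then obtain h' where h': "h = c @ h'" "h = h' @ b"
      using append_eq_split[OF less.prems[symmetric]] by auto
    then have "h' @ b = c @ h'" by simp
    moreover have "length h' < length h" using h' False by simp
    ultimately show ?thesis using less.hyps by blast
  qed
qed

definition prim :: "'a list \<Rightarrow> bool" where
  "prim w \<longleftrightarrow> w \<noteq> [] \<and> (\<forall>z n. w = pow z n \<longrightarrow> n = 1)"

text \<open>The root \<open>z\<close> commutes with its power \<open>y @ x\<close>, so it can be
  carried across \<open>y\<close> and becomes a conjugate \<open>v\<close>. Cancelling
  \<open>y\<close> in \<open>pow z n @ y = y @ pow v n\<close> gives the claim.\<close>

lemma pow_rot: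
  assumes "y @ x = pow z n"
  shows "\<exists>v. rot z v \<and> x @ y = pow v n"
proof (cases n)
  case (Suc m)
  have "z @ y @ x = y @ x @ z"
    using assms by (metis append.assoc pow_Suc pow_Suc_right Suc)
  then have e: "(z @ y) @ x = y @ (x @ z)" by simp
  then obtain v where v: "z @ y = y @ v" "x @ z = v @ x"
    using append_eq_split[OF e[symmetric]] by auto
  have "pow z n @ y = y @ pow v n"
  proof (induction n)
    case (Suc n)
    have "pow z (Suc n) @ y = z @ (pow z n @ y)" by simp
    also have "\<dots> = (z @ y) @ pow v n" by (simp add: Suc)
    finally show ?case by (simp add: v(1))
  qed simp
  then have "y @ x @ y = y @ pow v n" using assms[symmetric] by simp
  then show ?thesis using rot_if_conj[OF v(1)[symmetric]] rot_sym by auto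
qed (use assms in auto)

lemma pow_append_conj: "pow (x @ y) (Suc n) = x @ pow (y @ x) n @ y"
  by (induction n) simp_all

lemma prim_rot: "prim b \<Longrightarrow> rot b c \<Longrightarrow> prim c"
  unfolding prim_def rot_def using pow_rot by (metis append_is_Nil_conv)

lemma prim_commute:
  assumes "prim b" "b @ y = y @ b"
  obtains j where "y = pow b j"
proof -
  obtain z m n where z: "b = pow z m" "y = pow z n"
    using commute_common_root[OF assms(2)] .
  then have "m = 1" using assms(1) by (auto simp: prim_def)
  then show thesis using z that by simp
qed


section \<open>Factors of a glued word\<close>

lemma sublist_obtain:
  assumes "sublist d w" obtains p q where "w = p @ d @ q"
  using assms by (auto simp: sublist_def)

lemma sublist_of_glue:
  assumes "sublist d (x @ m @ y)"
  shows "sublist d (x @ m) \<or> sublist d (m @ y) \<or> sublist m d"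
proof -
  obtain p q where e: "x @ m @ y = p @ d @ q"
    using assms by (rule sublist_obtain)
  show ?thesis
  proof (cases "length x \<le> length p")
    case True
    then obtain r where "p = x @ r" "m @ y = r @ d @ q"
      using append_eq_split[OF e] by blast
    then show ?thesis by (auto simp: sublist_def)
  next
    case False
    then obtain r where r: "x = p @ r" "d @ q = r @ m @ y"
      using append_eq_split[OF e[symmetric]] by auto
    show ?thesis
    proof (cases "length y \<le> length q")
      case True
      have "d @ q = (r @ m) @ y" using r by simp
      then obtain s where "r @ m = d @ s"
        using append_eq_split_right[of d q "r @ m" y] True by metis
      then have "x @ m = p @ d @ s" using r by simp
      then show ?thesis by (auto simp: sublist_def)
    next
      case F: False
      have "(r @ m) @ y = d @ q" using r by simp
      then obtain s where "d = (r @ m) @ s"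
        using append_eq_split_right[of "r @ m" y d q] F by auto
      then show ?thesis by (auto simp: sublist_def)
    qed
  qed
qed

section \<open>Letters of strings\<close>

fun lts :: "('v, 'a) str \<Rightarrow> 'a syllable list" where
  "lts (Triv v i) = []"
| "lts (Letters w) = w"

lemma str_mult_SomeD:
  assumes "str_mult \<Lambda> x y = Some z"
  shows "is_string \<Lambda> x \<and> is_string \<Lambda> y \<and> is_string \<Lambda> z \<and> lts z = lts x @ lts y"
  using assms by (cases x; cases y) (auto split: if_splits simp del: is_string.simps)

lemma str_prod_SomeD:
  "str_prod \<Lambda> xs = Some y \<Longrightarrow>
     is_string \<Lambda> y \<and> (\<forall>x\<in>set xs. is_string \<Lambda> x) \<and> lts y = concat (map lts xs)"
proof (induction \<Lambda> xs arbitrary: y rule: str_prod.induct)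
  case (3 \<Lambda> x y' ys)
  then obtain z where "str_prod \<Lambda> (y' # ys) = Some z" "str_mult \<Lambda> x z = Some y"
    by (auto simp: bind_eq_Some_conv)
  with 3 str_mult_SomeD show ?case by fastforce
qed (auto split: if_splits)

lemma str_prod_lts:
  "str_prod \<Lambda> xs = Some (Letters w) \<Longrightarrow> w = concat (map lts xs)"
  using str_prod_SomeD by fastforce

text \<open>\<open>ends\<close> and \<open>signs\<close> provide the strings of length 0 at the ends
  of a word, \<open>long_paths\<close> forces closed strings to change direction, and
  \<open>domestic\<close> bounds the length and the number of bands.\<close>

locale dom_string_algebra =
  fixes \<Lambda> :: "('v, 'a) presentation" and B :: "('v, 'a) str set"
  assumes ends: "a \<in> arrows \<Lambda> \<Longrightarrow> src \<Lambda> a \<in> vertices \<Lambda> \<and> tgt \<Lambda> a \<in> vertices \<Lambda>"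
    and signs: "a \<in> arrows \<Lambda> \<Longrightarrow> sgn_src \<Lambda> a \<in> {1, -1} \<and> sgn_tgt \<Lambda> a \<in> {1, -1}"
    and long_paths: "\<exists>m. \<forall>p. quiver_path \<Lambda> p \<and> length p \<ge> m \<longrightarrow> (\<exists>r\<in>relations \<Lambda>. sublist r p)"
    and domestic: "domestic \<Lambda>"
    and reps: "band_reps \<Lambda> B"
begin

section \<open>Strings of positive length as lists of syllables\<close>

definition S :: "'a syllable list \<Rightarrow> bool" where
  "S w \<longleftrightarrow> is_string \<Lambda> (Letters w)"

definition adj :: "'a syllable \<Rightarrow> 'a syllable \<Rightarrow> bool" where
  "adj \<alpha> \<beta> \<longleftrightarrow> syl_src \<Lambda> \<alpha> = syl_tgt \<Lambda> \<beta> \<and> \<alpha> \<noteq> syl_inv \<beta>"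

definition undir :: "'a syllable list \<Rightarrow> bool" where
  "undir w \<longleftrightarrow> (\<exists>a. Dir a \<in> set w) \<and> (\<exists>a. Inv a \<in> set w)"

lemma S_iff: "S w \<longleftrightarrow> w \<noteq> [] \<and> arrow_of ` set w \<subseteq> arrows \<Lambda> \<and> successively adj w \<and>
   (\<forall>r\<in>relations \<Lambda>. \<not> sublist (map Dir r) w \<and> \<not> sublist (rev (map Inv r)) w)"
  unfolding S_def adj_def by simp

lemma S_nonempty: "S w \<Longrightarrow> w \<noteq> []"
  by (simp add: S_iff)

lemma S_sublist: "S w \<Longrightarrow> sublist v w \<Longrightarrow> v \<noteq> [] \<Longrightarrow> S v"
proof -
  assume w: "S w" and sub: "sublist v w" and v: "v \<noteq> []"
  obtain p q where e: "w = p @ v @ q" using sub by (rule sublist_obtain)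
  have "\<not> sublist d v" if "\<not> sublist d w" for d
    using that sub sublist_order.order.trans by blast
  then have "\<forall>r\<in>relations \<Lambda>. \<not> sublist (map Dir r) v \<and> \<not> sublist (rev (map Inv r)) v"
    using w unfolding S_iff by blast
  with w v show "S v"
    unfolding S_iff e by (auto simp: successively_append_iff)
qed

lemma S_factor: "S (x @ m @ y) \<Longrightarrow> m \<noteq> [] \<Longrightarrow> S m"
  by (rule S_sublist) auto

lemma S_prefix: "S (x @ y) \<Longrightarrow> x \<noteq> [] \<Longrightarrow> S x"
  by (rule S_sublist) auto

lemma S_suffix: "S (x @ y) \<Longrightarrow> y \<noteq> [] \<Longrightarrow> S y"
  by (rule S_sublist) auto

lemma S_adj: "S (x @ y) \<Longrightarrow> x \<noteq> [] \<Longrightarrow> y \<noteq> [] \<Longrightarrow> adj (last x) (hd y)"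
  by (auto simp: S_iff successively_append_iff)

lemma undir_nonempty: "undir m \<Longrightarrow> m \<noteq> []"
  by (auto simp: undir_def)

text \<open>A relation is directed, so as a factor of \<open>x @ m @ y\<close> it cannot contain
  \<open>m\<close>; it would then lie in one of the two given strings.\<close>

lemma glue:
  assumes "S (x @ m)" "S (m @ y)" "undir m"
  shows "S (x @ m @ y)"
proof -
  have m: "m \<noteq> []" using assms(3) by (rule undir_nonempty)
  have "\<not> sublist (map Dir r) (x @ m @ y) \<and> \<not> sublist (rev (map Inv r)) (x @ m @ y)"
    if r: "r \<in> relations \<Lambda>" for r
  proof -
    have "\<not> sublist m (map Dir r)" "\<not> sublist m (rev (map Inv r))"
      using assms(3) by (auto simp: undir_def dest!: set_mono_sublist)
    then show ?thesis
      using assms(1,2) r sublist_of_glue[of _ x m y] unfolding S_iff by blast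
  qed
  with assms(1,2) m show ?thesis
    by (auto simp: S_iff successively_append_iff)
qed

text \<open>The words of \<open>\<rho>\<close> and \<open>\<rho>\<close>-inverse are directed, so none of them runs across a change of direction.\<close>

lemma glue_cut:
  assumes "S x" "S y" "adj (last x) (hd y)" "last x = Inv a" "hd y = Dir c"
  shows "S (x @ y)"
proof -
  have ne: "x \<noteq> []" "y \<noteq> []" using assms(1,2) S_nonempty by auto
  have "\<not> sublist d (x @ y)" if "\<not> sublist d x" "\<not> sublist d y" "\<not> undir d" for d
  proof
    assume "sublist d (x @ y)"
    then have "\<exists>d1 d2. d = d1 @ d2 \<and> suffix d1 x \<and> prefix d2 y"
      using that(1,2) by (simp add: sublist_append)
    then obtain d1 d2 where d: "d = d1 @ d2" "suffix d1 x" "prefix d2 y"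
      by (elim exE conjE)
    have "d1 \<noteq> []"
      using prefix_imp_sublist[OF d(3)] that(2) d(1) by (cases d1) simp_all
    moreover have "d2 \<noteq> []"
      using suffix_imp_sublist[OF d(2)] that(1) d(1) by (cases d2) simp_all
    moreover obtain p q where "x = p @ d1" "y = d2 @ q"
      using d(2,3) unfolding suffix_def prefix_def by blast
    ultimately have "last d1 = Inv a" "hd d2 = Dir c" "d1 \<noteq> []" "d2 \<noteq> []"
      using assms(4,5) by simp_all
    then have "Inv a \<in> set d1" "Dir c \<in> set d2"
      by (metis last_in_set, metis hd_in_set)
    with d that show False by (auto simp: undir_def)
  qed
  moreover have "\<not> undir (map Dir r)" "\<not> undir (rev (map Inv r))" for r :: "'a list"
    by (auto simp: undir_def)
  ultimately have "\<forall>r\<in>relations \<Lambda>. \<not> sublist (map Dir r) (x @ y) \<and> \<not> sublist (rev (map Inv r)) (x @ y)"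
    using assms(1,2) unfolding S_iff by blast
  then show ?thesis
    using assms ne by (auto simp: S_iff successively_append_iff)
qed

lemma str_prod_Letters:
  assumes "S (concat ws)" "\<forall>w\<in>set ws. w \<noteq> []" "ws \<noteq> []"
  shows "str_prod \<Lambda> (map Letters ws) = Some (Letters (concat ws))"
  using assms
proof (induction ws)
  case (Cons w ws)
  show ?case
  proof (cases ws)
    case Nil
    with Cons.prems show ?thesis by (simp add: S_def)
  next
    case (Cons v vs)
    then have ne: "concat ws \<noteq> []" "w \<noteq> []" using Cons.prems by auto
    have s: "S (w @ concat ws)" using Cons.prems by simp
    then have s2: "S (concat ws)" "S w"
      using S_suffix[OF s] S_prefix[OF s] ne by auto
    with Cons.IH Cons.prems Cons
    have "str_prod \<Lambda> (map Letters ws) = Some (Letters (concat ws))" by auto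
    then show ?thesis
      using Cons s s2 by (simp add: S_def del: is_string.simps)
  qed
qed simp

lemma str_prod_pow:
  "S (pow z n) \<Longrightarrow> n \<ge> 1 \<Longrightarrow> str_prod \<Lambda> (replicate n (Letters z)) = Some (Letters (pow z n))"
  using str_prod_Letters[of "replicate n z"]
  by (cases "z = []") (auto simp: pow_def S_iff)

section \<open>Bands\<close>

definition bnd :: "'a syllable list \<Rightarrow> bool" where
  "bnd b \<longleftrightarrow> is_band \<Lambda> (Letters b)"

lemma is_bandD: "is_band \<Lambda> b \<Longrightarrow> \<exists>w. b = Letters w \<and> bnd w"
  by (auto simp: is_band_def bnd_def)

lemma cyc_perm_Letters: "cyc_perm (Letters b) y \<longleftrightarrow> (\<exists>c. y = Letters c \<and> rot b c)"
  by (auto simp: cyc_perm_def rot_iff)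

lemma bnd_iff:
  "bnd b \<longleftrightarrow> b \<noteq> [] \<and> (\<exists>a. hd b = Dir a) \<and> (\<exists>a. last b = Inv a) \<and> (\<forall>n\<ge>1. S (pow b n)) \<and> prim b"
proof
  assume b: "bnd b"
  have ne: "b \<noteq> []" using b by (auto simp: bnd_def is_band_def)
  have "S (pow b n)" if "n \<ge> 1" for n
  proof -
    have "str_prod \<Lambda> (replicate n (Letters b)) \<noteq> None"
      using b that unfolding bnd_def is_band_def by simp
    then obtain y where "str_prod \<Lambda> (replicate n (Letters b)) = Some y" by blast
    from str_prod_SomeD[OF this] that ne show ?thesis
      by (cases y) (auto simp: S_def pow_def map_replicate_const[symmetric] simp del: is_string.simps)
  qed
  moreover have "prim b"
    unfolding prim_def
  proof (intro conjI allI impI ne)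
    fix z n assume z: "b = pow z n"
    have "n \<ge> 1" using ne z by (cases n) auto
    moreover have "S b" using b by (auto simp: bnd_def is_band_def S_def)
    ultimately have "str_prod \<Lambda> (replicate n (Letters z)) = Some (Letters b)"
      using str_prod_pow z by metis
    then have "\<not> n \<ge> 2" using b unfolding bnd_def is_band_def by blast
    with \<open>n \<ge> 1\<close> show "n = 1" by simp
  qed
  ultimately show "b \<noteq> [] \<and> (\<exists>a. hd b = Dir a) \<and> (\<exists>a. last b = Inv a) \<and> (\<forall>n\<ge>1. S (pow b n)) \<and> prim b"
    using b ne by (auto simp: bnd_def is_band_def)
next
  assume b: "b \<noteq> [] \<and> (\<exists>a. hd b = Dir a) \<and> (\<exists>a. last b = Inv a) \<and> (\<forall>n\<ge>1. S (pow b n)) \<and> prim b"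
  then have s: "S (pow b 1)" "S (pow b (Suc (Suc 0)))" by (metis le_refl, metis Suc_le_mono le0 One_nat_def)
  then have "adj (last b) (hd b)" using b S_adj[of b b] by simp
  moreover have "\<not> (n \<ge> 2 \<and> str_prod \<Lambda> (replicate n z) = Some (Letters b))" for z n
  proof
    assume z: "n \<ge> 2 \<and> str_prod \<Lambda> (replicate n z) = Some (Letters b)"
    then have "b = concat (map lts (replicate n z))" using str_prod_lts by blast
    then have "b = pow (lts z) n" by (simp add: pow_def)
    then have "n = 1" using b unfolding prim_def by blast
    then show False using z by simp
  qed
  moreover have "str_prod \<Lambda> (replicate n (Letters b)) \<noteq> None" if "n \<ge> 1" for n
    using str_prod_pow[of b n] that b by auto
  ultimately show "bnd b"
    using b s unfolding bnd_def is_band_def by (auto simp: adj_def S_def)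
qed

lemma bnd_nonempty: "bnd b \<Longrightarrow> b \<noteq> []"
  by (simp add: bnd_iff)

lemma bnd_bounded: "\<exists>L. \<forall>b. bnd b \<longrightarrow> length b \<le> L"
proof -
  have "finite (lts ` {b. is_band \<Lambda> b})"
    using domestic by (auto simp: domestic_def)
  then have "finite {b. bnd b}"
    by (rule finite_subset[rotated]) (force simp: bnd_def)
  then have "\<forall>b\<in>{b. bnd b}. length b \<le> Max (length ` {b. bnd b})"
    by simp
  then show ?thesis by blast
qed

text \<open>Such a rotation \<open>c\<close> of a band, as it occurs inside a string, is called a
  window of the band below.\<close>

definition brot :: "'a syllable list \<Rightarrow> 'a syllable list \<Rightarrow> bool" where
  "brot b c \<longleftrightarrow> bnd b \<and> rot b c"

lemma brot_refl: "bnd b \<Longrightarrow> brot b b"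
  by (simp add: brot_def)

lemma brot_rot: "brot b c \<Longrightarrow> rot c d \<Longrightarrow> brot b d"
  by (auto simp: brot_def intro: rot_trans)

lemma brot_prim: "brot b c \<Longrightarrow> prim c"
  by (auto simp: brot_def bnd_iff intro: prim_rot)

lemma brot_undir: "brot b c \<Longrightarrow> undir c"
  unfolding brot_def undir_def bnd_iff
  by (metis rot_set hd_in_set last_in_set)

lemma brot_nonempty: "brot b c \<Longrightarrow> c \<noteq> []"
  using brot_undir undir_nonempty by blast

lemma brot_length: "brot b c \<Longrightarrow> length c = length b"
  by (auto simp: brot_def rot_length)

lemma brot_pow: "brot b c \<Longrightarrow> n \<ge> 1 \<Longrightarrow> S (pow c n)"
proof -
  assume c: "brot b c" and n: "n \<ge> 1"
  then obtain x y where xy: "b = x @ y" "c = y @ x" by (auto simp: brot_def rot_def)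
  have "S (pow b (Suc n))" using c by (auto simp: brot_def bnd_iff)
  then have "S (x @ pow c n @ y)" using xy pow_append_conj by metis
  moreover have "pow c n \<noteq> []" using brot_nonempty[OF c] n by (cases n) auto
  ultimately show "S (pow c n)" by (rule S_factor)
qed

lemma brot_S: "brot b c \<Longrightarrow> S c"
  using brot_pow[of b c 1] by simp

lemma brot_S2: "brot b c \<Longrightarrow> S (c @ c)"
  using brot_pow[of b c "Suc (Suc 0)"] by simp

lemma extend_left: "brot b c \<Longrightarrow> S (c @ w) \<Longrightarrow> S (c @ c @ w)"
  by (rule glue[OF brot_S2]) (auto intro: brot_undir)

subsection \<open>Closed strings\<close>

definition loop :: "'a syllable list \<Rightarrow> bool" where
  "loop z \<longleftrightarrow> z \<noteq> [] \<and> (\<forall>n\<ge>1. S (pow z n))"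

lemma map_Dir_path: "S (map Dir p) \<Longrightarrow> quiver_path \<Lambda> p"
  by (auto simp: S_iff quiver_path_def adj_def successively_map image_image
        elim!: successively_mono)

lemma map_Inv_path: "S (map Inv p) \<Longrightarrow> quiver_path \<Lambda> (rev p)"
  by (auto simp: S_iff quiver_path_def adj_def successively_map image_image successively_rev
        elim!: successively_mono)

text \<open>A directed closed word has powers that are arbitrarily long paths, or inverses of such,
  without a relation.\<close>

lemma loop_undir: "loop z \<Longrightarrow> undir z"
proof (rule ccontr)
  assume z: "loop z" and nu: "\<not> undir z"
  obtain m where m: "\<And>p. quiver_path \<Lambda> p \<Longrightarrow> length p \<ge> m \<Longrightarrow> \<exists>r\<in>relations \<Lambda>. sublist r p"
    using long_paths by blast
  define w where "w = pow z (Suc m)"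
  have w: "S w" "length w \<ge> m" "set w = set z"
    using z set_pow[of "Suc m" z] unfolding w_def loop_def
    by (cases z; simp del: pow_Suc)+
  consider "\<forall>s\<in>set w. \<exists>a. s = Dir a" | "\<forall>s\<in>set w. \<exists>a. s = Inv a"
    using nu w(3) unfolding undir_def by (metis syllable.exhaust)
  then show False
  proof cases
    case 1
    then have e: "w = map Dir (map arrow_of w)"
      by (auto simp: map_idI) (metis (no_types, lifting) map_idI o_apply syllable.sel(1))
    then have "quiver_path \<Lambda> (map arrow_of w)" using map_Dir_path w(1) by metis
    then obtain r where "r \<in> relations \<Lambda>" "sublist r (map arrow_of w)"
      using m w(2) by (metis length_map)
    then have "sublist (map Dir r) w" using map_mono_sublist e by metis
    then show False using w(1) \<open>r \<in> relations \<Lambda>\<close> unfolding S_iff by blast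
  next
    case 2
    then have e: "w = map Inv (map arrow_of w)"
      by (auto simp: map_idI) (metis (no_types, lifting) map_idI o_apply syllable.sel(2))
    then have "quiver_path \<Lambda> (rev (map arrow_of w))" using map_Inv_path w(1) by metis
    then obtain r where r: "r \<in> relations \<Lambda>" "sublist r (rev (map arrow_of w))"
      using m w(2) by (metis length_map length_rev)
    then have "sublist (rev r) (map arrow_of w)" by (simp only: sublist_rev_right)
    then have "sublist (rev (map Inv r)) w"
      using map_mono_sublist[of "rev r" "map arrow_of w" Inv] e by (simp only: rev_map)
    then show False using w(1) r unfolding S_iff by blast
  qed
qed

lemma undir_cut:
  assumes "undir z"
  obtains x y a c where "z = x @ y" "hd (y @ x) = Dir a" "last (y @ x) = Inv c"
proof -
  define isD where "isD = (\<lambda>s::'a syllable. \<exists>a. s = Dir a)"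
  have nD: "\<not> isD s \<longleftrightarrow> (\<exists>a. s = Inv a)" for s by (cases s) (auto simp: isD_def)
  have zne: "z \<noteq> []" using assms by (rule undir_nonempty)
  have ex: "\<exists>s\<in>set z. isD s" "\<exists>s\<in>set z. \<not> isD s"
    using assms unfolding undir_def nD by (auto simp: isD_def)
  consider "isD (hd z)" "\<not> isD (last z)" | "\<not> isD (hd z)" | "isD (last z)" by blast
  then have "\<exists>x y. z = x @ y \<and> isD (hd (y @ x)) \<and> \<not> isD (last (y @ x))"
  proof cases
    case 1
    then show ?thesis by (intro exI[of _ "[]"] exI[of _ z]) simp
  next
    case 2
    obtain ys s zs where "z = ys @ s # zs" "isD s" "\<forall>y\<in>set ys. \<not> isD y"
      using split_list_first_prop[OF ex(1)] by blast
    moreover from this 2 have "ys \<noteq> []" by auto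
    ultimately show ?thesis by (intro exI[of _ ys] exI[of _ "s # zs"]) auto
  next
    case 3
    obtain ys s zs where "z = ys @ s # zs" "\<not> isD s" "\<forall>y\<in>set zs. isD y"
      using split_list_last_prop[OF ex(2)] by blast
    moreover from this 3 have "zs \<noteq> []" by auto
    ultimately show ?thesis by (intro exI[of _ "ys @ [s]"] exI[of _ zs]) auto
  qed
  then show thesis using that unfolding nD by (auto simp: isD_def)
qed

text \<open>Rotated to a place where an inverse syllable is followed cyclically by a direct one, a
  closed string is a power of a band. Thus domesticity bounds the primitive period of every closed
  string.\<close>

lemma loop_root:
  assumes "loop z"
  obtains b v m where "bnd b" "length v = length b" "z = pow v m"
proof -
  obtain x y a c where z: "z = x @ y" "hd (y @ x) = Dir a" "last (y @ x) = Inv c"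
    using undir_cut[OF loop_undir[OF assms]] by blast
  define w where "w = y @ x"
  have wne: "w \<noteq> []" using z assms by (auto simp: loop_def w_def)
  \<comment> \<open>A shortest root is primitive and inherits the first and the last syllable of
    \<open>w\<close>, so it is a band.\<close>
  define P where "P = (\<lambda>b. b \<noteq> [] \<and> (\<exists>m. w = pow b m))"
  have "P w" unfolding P_def using wne by (auto intro: exI[of _ 1])
  then obtain b where b: "P b" "\<And>b'. P b' \<Longrightarrow> length b \<le> length b'"
    using arg_min_nat_lemma[of P w length] by blast
  then obtain m where m: "w = pow b m" "b \<noteq> []" unfolding P_def by blast
  have m0: "m \<ge> 1" using m wne by (cases m) auto
  have hl: "hd b = hd w" "last b = last w"
  proof -
    obtain k where k: "m = Suc k" using m0 by (cases m) auto
    show "hd b = hd w" using m k by simp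
    have "w = pow b k @ b" using m k pow_Suc_right by metis
    then show "last b = last w" using m(2) by simp
  qed
  have "S (pow b n)" if n: "n \<ge> 1" for n
  proof -
    have "S (pow z (Suc n))" using assms by (auto simp: loop_def)
    then have "S (x @ pow w n @ y)" using z pow_append_conj unfolding w_def by metis
    moreover have "pow w n = pow b n @ pow b (n * m - n)"
    proof -
      have "n * m = n + (n * m - n)" using m0 by simp
      then show ?thesis using m pow_mult[of b m n] pow_add[of b n "n * m - n"] by (metis mult.commute)
    qed
    ultimately have "S (x @ pow b n @ (pow b (n * m - n) @ y))" by simp
    moreover have "pow b n \<noteq> []" using m n by (cases n) auto
    ultimately show ?thesis by (rule S_factor)
  qed
  moreover have "prim b"
    unfolding prim_def
  proof (intro conjI allI impI m(2))
    fix v n assume v: "b = pow v n"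
    then have vne: "v \<noteq> []" "n > 0" using m(2) by (cases n; auto simp: pow_def)+
    have "w = pow v (n * m)" using v m pow_mult by metis
    then have "length b \<le> length v" using b vne unfolding P_def by blast
    then show "n = 1" using v vne by simp
  qed
  ultimately have "bnd b" using m hl z unfolding bnd_iff w_def by auto
  moreover obtain v where "rot b v" "z = pow v m"
    using pow_rot[of y x b m] m z unfolding w_def by auto
  ultimately show thesis using that rot_length by blast
qed

text \<open>This is where domesticity acts. The closed strings \<open>pow x j @ y\<close> have roots
  of bounded length, whereas for large \<open>j\<close> they begin with a long power of
  \<open>x\<close>. The two periods must then agree, which forces \<open>x\<close> and
  \<open>y\<close> to commute.\<close>

lemma loop_commute:
  assumes "loop x" "S (x @ y @ x)"
  shows "x @ y = y @ x"
proof -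
  have u: "undir x" using assms(1) by (rule loop_undir)
  have "S (pow x (Suc (Suc 0)))" using assms(1) unfolding loop_def by (metis One_nat_def Suc_le_mono le0)
  then have xx: "S (x @ x)" by simp
  have ex: "S (x @ x @ w)" if "S (x @ w)" for w
    using glue[OF xx that u] .
  have ey: "S (x @ y @ x @ w)" if "S (x @ w)" for w
    using glue[of "x @ y" x w] that assms(2) u by simp
  obtain L where L: "\<And>b. bnd b \<Longrightarrow> length b \<le> L" using bnd_bounded by blast
  \<comment> \<open>The exponent exceeds the length \<open>p\<close> of the root \<open>v\<close>,
    so that \<open>pow x p\<close> is a prefix of \<open>z\<close>.\<close>
  define z where "z = pow x (Suc L) @ y"
  have p: "S (pow x (Suc j) @ y @ x @ w)" if "S (x @ w)" for w j
  proof (induction j)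
    case (Suc j)
    then show ?case using ex[of "pow x j @ y @ x @ w"] by simp
  qed (use ey[OF that] in simp)
  have "\<exists>w. pow z k @ x = x @ w \<and> S (x @ w)" for k
  proof (induction k)
    case 0
    have "S x" using assms(2) u S_prefix undir_nonempty by blast
    then show ?case by auto
  next
    case (Suc k)
    then obtain w where w: "pow z k @ x = x @ w" "S (x @ w)" by blast
    have "pow z (Suc k) @ x = z @ x @ w" using w by simp
    also have "\<dots> = pow x (Suc L) @ y @ x @ w" by (simp add: z_def)
    finally have e: "pow z (Suc k) @ x = pow x (Suc L) @ y @ x @ w" .
    with p[OF w(2), of L] show ?case by (intro exI[of _ "pow x L @ y @ x @ w"]) simp
  qed
  then have "S (pow z k @ x)" for k by metis
  moreover have zne: "z \<noteq> []" using u undir_nonempty by (auto simp: z_def)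
  moreover have "pow z k \<noteq> []" if "k \<ge> 1" for k using zne that by (cases k) auto
  ultimately have "loop z" unfolding loop_def using S_prefix by blast
  then obtain b v m where v: "bnd b" "length v = length b" "z = pow v m"
    by (rule loop_root)
  define p where "p = length v"
  define q where "q = length x"
  have pL: "p \<le> L" "p > 0" using v L bnd_nonempty[OF v(1)] unfolding p_def by auto
  have "m * p = Suc L * q + length y"
    using arg_cong[OF v(3), of length] unfolding z_def p_def q_def by (simp add: algebra_simps)
  moreover have "p * q \<le> Suc L * q" using pL by (intro mult_right_mono) auto
  ultimately have "q * p \<le> m * p" by (simp add: mult.commute)
  then have mq: "q \<le> m" using pL by simp
  have 1: "z = pow v q @ pow v (m - q)"
    using v(3) pow_add[of v q "m - q"] mq by simp
  have 2: "z = pow x p @ (pow x (Suc L - p) @ y)"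
    using pow_add[of x p "Suc L - p"] pL unfolding z_def by simp
  \<comment> \<open>Both are prefixes of \<open>z\<close> of length \<open>p * q\<close>. Hence
    \<open>pow x p\<close> commutes with \<open>z\<close>, and therefore with
    \<open>y\<close>.\<close>
  have px: "pow x p = pow v q"
    using 1 2 same_length_prefix_eq[of "pow x p" _ "pow v q"] by (simp add: p_def q_def mult.commute)
  have "pow v q @ z = z @ pow v q"
    unfolding v(3) by (rule pow_commute, rule sym, rule pow_commute) simp
  then have "pow x p @ pow x (Suc L) @ y = pow x (Suc L) @ y @ pow x p"
    using px unfolding z_def by simp
  moreover have "pow x p @ pow x (Suc L) = pow x (Suc L) @ pow x p"
    by (metis pow_add add.commute)
  ultimately have "pow x (Suc L) @ (pow x p @ y) = pow x (Suc L) @ (y @ pow x p)"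
    by (metis append.assoc)
  then have "y @ pow x p = pow x p @ y" by simp
  then show ?thesis using commute_if_pow_commute pL by blast
qed

lemma brot_loop: "brot b c \<Longrightarrow> loop c"
  using brot_pow brot_nonempty unfolding loop_def by blast

text \<open>In the square of \<open>pow a j\<close> the window \<open>c\<close> recurs, so
  \<open>loop_commute\<close> makes the word between the two copies a power of \<open>c\<close>.
  Then \<open>pow a j\<close> is a power of a conjugate of \<open>c\<close>, and primitivity
  identifies this conjugate with \<open>a\<close>.\<close>

lemma rot_if_factor:
  assumes a: "brot b a" and c: "brot d c" and e: "pow a j = u @ c @ v"
  shows "rot b d"
proof -
  have j: "j > 0" using e brot_nonempty[OF c] by (cases j) auto
  then have "S (pow a (j + j))" using brot_pow[OF a] by simp
  then have "S (u @ (c @ (v @ u) @ c) @ v)" using e by (simp add: pow_add)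
  then have "S (c @ (v @ u) @ c)" by (rule S_factor) (use brot_nonempty[OF c] in simp)
  then have "c @ v @ u = (v @ u) @ c" by (rule loop_commute[OF brot_loop[OF c]])
  then obtain l where "v @ u = pow c l" using prim_commute[OF brot_prim[OF c]] by blast
  then have "(c @ v) @ u = pow c (Suc l)" by simp
  then obtain f where f: "rot c f" "u @ c @ v = pow f (Suc l)" using pow_rot by metis
  have pf: "prim f" using prim_rot[OF brot_prim[OF c] f(1)] .
  have "pow f (Suc l) @ f = f @ pow f (Suc l)" by (rule pow_commute) simp
  then have "f @ pow a j = pow a j @ f" using e f by simp
  then have "a @ f = f @ a" using commute_if_pow_commute j by blast
  then obtain i where "f = pow a i" using prim_commute[OF brot_prim[OF a]] by blast
  moreover from this pf have "i = 1" by (auto simp: prim_def)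
  ultimately have "f = a" by simp
  then have "rot c a" using f by simp
  then show ?thesis using a c unfolding brot_def by (metis rot_sym rot_trans)
qed

text \<open>Prolonging \<open>b2\<close> along its band until \<open>b1\<close> appears again yields
  a string \<open>b1 @ y' @ b1\<close>. By \<open>loop_commute\<close> its middle part, which
  contains \<open>c1\<close>, is a power of \<open>b1\<close>.\<close>

lemma no_return:
  assumes b1: "brot b b1" and b2: "brot b b2" and c: "brot c c1"
    and s: "S (b1 @ x @ c1 @ y @ b2)"
  shows "rot b c"
proof -
  have "rot b1 b2" using b1 b2 by (meson brot_def rot_sym rot_trans)
  then obtain p q where pq: "b1 = p @ q" "b2 = q @ p" by (auto simp: rot_def)
  have "S (b2 @ b2)" using brot_S2[OF b2] .
  then have "S ((b2 @ q) @ p)" using pq by simp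
  then have s2: "S (b2 @ q)" by (rule S_prefix) (use brot_nonempty[OF b2] in simp)
  have "S ((b1 @ x @ c1 @ y) @ b2 @ q)"
    using glue[of "b1 @ x @ c1 @ y" b2 q] s s2 brot_undir[OF b2] by simp
  then have "S (b1 @ (x @ c1 @ y @ q) @ b1)" using pq by simp
  then have "b1 @ (x @ c1 @ y @ q) = (x @ c1 @ y @ q) @ b1"
    by (rule loop_commute[OF brot_loop[OF b1]])
  then obtain j where "x @ c1 @ y @ q = pow b1 j" using prim_commute[OF brot_prim[OF b1]] by blast
  then show ?thesis using rot_if_factor[OF b1 c] by metis
qed

subsection \<open>Overlapping windows\<close>

lemma rot_if_window_contains_band:
  assumes "bnd b" "brot d (x @ b @ y)" shows "rot b d"
proof -
  have "S (pow (x @ b @ y) (Suc (Suc (Suc 0))))" by (rule brot_pow[OF assms(2)]) simp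
  then have "S ((x @ b @ y) @ x @ b @ y @ (x @ b @ y))" by simp
  from no_return[OF assms(2) assms(2) brot_refl[OF assms(1)] this] show ?thesis by (rule rot_sym)
qed

lemma rot_if_band_contains_window:
  assumes "bnd (x @ e @ y)" "brot d e" shows "rot (x @ e @ y) d"
proof -
  note b = brot_refl[OF assms(1)]
  have "S (pow (x @ e @ y) (Suc (Suc (Suc 0))))" by (rule brot_pow[OF b]) simp
  then have "S ((x @ e @ y) @ x @ e @ y @ (x @ e @ y))" by simp
  from no_return[OF b b assms(2) this] show ?thesis .
qed

text \<open>In the next two lemmas the string returns to the band through its end, where an inverse
  syllable meets a direct one.\<close>

lemma rot_if_overlap_left:
  assumes b: "bnd (h @ b2)" and e: "brot d (p @ h)" and h: "h \<noteq> []" and s: "S (p @ h @ b2)"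
  shows "rot (h @ b2) d"
proof -
  define b where "b = h @ b2"
  note bb = brot_refl[OF b]
  have "S (b @ b)" using brot_S2[OF bb] by (simp add: b_def)
  then have a: "adj (last b) (hd b)" using bnd_nonempty[OF b] S_adj unfolding b_def by blast
  have "S (p @ (h @ p @ h))" using brot_S2[OF e] by simp
  then have "S (h @ p @ h)" by (rule S_suffix) (use h in simp)
  moreover obtain x y where "last b = Inv x" "hd b = Dir y"
    using b unfolding bnd_iff b_def by blast
  moreover have "hd (h @ p @ h) = hd b" using h by (simp add: b_def)
  ultimately have "S (b @ h @ p @ h)"
    using glue_cut[of b "h @ p @ h"] brot_S[OF bb] a b_def by simp
  then have "S ((b @ h) @ (p @ h) @ b2)"
    using glue[of "b @ h" "p @ h" b2] s brot_undir[OF e] by simp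
  then have "S (b @ [] @ (h @ p) @ [] @ b)" by (simp add: b_def)
  then show ?thesis
    using no_return[OF bb bb brot_rot[OF e rot_append_commute]] unfolding b_def by metis
qed

lemma rot_if_overlap_right:
  assumes b: "bnd (b1 @ h)" and e: "brot d (h @ p)" and h: "h \<noteq> []" and s: "S (b1 @ h @ p)"
  shows "rot (b1 @ h) d"
proof -
  define b where "b = b1 @ h"
  note bb = brot_refl[OF b]
  have "S (b @ b)" using brot_S2[OF bb] by (simp add: b_def)
  then have a: "adj (last b) (hd b)" using bnd_nonempty[OF b] S_adj unfolding b_def by blast
  have "S ((h @ p @ h) @ p)" using brot_S2[OF e] by simp
  then have "S (h @ p @ h)" by (rule S_prefix) (use h in simp)
  moreover obtain x y where "last b = Inv x" "hd b = Dir y"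
    using b unfolding bnd_iff b_def by blast
  moreover have "last (h @ p @ h) = last b" using h by (simp add: b_def)
  ultimately have "S ((h @ p @ h) @ b)"
    using glue_cut[of "h @ p @ h" b] brot_S[OF bb] a b_def by simp
  then have "S (b1 @ (h @ p) @ (h @ b))"
    using glue[of b1 "h @ p" "h @ b"] s brot_undir[OF e] by simp
  then have "S (b @ [] @ (p @ h) @ [] @ b)" by (simp add: b_def)
  then show ?thesis
    using no_return[OF bb bb brot_rot[OF e rot_append_commute]] unfolding b_def by metis
qed

text \<open>The four ways to overlap, containment in either direction and partial overlap on either
  side, are excluded by the four preceding lemmas. For the partial overlaps it matters that
  \<open>b\<close> is a band and not just a rotation of one: its ends are a place where strings can
  be joined.\<close>

lemma window_disjoint:
  assumes s: "S (X @ b @ l)" and e: "X @ b @ l = Y @ e @ m"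
    and b: "bnd b" and d: "brot d e" and nr: "\<not> rot b d"
  obtains r where "X = Y @ e @ r" "m = r @ b @ l"
  | r where "Y = X @ b @ r" "l = r @ e @ m"
proof -
  consider (L) "length (Y @ e) \<le> length X" | (R) "length (X @ b) \<le> length Y"
    | (O) "length X < length (Y @ e)" "length Y < length (X @ b)" by linarith
  then show thesis
  proof cases
    case L
    have "(Y @ e) @ m = X @ (b @ l)" using e by simp
    from append_eq_split[OF this L] that(1) show thesis by auto
  next
    case R
    have "(X @ b) @ l = Y @ (e @ m)" using e by simp
    from append_eq_split[OF this R] that(2) show thesis by auto
  next
    case O
    have "rot b d"
    proof (cases "length Y \<le> length X")
      case True
      then obtain y where y: "X = Y @ y" "e @ m = y @ b @ l"
        using append_eq_split[OF e[symmetric]] by auto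
      then obtain h where h: "e = y @ h" "b @ l = h @ m"
        using append_eq_split[of y "b @ l" e m] O by auto
      have hne: "h \<noteq> []" using O y h by auto
      have s2: "S (y @ b @ l)" using s S_suffix[of Y "y @ b @ l"] y bnd_nonempty[OF b] by simp
      show ?thesis
      proof (cases "length b \<le> length h")
        case True
        then obtain g where "h = b @ g" using append_eq_split[OF h(2)] by auto
        then show ?thesis using rot_if_window_contains_band[of b d y g] b d h by simp
      next
        case False
        then obtain b2 where b2: "b = h @ b2" using append_eq_split[OF h(2)[symmetric]] by auto
        have "S (y @ h @ b2)" using S_prefix[of "y @ h @ b2" l] s2 b2 hne by simp
        then show ?thesis using rot_if_overlap_left[of h b2 d y] b2 b d h hne by simp
      qed
    next
      case False
      then obtain y where y: "Y = X @ y" "b @ l = y @ e @ m"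
        using append_eq_split[OF e] by auto
      then obtain h where h: "b = y @ h" "e @ m = h @ l"
        using append_eq_split[of y "e @ m" b l] O by auto
      have hne: "h \<noteq> []" using O y h by auto
      have "S (b @ l)" using S_suffix[OF s] bnd_nonempty[OF b] by simp
      then have s2: "S (y @ e @ m)" by (simp only: y(2))
      show ?thesis
      proof (cases "length e \<le> length h")
        case True
        then obtain g where "h = e @ g" using append_eq_split[OF h(2)] by auto
        then show ?thesis using rot_if_band_contains_window[of y e g d] b d h by simp
      next
        case False
        then obtain p where p: "e = h @ p" using append_eq_split[OF h(2)[symmetric]] by auto
        have "S (y @ h @ p)" using S_prefix[of "y @ h @ p" m] s2 p hne by simp
        then show ?thesis using rot_if_overlap_right[of y h d p] p b d h hne by simp
      qed
    qed
    with nr show thesis ..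
  qed
qed

text \<open>Prolonging \<open>f\<close> on the right produces another copy of \<open>e\<close>, and
  \<open>loop_commute\<close> applies. The conclusion says that both windows belong to one periodic
  run and that \<open>x\<close> slides one onto the other.\<close>

lemma windows_commute:
  assumes e: "brot b e" and f: "brot b f" and s: "S (e @ x @ f)"
  shows "e @ x = x @ f"
proof -
  have "rot e f" using e f by (meson brot_def rot_sym rot_trans)
  then obtain p q where pq: "e = p @ q" "f = q @ p" by (auto simp: rot_def)
  have "S ((f @ q) @ p)" using brot_S2[OF f] pq by simp
  then have s2: "S (f @ q)" by (rule S_prefix) (use brot_nonempty[OF f] in simp)
  have "S ((e @ x) @ f @ q)"
    using glue[of "e @ x" f q] s s2 brot_undir[OF f] by simp
  then have "S (e @ (x @ q) @ e)" using pq by simp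
  then have "e @ x @ q = (x @ q) @ e" by (rule loop_commute[OF brot_loop[OF e]])
  then have "(e @ x) @ q = (x @ f) @ q" using pq by simp
  then show ?thesis by simp
qed

lemma removal_unique_aux:
  assumes e: "brot b e" and f: "brot b f" and s: "S (X @ e @ l)"
    and eq: "X @ e @ l = Y @ f @ m" and le: "length X \<le> length Y"
  shows "X @ l = Y @ m"
proof -
  obtain g where g: "Y = X @ g" "e @ l = g @ f @ m"
    using append_eq_split[OF eq le] by auto
  have s2: "S (e @ l)" using S_suffix[OF s] brot_nonempty[OF e] by simp
  have c: "e @ g = g @ f"
  proof (cases "length e \<le> length g")
    case True
    then obtain x where x: "g = e @ x" "l = x @ f @ m"
      using append_eq_split[OF g(2)] by auto
    then have "S ((e @ x @ f) @ m)" using s2 by simp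
    then have "S (e @ x @ f)" by (rule S_prefix) (use brot_nonempty[OF e] in simp)
    from windows_commute[OF e f this] show ?thesis using x by simp
  next
    case False
    then obtain r where r: "e = g @ r" "f @ m = r @ l"
      using append_eq_split[OF g(2)[symmetric]] by auto
    have "length r \<le> length f"
      using r(1) brot_length[OF e] brot_length[OF f] by simp
    then obtain t where t: "f = r @ t" "l = t @ m"
      using append_eq_split[OF r(2)[symmetric]] by auto
    have "S ((e @ t) @ m)" using s2 t by simp
    then have "S (e @ t)" by (rule S_prefix) (use brot_nonempty[OF e] in simp)
    \<comment> \<open>Repeating \<open>e\<close> separates the overlapping windows:
      \<open>e @ g @ f\<close> is a string, as in the disjoint case.\<close>
    then have "S (e @ e @ t)" by (rule extend_left[OF e])
    then have "S (e @ g @ f)" using r t by simp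
    from windows_commute[OF e f this] show ?thesis .
  qed
  have "e @ l = (g @ f) @ m" using g by simp
  also have "\<dots> = e @ g @ m" by (simp only: c flip: append_assoc)
  finally have "l = g @ m" by simp
  then show ?thesis using g(1) by simp
qed

text \<open>Two windows of one band in a string are shifts of each other along a common run, so it
  does not matter which is deleted. This determines the 1-step reduction, and with it the choice in
  \<open>band_red\<close>.\<close>

lemma removal_unique:
  assumes "brot b e" "brot b f" "S (X @ e @ l)" "X @ e @ l = Y @ f @ m"
  shows "X @ l = Y @ m"
proof (cases "length X \<le> length Y")
  case True
  then show ?thesis using removal_unique_aux assms by blast
next
  case False
  then have le: "length Y \<le> length X" by simp
  have "S (Y @ f @ m)" using assms(3) unfolding assms(4) .
  from removal_unique_aux[OF assms(2,1) this assms(4)[symmetric] le] show ?thesis by (rule sym)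
qed

section \<open>H-equivalence\<close>

text \<open>\<open>H_equiv\<close> for nonempty words. The condition on \<open>syl_eps\<close>
  records what multiplication by strings of length 0 tests.\<close>

definition Heq :: "'a syllable list \<Rightarrow> 'a syllable list \<Rightarrow> bool" where
  "Heq l l' \<longleftrightarrow> S l \<and> S l' \<and> syl_tgt \<Lambda> (hd l) = syl_tgt \<Lambda> (hd l') \<and>
     syl_eps \<Lambda> (hd l) = syl_eps \<Lambda> (hd l') \<and> (\<forall>x. x \<noteq> [] \<longrightarrow> S (x @ l) = S (x @ l'))"

lemma Heq_refl: "S l \<Longrightarrow> Heq l l"
  by (simp add: Heq_def)

lemma Heq_sym: "Heq l l' \<Longrightarrow> Heq l' l"
  by (simp add: Heq_def)

lemma Heq_trans: "Heq l l' \<Longrightarrow> Heq l' l'' \<Longrightarrow> Heq l l''"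
  by (simp add: Heq_def)

lemma Heq_S: "Heq l l' \<Longrightarrow> S l" "Heq l l' \<Longrightarrow> S l'"
  by (simp_all add: Heq_def)

lemma Heq_S_append: "Heq l l' \<Longrightarrow> S (x @ l) \<Longrightarrow> S (x @ l')"
  by (cases "x = []") (simp_all add: Heq_def)

lemma Heq_cong: "Heq l l' \<Longrightarrow> S (x @ l) \<Longrightarrow> Heq (x @ l) (x @ l')"
  using Heq_S_append[of l l' x] Heq_S_append[of l l' "y @ x" for y]
    Heq_S_append[OF Heq_sym[of l l'], of "y @ x" for y]
  unfolding Heq_def by (cases "x = []") auto

text \<open>Any left extension of \<open>p @ m\<close> can be glued along \<open>m\<close> to
  \<open>m @ r\<close>, so what follows \<open>m\<close> is invisible from the left.\<close>

lemma Heq_prefix: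
  assumes "S (p @ m)" "S (m @ r)" "undir m"
  shows "Heq (p @ m) (p @ m @ r)"
proof -
  have ne: "m \<noteq> []" using assms(3) by (rule undir_nonempty)
  have "S (x @ p @ m @ r)" if "S (x @ p @ m)" for x
    using glue[of "x @ p" m r] that assms by simp
  moreover have "S (x @ p @ m)" if "S (x @ p @ m @ r)" for x
    using S_prefix[of "x @ p @ m" r] that ne by simp
  ultimately show ?thesis
    using assms(1) ne glue[OF assms] unfolding Heq_def by (cases p) auto
qed

lemma Heq_common_prefix:
  assumes "S (p @ m @ r)" "S (p @ m @ r')" "undir m"
  shows "Heq (p @ m @ r) (p @ m @ r')"
proof -
  have ne: "m \<noteq> []" using assms(3) by (rule undir_nonempty)
  have "S (p @ m)" using S_prefix[of "p @ m" r] assms(1) ne by simp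
  moreover have "S (m @ r)" "S (m @ r')"
    using S_suffix[of p "m @ r"] S_suffix[of p "m @ r'"] assms ne by simp_all
  ultimately show ?thesis
    using Heq_prefix assms(3) Heq_trans Heq_sym by metis
qed

text \<open>Of two adjacent periods the left one can always be removed by an H-reduction; this is
  why the skeleton respects H-classes.\<close>

lemma Heq_window:
  assumes "brot b e" "S (e @ s)"
  shows "Heq (e @ e @ s) (e @ s)"
  using Heq_common_prefix[of "[]" e "e @ s" s] extend_left[OF assms] assms brot_undir by simp

lemma H_equiv_Letters:
  assumes "S a" "S c"
  shows "H_equiv \<Lambda> (Letters a) (Letters c) \<longleftrightarrow> Heq a c"
proof
  assume h: "H_equiv \<Lambda> (Letters a) (Letters c)"
  have ne: "a \<noteq> []" using assms S_nonempty by auto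
  have t: "syl_tgt \<Lambda> (hd a) = syl_tgt \<Lambda> (hd c)" using h by (simp add: H_equiv_def)
  have hx: "str_prod \<Lambda> [x, Letters a] \<noteq> None \<longleftrightarrow> str_prod \<Lambda> [x, Letters c] \<noteq> None"
    if "is_string \<Lambda> x" "str_src \<Lambda> x = syl_tgt \<Lambda> (hd a)" for x
  proof -
    have "\<forall>x. is_string \<Lambda> x \<and> str_src \<Lambda> x = str_tgt \<Lambda> (Letters a) \<longrightarrow>
        (str_prod \<Lambda> [x, Letters a] \<noteq> None \<longleftrightarrow> str_prod \<Lambda> [x, Letters c] \<noteq> None)"
      using h unfolding H_equiv_def by blast
    moreover have "str_src \<Lambda> x = str_tgt \<Lambda> (Letters a)" using that by simp
    ultimately show ?thesis using that(1) by blast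
  qed
  have "arrow_of (hd a) \<in> arrows \<Lambda>" using assms(1) ne by (auto simp: S_iff)
  then have v: "syl_tgt \<Lambda> (hd a) \<in> vertices \<Lambda>" "syl_eps \<Lambda> (hd a) \<in> {1, -1}"
    using ends signs by (cases "hd a"; force)+
  have "syl_eps \<Lambda> (hd a) = syl_eps \<Lambda> (hd c)"
    using hx[of "Triv (syl_tgt \<Lambda> (hd a)) (syl_eps \<Lambda> (hd a))"] v assms
    by (auto simp: S_def simp del: is_string.simps(2) split: if_splits)
  moreover have "S (x @ a) = S (x @ c)" if "x \<noteq> []" for x
  proof -
    have "S x \<and> syl_src \<Lambda> (last x) = syl_tgt \<Lambda> (hd a)" if "S (x @ a) \<or> S (x @ c)"
      using that S_adj[of x a] S_adj[of x c] S_prefix[of x] \<open>x \<noteq> []\<close> t assms S_nonempty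
      unfolding adj_def by metis
    then show ?thesis
      using hx[of "Letters x"] assms
      by (auto simp: S_def simp del: is_string.simps(2) split: if_splits)
  qed
  ultimately show "Heq a c" using assms t unfolding Heq_def by blast
next
  assume h: "Heq a c"
  have "str_prod \<Lambda> [x, Letters a] \<noteq> None \<longleftrightarrow> str_prod \<Lambda> [x, Letters c] \<noteq> None" for x
  proof (cases x)
    case (Triv v i)
    then show ?thesis using h by (auto simp: S_def Heq_def simp del: is_string.simps(2))
  next
    case (Letters w)
    then show ?thesis using h S_nonempty[of w] unfolding Heq_def
      by (auto simp: S_def simp del: is_string.simps(2))
  qed
  then show "H_equiv \<Lambda> (Letters a) (Letters c)"
    using h by (simp add: H_equiv_def Heq_def S_def del: is_string.simps)
qed

section \<open>The reductions on words\<close>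

text \<open>The witness \<open>h\<close> moves the removed window to the left along the run of the band; H-equivalence
  is the weaker the further to the left the window is.\<close>

definition Hred :: "'a syllable list \<Rightarrow> 'a syllable list \<Rightarrow> 'a syllable list \<Rightarrow> bool" where
  "Hred X b l \<longleftrightarrow> (\<exists>h c. suffix h X \<and> h @ b = c @ h \<and> Heq (c @ h @ l) (h @ l))"

lemma Hred_S:
  assumes "Hred X b l" "S (X @ b @ l)" shows "S (X @ l)"
proof -
  obtain X0 h c where h: "X = X0 @ h" "h @ b = c @ h" "Heq (c @ h @ l) (h @ l)"
    using assms(1) by (auto simp: Hred_def suffix_def)
  have "X @ b @ l = X0 @ (h @ b) @ l" using h(1) by simp
  also have "\<dots> = X0 @ (c @ h) @ l" by (simp only: h(2))
  finally have "X @ b @ l = X0 @ c @ h @ l" by simp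
  then have "S (X0 @ c @ h @ l)" using assms(2) by (simp only:)
  then show ?thesis using Heq_S_append[OF h(3)] h(1) by simp
qed

lemma S_if_str_prod: "str_prod \<Lambda> xs = Some (Letters w) \<Longrightarrow> S w"
  using str_prod_SomeD unfolding S_def by blast

lemma one_step_reductionD:
  assumes r: "one_step_reduction \<Lambda> (Letters b) (Letters (X @ e @ l)) z"
    and b: "brot b e" and ne: "X @ l \<noteq> []"
  shows "z = Letters (X @ l)" "S (X @ l)"
proof -
  obtain y2 b' y1 where y: "cyc_perm (Letters b) b'"
      "str_prod \<Lambda> [y2, b', y1] = Some (Letters (X @ e @ l))" "str_prod \<Lambda> [y2, y1] = Some z"
    using r by (auto simp: one_step_reduction_def)
  obtain f where f: "b' = Letters f" "rot b f" using y(1) cyc_perm_Letters by blast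
  have w: "X @ e @ l = lts y2 @ f @ lts y1" using str_prod_lts[OF y(2)] f by simp
  have "S (X @ e @ l)" using S_if_str_prod[OF y(2)] .
  then have "X @ l = lts y2 @ lts y1"
    using removal_unique[of b e f X l] b f w by (auto simp: brot_def)
  then have "lts z = X @ l" using str_prod_SomeD[OF y(3)] by simp
  then show z: "z = Letters (X @ l)" using ne by (cases z) auto
  show "S (X @ l)" using S_if_str_prod y(3) unfolding z by blast
qed

lemma str_prod_2:
  "S (x @ y) \<Longrightarrow> x \<noteq> [] \<Longrightarrow> y \<noteq> [] \<Longrightarrow>
     str_prod \<Lambda> [Letters x, Letters y] = Some (Letters (x @ y))"
  using str_prod_Letters[of "[x, y]"] by simp

lemma str_prod_3:
  "S (x @ y @ z) \<Longrightarrow> x \<noteq> [] \<Longrightarrow> y \<noteq> [] \<Longrightarrow> z \<noteq> [] \<Longrightarrow>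
     str_prod \<Lambda> [Letters x, Letters y, Letters z] = Some (Letters (x @ y @ z))"
  using str_prod_Letters[of "[x, y, z]"] by simp

lemma band_red_Some:
  assumes b: "brot b e" and s: "S (X @ e @ l)" "S (X @ l)" and ne: "X \<noteq> []" "l \<noteq> []"
  shows "band_red \<Lambda> (Letters b) (Letters (X @ e @ l)) = Some (Letters (X @ l))"
proof -
  have "one_step_reduction \<Lambda> (Letters b) (Letters (X @ e @ l)) (Letters (X @ l))"
    unfolding one_step_reduction_def
  proof (intro exI conjI)
    show "cyc_perm (Letters b) (Letters e)" using b by (auto simp: cyc_perm_Letters brot_def)
    show "str_prod \<Lambda> [Letters X, Letters e, Letters l] = Some (Letters (X @ e @ l))"
      using str_prod_3[OF s(1)] ne brot_nonempty[OF b] by blast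
    show "str_prod \<Lambda> [Letters X, Letters l] = Some (Letters (X @ l))"
      using str_prod_2[OF s(2)] ne by blast
  qed
  moreover from this have "(SOME z. one_step_reduction \<Lambda> (Letters b) (Letters (X @ e @ l)) z) = Letters (X @ l)"
    by (rule some_equality) (use one_step_reductionD(1)[OF _ b] ne in simp)
  ultimately show ?thesis unfolding band_red_def by metis
qed

lemma band_red_None:
  assumes "brot b e" "\<not> S (X @ l)" "X \<noteq> []"
  shows "band_red \<Lambda> (Letters b) (Letters (X @ e @ l)) = None"
  using one_step_reductionD(2)[OF _ assms(1)] assms unfolding band_red_def by auto

section \<open>Multiplicity of a band in a word\<close>

definition occ :: "'a syllable list \<Rightarrow> nat \<Rightarrow> 'a syllable list \<Rightarrow> bool" where
  "occ b n w \<longleftrightarrow> (\<exists>y e m. rot b e \<and> w = y @ pow e n @ m)"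

lemma band_mult_set:
  assumes "bnd b" "S w"
  defines "N \<equiv> {n. \<exists>y2 b' y1. cyc_perm (Letters b) b' \<and>
            str_prod \<Lambda> ([y2] @ replicate n b' @ [y1]) = Some (Letters w)}"
  shows "finite N" "n \<in> N \<Longrightarrow> occ b n w"
    "S (y @ pow e n @ m) \<Longrightarrow> w = y @ pow e n @ m \<Longrightarrow> rot b e \<Longrightarrow> y \<noteq> [] \<Longrightarrow> m \<noteq> [] \<Longrightarrow> n \<in> N"
proof -
  show o: "occ b n w" if nN: "n \<in> N" for n
  proof -
    obtain y2 b' y1 where y: "cyc_perm (Letters b) b'"
        "str_prod \<Lambda> ([y2] @ replicate n b' @ [y1]) = Some (Letters w)"
      using nN unfolding N_def by blast
    obtain e where e: "b' = Letters e" "rot b e" using y(1) cyc_perm_Letters by blast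
    have "w = lts y2 @ pow e n @ lts y1"
      using str_prod_lts[OF y(2)] e by (simp add: pow_def)
    with e(2) show ?thesis unfolding occ_def by blast
  qed
  have "n \<le> length w" if nN: "n \<in> N" for n
  proof -
    obtain y e m where e: "rot b e" "w = y @ pow e n @ m" using o[OF nN] by (auto simp: occ_def)
    have "length e \<ge> 1" using rot_length[OF e(1)] bnd_nonempty[OF assms(1)] by (cases b) auto
    from mult_le_mono2[OF this, of n] have "n \<le> n * length e" by (simp only: mult_1_right)
    also have "\<dots> \<le> length w" using e(2) by simp
    finally show ?thesis .
  qed
  then show "finite N" by (meson finite_nat_set_iff_bounded_le)
  assume a: "S (y @ pow e n @ m)" "w = y @ pow e n @ m" "rot b e" "y \<noteq> []" "m \<noteq> []"
  then have "e \<noteq> []" using rot_length[OF a(3)] bnd_nonempty[OF assms(1)] by auto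
  then have "str_prod \<Lambda> (map Letters ([y] @ replicate n e @ [m])) = Some (Letters w)"
    using str_prod_Letters[of "[y] @ replicate n e @ [m]"] a
    by (auto simp: pow_def)
  then have "str_prod \<Lambda> ([Letters y] @ replicate n (Letters e) @ [Letters m]) = Some (Letters w)"
    by simp
  then show "n \<in> N"
    using a(3) unfolding N_def cyc_perm_Letters by blast
qed

lemma band_mult_ge:
  assumes "bnd b" "S (y @ pow e n @ m)" "rot b e" "y \<noteq> []" "m \<noteq> []"
  shows "n \<le> band_mult \<Lambda> (Letters b) (Letters (y @ pow e n @ m))"
  unfolding band_mult_def using band_mult_set[OF assms(1,2)] assms by (intro Max_ge) auto

lemma band_mult_occ:
  assumes "bnd b" "S w" "length w \<ge> 2"
  shows "occ b (band_mult \<Lambda> (Letters b) (Letters w)) w"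
proof -
  \<comment> \<open>Multiplicity 0 shows that the set under \<open>Max\<close> is nonempty; two
    nonempty parts of \<open>w\<close> serve as the outer factors.\<close>
  obtain x y where w: "w = [x] @ y" "y \<noteq> []"
    using assms(3) by (cases w; cases "tl w") auto
  have "w = [x] @ pow b 0 @ y" using w by simp
  then have 0: "0 \<in> {n. \<exists>y2 b' y1. cyc_perm (Letters b) b' \<and>
            str_prod \<Lambda> ([y2] @ replicate n b' @ [y1]) = Some (Letters w)}"
    using band_mult_set(3)[OF assms(1,2), of "[x]" b 0 y] assms w by auto
  show ?thesis
    unfolding band_mult_def
    using band_mult_set(2)[OF assms(1,2) Max_in[OF band_mult_set(1)[OF assms(1,2)]]] 0 by blast
qed

lemma one_step_H_reduction_if_Hred:
  assumes b: "brot b e" and h: "Hred X e l" and s: "S (X @ e @ l)" and ne: "X \<noteq> []" "l \<noteq> []"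
  shows "one_step_H_reduction \<Lambda> (Letters (X @ e @ l)) (Letters (X @ l))"
proof -
  obtain X0 h c where h: "X = X0 @ h" "h @ e = c @ h" "Heq (c @ h @ l) (h @ l)"
    using h by (auto simp: Hred_def suffix_def)
  have c: "brot b c" using rot_if_conj[OF h(2)] b brot_rot by blast
  have w: "X @ e @ l = X0 @ c @ h @ l"
    using arg_cong[OF h(2), of "\<lambda>x. X0 @ x @ l"] h(1) by simp
  have hl: "h @ l \<noteq> []" using ne by simp
  have s2: "S (X @ l)" by (rule Hred_S[OF assms(2) s])
  \<comment> \<open>Nothing may be left of the slid window \<open>c\<close>; the outer factor is
    then a string of length 0.\<close>
  define y2 where "y2 = (if X0 = [] then Triv (syl_tgt \<Lambda> (hd c)) (syl_eps \<Lambda> (hd c)) else Letters X0)"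
  have sc: "S (c @ h @ l)" "S (h @ l)" using Heq_S[OF h(3)] .
  have "arrow_of (hd c) \<in> arrows \<Lambda>" using sc brot_nonempty[OF c] by (auto simp: S_iff)
  then have v: "syl_tgt \<Lambda> (hd c) \<in> vertices \<Lambda>" "syl_eps \<Lambda> (hd c) \<in> {1, -1}"
    using ends signs by (cases "hd c"; force)+
  have p: "str_prod \<Lambda> [Letters c, Letters (h @ l)] = Some (Letters (c @ h @ l))"
    using str_prod_2[OF sc(1)] brot_nonempty[OF c] hl by simp
  have "syl_tgt \<Lambda> (hd (h @ l)) = syl_tgt \<Lambda> (hd c)" "syl_eps \<Lambda> (hd (h @ l)) = syl_eps \<Lambda> (hd c)"
    using h(3) brot_nonempty[OF c] by (simp_all add: Heq_def)
  then have q: "str_prod \<Lambda> [y2, Letters (h @ l)] = Some (Letters (X0 @ h @ l))"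
    using sc v s2 h(1) str_prod_2[of X0 "h @ l"] hl
    by (auto simp: y2_def S_def simp del: is_string.simps(2))
  have "str_mult \<Lambda> y2 (Letters (c @ h @ l)) = Some (Letters (X0 @ c @ h @ l))"
    using sc v s w str_prod_2[of X0 "c @ h @ l"] hl brot_nonempty[OF c]
    by (auto simp: y2_def S_def simp del: is_string.simps(2))
  then have r: "str_prod \<Lambda> [y2, Letters c, Letters (h @ l)] = Some (Letters (X0 @ c @ h @ l))"
    using p by simp
  have "H_equiv \<Lambda> (Letters (c @ h @ l)) (Letters (h @ l))"
    using H_equiv_Letters[OF sc] h(3) by blast
  moreover have "is_band \<Lambda> (Letters b)" "cyc_perm (Letters b) (Letters c)"
    using c by (auto simp: brot_def bnd_def cyc_perm_Letters)
  ultimately show ?thesis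
    unfolding one_step_H_reduction_def w
  proof (intro exI conjI)
    show "str_prod \<Lambda> [y2, Letters (h @ l)] = Some (Letters (X @ l))" using q h(1) by simp
    show "str_prod \<Lambda> [y2, Letters c, Letters (h @ l)] = Some (Letters (X0 @ c @ h @ l))" by (fact r)
    show "H_equiv \<Lambda> (Letters (c @ h @ l)) (Letters (h @ l))" by fact
    show "is_band \<Lambda> (Letters b)" "cyc_perm (Letters b) (Letters c)" by fact+
    show "str_prod \<Lambda> [Letters c, Letters (h @ l)] = Some (Letters (c @ h @ l))" by (fact p)
  qed
qed

text \<open>The definition may have used another window, formally even one of another band, but both
  removals lead to the same word. If that window starts at \<open>e\<close> or further left, the
  shift is the witness \<open>h\<close>. If it starts further right, prepending the shift
  \<open>g\<close> carries its H-equivalence over to \<open>e\<close>, with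
  \<open>h = []\<close>.\<close>

lemma Hred_if_one_step_H_reduction:
  assumes "one_step_H_reduction \<Lambda> (Letters (X @ e @ l)) (Letters (X @ l))"
    and ne: "l \<noteq> []" and e: "e \<noteq> []"
  shows "Hred X e l"
proof -
  obtain y2 b b' y1 x where y: "is_band \<Lambda> b" "cyc_perm b b'"
      "str_prod \<Lambda> [y2, b', y1] = Some (Letters (X @ e @ l))"
      "str_prod \<Lambda> [y2, y1] = Some (Letters (X @ l))"
      "str_prod \<Lambda> [b', y1] = Some x" "H_equiv \<Lambda> x y1"
    using assms(1) unfolding one_step_H_reduction_def by blast
  obtain c where c: "b' = Letters c" using y(1,2) is_bandD cyc_perm_Letters by metis
  have w: "X @ e @ l = lts y2 @ c @ lts y1" "X @ l = lts y2 @ lts y1"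
    using str_prod_lts[OF y(3)] str_prod_lts[OF y(4)] c by simp_all
  have len: "length c = length e" using arg_cong[OF w(1), of length] arg_cong[OF w(2), of length] by simp
  have cne: "c \<noteq> []" using len e by auto
  have sx: "is_string \<Lambda> x" "is_string \<Lambda> y1" "lts x = c @ lts y1"
    using str_prod_SomeD[OF y(5)] c by auto
  then have x: "x = Letters (c @ lts y1)" using cne by (cases x) auto
  have sW: "S (X @ e @ l)" "S (X @ l)"
    using S_if_str_prod y(3,4) by blast+
  show ?thesis
  proof (cases "length (lts y2) \<le> length X")
    case True
    then obtain h where h: "X = lts y2 @ h" "c @ lts y1 = h @ e @ l"
      using append_eq_split[OF w(1)[symmetric]] by auto
    have y1: "lts y1 = h @ l" using w(2) h(1) by simp
    then have y1': "y1 = Letters (h @ l)" using ne by (cases y1) auto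
    have "c @ h @ l = h @ e @ l" using h y1 by simp
    then have "h @ e = c @ h" by (metis append.assoc append_same_eq)
    moreover have "Heq (c @ h @ l) (h @ l)"
      using H_equiv_Letters[of "c @ h @ l" "h @ l"] y(6) x y1 y1' sx(1,2) by (simp add: S_def)
    ultimately show ?thesis using h(1) unfolding Hred_def by (auto simp: suffix_def)
  next
    case False
    then obtain g where g: "lts y2 = X @ g" "e @ l = g @ c @ lts y1"
      using append_eq_split[OF w(1)] by auto
    have gne: "g \<noteq> []" using False g by auto
    have l: "l = g @ lts y1" using w(2) g(1) by simp
    have "S (e @ l)" "S l" using S_suffix[OF sW(1)] S_suffix[OF sW(2)] ne by auto
    then have eg: "S (g @ c @ lts y1)" "S (g @ lts y1)"
      by (simp only: g(2), simp only: l)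
    have y2: "y2 = Letters (X @ g)" using g(1) gne by (cases y2) auto
    \<comment> \<open>\<open>y1\<close> may have length 0, where \<open>Heq\<close> does not apply
      and the definition of \<open>H_equiv\<close> is used directly.\<close>
    have eq: "S (u @ c @ lts y1) = S (u @ lts y1)" if u: "suffix g u" for u
    proof (cases y1)
      case (Letters v)
      have "Heq (c @ v) v"
        using H_equiv_Letters[of "c @ v" v] y(6) x Letters sx(1,2) by (simp add: S_def)
      then show ?thesis using Letters gne u unfolding Heq_def by (auto simp: suffix_def)
    next
      case (Triv v i)
      have une: "u \<noteq> []" "last u = last g" using u gne by (auto simp: suffix_def)
      have "str_mult \<Lambda> (Letters (X @ g)) (Triv v i) \<noteq> None"
        using y(4) y2 Triv by (auto split: if_splits)
      then have t: "syl_src \<Lambda> (last g) = v" "syl_sigma \<Lambda> (last g) = - i" "is_string \<Lambda> (Triv v i)"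
        using gne by (auto split: if_splits)
      have tc: "str_tgt \<Lambda> (Letters c) = v" using y(6) x Triv by (simp add: H_equiv_def)
      show ?thesis
      proof
        assume "S (u @ c @ lts y1)"
        then show "S (u @ lts y1)" using Triv S_prefix une by auto
      next
        assume "S (u @ lts y1)"
        then have su: "S u" using Triv by simp
        then have "str_prod \<Lambda> [Letters u, y1] \<noteq> None" using t Triv une by (simp add: S_def del: is_string.simps)
        moreover have "str_src \<Lambda> (Letters u) = v" using t une by simp
        ultimately have "str_prod \<Lambda> [Letters u, x] \<noteq> None"
          using y(6) su tc x Triv unfolding H_equiv_def by (simp add: S_def del: is_string.simps str_prod.simps)
        then show "S (u @ c @ lts y1)"
          using x Triv by (auto simp: S_def simp del: is_string.simps split: if_splits)
      qed
    qed
    have "Heq (g @ c @ lts y1) (g @ lts y1)"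
    proof -
      have "S (x @ g @ c @ lts y1) = S (x @ g @ lts y1)" for x
        using eq[of "x @ g"] by (simp add: suffix_def)
      then show ?thesis unfolding Heq_def using eg gne by simp
    qed
    then have "Heq (e @ l) l" by (simp only: g(2) flip: l)
    then have "Heq (e @ [] @ l) ([] @ l)" by simp
    then show ?thesis unfolding Hred_def by (intro exI[of _ "[]"] exI[of _ e]) auto
  qed
qed

text \<open>By uniqueness of the 1-step reduction, the operation can be evaluated at any window
  \<open>e\<close> of the band that is convenient.\<close>

lemma h_band_word:
  assumes b: "brot b e" "Letters b \<in> B" and s: "S (X @ e @ l)" and ne: "X \<noteq> []" "l \<noteq> []"
  shows "h_band \<Lambda> B (Letters b) (Letters (X @ e @ l)) = Letters (if Hred X e l then X @ l else X @ e @ l)"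
proof (cases "S (X @ l)")
  case True
  have "1 \<le> band_mult \<Lambda> (Letters b) (Letters (X @ e @ l))"
    using band_mult_ge[of b X e 1 l] b s ne by (auto simp: brot_def)
  then have "Letters b \<in> bands_in \<Lambda> B (Letters (X @ e @ l))"
    using b by (simp add: bands_in_def)
  moreover have "one_step_H_reduction \<Lambda> (Letters (X @ e @ l)) (Letters (X @ l)) \<longleftrightarrow> Hred X e l"
    using one_step_H_reduction_if_Hred[OF b(1) _ s ne] Hred_if_one_step_H_reduction[OF _ ne(2)]
      brot_nonempty[OF b(1)] by blast
  ultimately show ?thesis
    unfolding h_band_def band_red_Some[OF b(1) s True ne] option.case by auto
next
  case False
  then have "\<not> Hred X e l" using Hred_S s by blast
  then show ?thesis unfolding h_band_def band_red_None[OF b(1) False ne(1)] option.case by simp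
qed

end

section \<open>Paths of weak bridges as words\<close>

text \<open>A path \<open>(u\<^sub>1, \<dots>, u\<^sub>n)\<close> is represented by the reversed list of the pairs
  \<open>(t(u\<^sub>i), u\<^sub>i)\<close>, so that \<open>path_word s(P)\<close> reads from left to right.\<close>

fun path_word :: "'c list \<Rightarrow> ('c list \<times> 'c list) list \<Rightarrow> 'c list" where
  "path_word t [] = t"
| "path_word t ((b, u) # Q) = b @ u @ path_word t Q"

fun head_band :: "'c list \<Rightarrow> ('c list \<times> 'c list) list \<Rightarrow> 'c list" where
  "head_band c [] = c"
| "head_band c ((b, u) # Q) = b"

lemma path_word_append: "path_word t (Q1 @ Q2) = path_word (path_word t Q2) Q1"
  by (induction Q1) auto

lemma head_band_append: "head_band c (Q1 @ Q2) = head_band (head_band c Q2) Q1"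
  by (cases Q1) auto

lemma path_word_head: "\<exists>m. path_word (c @ r) Q = head_band c Q @ m"
  by (cases Q) auto

lemma path_word_tail: "\<exists>p. \<forall>t. path_word t Q = p @ t"
proof (induction Q)
  case (Cons a Q)
  then obtain p where p: "\<forall>t. path_word t Q = p @ t" by blast
  obtain b u where "a = (b, u)" by force
  with p show ?case by (auto intro!: exI[of _ "b @ u @ p"])
qed auto

lemma path_word_mem:
  assumes "x = c \<or> x \<in> fst ` set Q"
  shows "\<exists>y m. path_word c Q = y @ x @ m"
  using assms
proof (induction Q)
  case (Cons a Q)
  obtain b u where a: "a = (b, u)" by force
  show ?case
  proof (cases "x = b")
    case True
    then show ?thesis using a by (intro exI[of _ "[]"] exI[of _ "u @ path_word c Q"]) simp
  next
    case False
    then obtain y m where "path_word c Q = y @ x @ m" using Cons a by auto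
    then show ?thesis using a by (intro exI[of _ "b @ u @ y"] exI[of _ m]) auto
  qed
qed (auto intro: exI[of _ "[]"])

context dom_string_algebra begin

lemma B_bnd: "Letters b \<in> B \<Longrightarrow> bnd b"
  using reps by (auto simp: band_reps_def bnd_def)

lemma B_unique: "Letters b \<in> B \<Longrightarrow> Letters c \<in> B \<Longrightarrow> rot b c \<Longrightarrow> b = c"
proof -
  assume b: "Letters b \<in> B" and c: "Letters c \<in> B" and r: "rot b c"
  have "\<exists>!b'. b' \<in> B \<and> cyc_perm (Letters b) b'"
    using reps B_bnd[OF b] by (auto simp: band_reps_def bnd_def)
  moreover have "cyc_perm (Letters b) (Letters b)" "cyc_perm (Letters b) (Letters c)"
    using r by (auto simp: cyc_perm_Letters)
  ultimately show "b = c" using b c by auto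
qed

definition bfree :: "'a syllable list \<Rightarrow> bool" where
  "bfree u \<longleftrightarrow> \<not> (\<exists>d e x y. brot d e \<and> u = x @ e @ y)"

text \<open>Only a bridge with its two neighbouring bands is required to be a string;
  \<open>chain_S\<close> glues these along the bands. A trivial bridge appears as
  \<open>u = []\<close> between equal bands.\<close>

fun chain :: "'a syllable list \<Rightarrow> ('a syllable list \<times> 'a syllable list) list \<Rightarrow> bool" where
  "chain c [] \<longleftrightarrow> Letters c \<in> B"
| "chain c ((b, u) # Q) \<longleftrightarrow> Letters b \<in> B \<and> bfree u \<and> S (b @ u @ head_band c Q) \<and>
     \<not> (b = head_band c Q \<and> u = []) \<and> chain c Q"

lemma chain_head: "chain c Q \<Longrightarrow> Letters (head_band c Q) \<in> B"
  by (cases Q) auto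

lemma chain_last: "chain c Q \<Longrightarrow> Letters c \<in> B"
  by (induction Q) auto

lemma chain_mem: "chain c Q \<Longrightarrow> b \<in> fst ` set Q \<Longrightarrow> Letters b \<in> B"
  by (induction Q) fastforce+

lemma chain_append: "chain c (Q1 @ Q2) \<longleftrightarrow> chain (head_band c Q2) Q1 \<and> chain c Q2"
  using chain_head by (induction Q1) (auto simp: head_band_append)

lemma chain_S:
  assumes "chain c Q" "S (c @ r)" shows "S (path_word (c @ r) Q)"
  using assms(1)
proof (induction Q)
  case (Cons a Q)
  obtain b u where a: "a = (b, u)" by force
  obtain m where m: "path_word (c @ r) Q = head_band c Q @ m" using path_word_head by blast
  have "S ((b @ u) @ head_band c Q @ m)"
    using Cons a m chain_head[of c Q] brot_undir[OF brot_refl[OF B_bnd]] by (intro glue) auto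
  then show ?case using a m by simp
qed (use assms(2) in simp)

lemma chain_S0: "chain c Q \<Longrightarrow> S (path_word c Q)"
  using chain_S[of c Q "[]"] chain_last B_bnd brot_S brot_refl by fastforce

text \<open>If \<open>b\<close> is also the next band, \<open>b @ u @ b\<close> makes
  \<open>u\<close> a power of \<open>b\<close>, which is empty because \<open>u\<close> is
  band-free, so the bridge is trivial. A later recurrence of \<open>b\<close> contradicts
  \<open>no_return\<close>, applied to the next band in between.\<close>

lemma chain_acyclic:
  assumes "chain c ((b, u) # Q)" shows "b \<noteq> c" "b \<notin> fst ` set Q"
proof -
  have b: "bnd b" "Letters b \<in> B" using assms B_bnd by auto
  have 1: "b \<noteq> head_band c Q"
  proof
    assume e: "b = head_band c Q"
    then have "S (b @ u @ b)" using assms by simp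
    then have "b @ u = u @ b" by (rule windows_commute[OF brot_refl[OF b(1)] brot_refl[OF b(1)]])
    then obtain j where j: "u = pow b j"
      using prim_commute[OF brot_prim[OF brot_refl[OF b(1)]]] by blast
    have "j = 0"
    proof (cases j)
      case (Suc i)
      then have "u = [] @ b @ pow b i" using j by simp
      moreover have "bfree u" using assms by simp
      ultimately show ?thesis using brot_refl[OF b(1)] unfolding bfree_def by blast
    qed
    then show False using assms e j by simp
  qed
  have "\<not> (b = c \<or> b \<in> fst ` set Q)"
  proof
    assume m: "b = c \<or> b \<in> fst ` set Q"
    show False
    proof (cases Q)
      case Nil
      then show False using m 1 by simp
    next
      case (Cons a Q')
      obtain b' u' where a: "a = (b', u')" by force
      then have "b \<noteq> b'" using 1 Cons by simp
      then have "b = c \<or> b \<in> fst ` set Q'" using m Cons a by auto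
      then obtain y r where y: "path_word c Q' = y @ b @ r" using path_word_mem by metis
      have "S (path_word c ((b, u) # Q))" using chain_S0 assms by blast
      then have "S ((b @ u @ b' @ (u' @ y) @ b) @ r)" using y Cons a by simp
      then have s: "S (b @ u @ b' @ (u' @ y) @ b)" by (rule S_prefix) (use bnd_nonempty[OF b(1)] in simp)
      have b': "Letters b' \<in> B" using assms Cons a by simp
      have "rot b b'"
        using no_return[OF brot_refl[OF b(1)] brot_refl[OF b(1)] brot_refl[OF B_bnd[OF b']] s] .
      then show False using B_unique[OF b(2) b'] \<open>b \<noteq> b'\<close> by simp
    qed
  qed
  then show "b \<noteq> c" "b \<notin> fst ` set Q" by auto
qed

lemma chain_distinct: "chain c Q \<Longrightarrow> distinct (map fst Q)"
proof (induction Q)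
  case (Cons a Q)
  obtain b u where a: "a = (b, u)" by force
  show ?case using Cons chain_acyclic[of c b u Q] a by auto
qed simp

lemma chain_head_neq: "chain c ((b, u) # Q) \<Longrightarrow> b \<noteq> head_band c Q"
proof -
  assume "chain c ((b, u) # Q)"
  from chain_acyclic[OF this] show ?thesis by (cases "(c, Q)" rule: head_band.cases) simp_all
qed

subsection \<open>Runs of a band into its surroundings\<close>

text \<open>The equation \<open>h @ c = d @ h\<close> says that \<open>h\<close> extends the run of the band \<open>c\<close> to the left.\<close>

lemma extend_run:
  assumes c: "bnd c" and h: "h @ c = d @ h" and s: "S (h @ c @ m)"
  shows "S (d @ h @ c @ m)" "brot c d"
proof -
  show d: "brot c d" using rot_if_conj[OF h] c by (simp add: brot_def)
  have e: "h @ c @ m = d @ h @ m" using arg_cong[OF h, of "\<lambda>x. x @ m"] by simp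
  have "S (d @ h @ m)" using s by (simp only: e)
  then have "S (d @ d @ h @ m)" by (rule extend_left[OF d])
  then show "S (d @ h @ c @ m)" by (simp only: e)
qed

text \<open>A window of \<open>c\<close> slid to the left cannot overlap \<open>b\<close>, and it
  cannot lie beyond \<open>b\<close> by \<open>no_return\<close>.\<close>

lemma run_left_of_band:
  assumes b: "Letters b \<in> B" and c: "Letters c \<in> B" and ne: "b \<noteq> c"
    and s: "S (Y @ b @ u @ c @ m)" and h: "suffix h (Y @ b @ u)" "h @ c = d @ h"
  shows "suffix h u"
proof -
  obtain P where P: "Y @ b @ u = P @ h" using h(1) by (auto simp: suffix_def)
  have d: "brot c d" using rot_if_conj[OF h(2)] B_bnd[OF c] by (simp add: brot_def)
  have "Y @ b @ (u @ c @ m) = (Y @ b @ u) @ c @ m" by simp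
  also have "\<dots> = P @ (h @ c) @ m" by (simp only: P append_assoc)
  also have "\<dots> = P @ d @ (h @ m)" by (simp only: h(2) append_assoc)
  finally have e: "Y @ b @ (u @ c @ m) = P @ d @ (h @ m)" .
  have nr: "\<not> rot b c" using B_unique[OF b c] ne by blast
  from window_disjoint[OF _ e B_bnd[OF b] d nr] s show ?thesis
  proof cases
    fix r assume r: "Y = P @ d @ r"
    then have "S (P @ (d @ r @ b @ u @ c) @ m)" using s by simp
    then have "S (d @ r @ b @ u @ c)" by (rule S_factor) (use brot_nonempty[OF d] in simp)
    from no_return[OF d brot_refl[OF B_bnd[OF c]] brot_refl[OF B_bnd[OF b]] this]
    show ?thesis using nr rot_sym by blast
  next
    fix r assume "P = Y @ b @ r"
    then have "u = r @ h" using P by simp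
    then show ?thesis by (auto simp: suffix_def)
  qed
qed

text \<open>The deleted band can be put back into any longer run of \<open>c\<close>, which would
  produce a return to \<open>c\<close> through \<open>b\<close>. If the witness \<open>g\<close> of
  the reduction fits into the part \<open>h1\<close> of the run beyond the bridge, H-equivalence
  reinserts the window \<open>e\<close>. Otherwise \<open>h1\<close> ends with the same inverse
  syllable as \<open>b\<close>, and \<open>b\<close> itself can be joined there.\<close>

lemma run_left_of_reduced_band:
  assumes b: "Letters b \<in> B" and c: "Letters c \<in> B" and ne: "b \<noteq> c"
    and s: "S (X @ b @ u @ c @ m)" and red: "Hred X b (u @ c @ m)"
    and h: "suffix h (X @ u)" "h @ c = d @ h"
  shows "suffix h u"
proof (rule ccontr)
  assume n: "\<not> suffix h u"
  have nr: "\<not> rot c b" using B_unique[OF c b] ne by blast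
  note cb = brot_refl[OF B_bnd[OF c]] and bb = brot_refl[OF B_bnd[OF b]]
  obtain P where P: "P @ h = X @ u" using h(1) by (auto simp: suffix_def)
  have "length P < length X"
  proof (rule ccontr)
    assume "\<not> length P < length X"
    then obtain r where "u = r @ h" using append_eq_split[OF P[symmetric]] by auto
    then show False using n by (auto simp: suffix_def)
  qed
  then obtain h1 where h1: "X = P @ h1" "h = h1 @ u"
    using append_eq_split[OF P] by auto
  then have h1ne: "h1 \<noteq> []" using n by auto
  have "S (X @ u @ c @ m)" using Hred_S[OF red] s by simp
  then have "S (P @ (h @ c @ m))" using h1 by simp
  then have "S (h @ c @ m)" by (rule S_suffix) (use brot_nonempty[OF cb] in simp)
  from extend_run[OF B_bnd[OF c] h(2) this]
  have s2: "S (d @ h1 @ u @ c @ m)" and d: "brot c d" using h1 by simp_all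
  obtain g e where g: "suffix g X" "g @ b = e @ g" "Heq (e @ g @ u @ c @ m) (g @ u @ c @ m)"
    using red by (auto simp: Hred_def)
  have e: "brot b e" using rot_if_conj[OF g(2)] B_bnd[OF b] by (simp add: brot_def)
  obtain X1 where X1: "X1 @ g = P @ h1" using g(1) h1 by (auto simp: suffix_def)
  show False
  proof (cases "length P \<le> length X1")
    case True
    then obtain x where x: "h1 = x @ g" using append_eq_split[OF X1[symmetric]] by auto
    then have "S ((d @ x) @ g @ u @ c @ m)" using s2 by simp
    from Heq_S_append[OF Heq_sym[OF g(3)] this]
    have "S ((d @ x @ e @ (g @ u) @ c) @ m)" by simp
    then have "S (d @ x @ e @ (g @ u) @ c)" by (rule S_prefix) (use brot_nonempty[OF d] in simp)
    from no_return[OF d cb e this] nr show False by contradiction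
  next
    case False
    then obtain g1 where g1: "g = g1 @ h1" using append_eq_split[OF X1] by auto
    have "last (g @ b) = last (e @ g)" by (simp only: g(2))
    then have l: "last h1 = last b" using g1 h1ne bnd_nonempty[OF B_bnd[OF b]] by simp
    obtain x y where xy: "last b = Inv x" "hd b = Dir y" using B_bnd[OF b] bnd_iff by blast
    have "adj (last b) (hd b)" using S_adj[OF brot_S2[OF bb]] brot_nonempty[OF bb] by blast
    moreover have "S (d @ h1)" using S_prefix[of "d @ h1" "u @ c @ m"] s2 h1ne by simp
    ultimately have "S ((d @ h1) @ b)"
      using glue_cut[of "d @ h1" b] brot_S[OF bb] l xy h1ne by simp
    moreover have "S (b @ u @ c @ m)" using S_suffix[OF s] brot_nonempty[OF bb] by simp
    ultimately have "S ((d @ h1) @ b @ u @ c @ m)" using glue brot_undir[OF bb] by blast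
    then have "S ((d @ h1 @ b @ u @ c) @ m)" by simp
    then have "S (d @ h1 @ b @ u @ c)" by (rule S_prefix) (use brot_nonempty[OF d] in simp)
    from no_return[OF d cb bb this] nr show False by contradiction
  qed
qed

text \<open>By H-equivalence, \<open>e\<close> can be inserted before \<open>u\<close> in any
  string. A run of \<open>c\<close> reaching the left end of \<open>u\<close> would then return to
  \<open>c\<close> across \<open>e\<close>; this happens already for \<open>h = u\<close>, whence
  the strict inequality.\<close>

lemma run_left_of_doubly_reduced_band:
  assumes b: "Letters b \<in> B" and c: "Letters c \<in> B" and ne: "b \<noteq> c"
    and e: "brot b e" and eq: "Heq (e @ u @ c @ m) (u @ c @ m)"
    and s: "S (Y @ u @ c @ m)"
    and h: "suffix h (Y @ u)" "h @ c = d @ h"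
  shows "length h < length u"
proof (rule ccontr)
  assume n: "\<not> length h < length u"
  obtain P where P: "P @ h = Y @ u" using h(1) by (auto simp: suffix_def)
  have "length P \<le> length Y" using n arg_cong[OF P, of length] by simp
  then obtain h1 where h1: "Y = P @ h1" "h = h1 @ u" using append_eq_split[OF P] by auto
  note cb = brot_refl[OF B_bnd[OF c]]
  have "S (P @ (h @ c @ m))" using h1 s by simp
  then have "S (h @ c @ m)" by (rule S_suffix) (use brot_nonempty[OF cb] in simp)
  from extend_run[OF B_bnd[OF c] h(2) this]
  have s2: "S ((d @ h1) @ u @ c @ m)" and d: "brot c d" using h1 by simp_all
  from Heq_S_append[OF Heq_sym[OF eq] s2] have "S ((d @ h1 @ e @ u @ c) @ m)" by simp
  then have "S (d @ h1 @ e @ u @ c)" by (rule S_prefix) (use brot_nonempty[OF d] in simp)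
  from no_return[OF d cb e this] show False using B_unique[OF c b] ne by blast
qed

lemma window_after_band:
  assumes a: "Letters a \<in> B" and b: "Letters b \<in> B" and ne: "a \<noteq> b" and e: "brot b e"
    and s: "S (a @ l)" and eq: "a @ l = X @ e @ m"
  obtains r where "X = a @ r"
proof -
  have "\<not> rot a b" using B_unique[OF a b] ne by blast
  from window_disjoint[of "[]" a l X e m b] this s eq B_bnd[OF a] e that brot_nonempty[OF e]
  show thesis by auto
qed

text \<open>Two periods \<open>h @ k\<close> stand in a row. The second one cannot overlap the next
  band \<open>c\<close>, so its part \<open>k\<close> lies in the bridge.\<close>

lemma double_window_prefix:
  assumes b: "Letters (k @ h) \<in> B" and c: "Letters c \<in> B" and ne: "k @ h \<noteq> c"
    and s: "S (X @ h @ k @ h @ u @ c @ m)" and k: "u @ c @ m = k @ l"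
  shows "prefix k u"
proof -
  have r: "brot (k @ h) (h @ k)" using B_bnd[OF b] rot_append_commute by (simp add: brot_def)
  have "(X @ h @ k @ h @ u) @ c @ m = X @ h @ k @ h @ (u @ c @ m)" by simp
  also have "\<dots> = (X @ h @ k) @ (h @ k) @ l" by (simp only: k append_assoc)
  finally have e: "(X @ h @ k @ h @ u) @ c @ m = (X @ h @ k) @ (h @ k) @ l" .
  have nr: "\<not> rot c (k @ h)" using B_unique[OF c b] ne by blast
  have s2: "S ((X @ h @ k @ h @ u) @ c @ m)" using s by simp
  from window_disjoint[OF s2 e B_bnd[OF c] r nr] show ?thesis
  proof cases
    fix r assume "X @ h @ k @ h @ u = (X @ h @ k) @ (h @ k) @ r"
    then show ?thesis by simp
  next
    fix r assume "X @ h @ k = (X @ h @ k @ h @ u) @ c @ r"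
    then show ?thesis using bnd_nonempty[OF B_bnd[OF c]] by simp
  qed
qed

section \<open>Invariance of the reductions\<close>

lemma Hred_Heq:
  assumes "Heq l l'" shows "Hred X b l \<longleftrightarrow> Hred X b l'"
proof -
  have "Heq (c @ h @ l') (h @ l')" if "Heq (c @ h @ l) (h @ l)" "Heq l l'" for c h l l'
    using Heq_cong[OF that(2), of h] Heq_cong[OF that(2), of "c @ h"] Heq_S[OF that(1)] that(1)
      Heq_trans Heq_sym by (metis append.assoc)
  then show ?thesis using assms Heq_sym unfolding Hred_def by blast
qed

text \<open>In \<open>X0 @ h @ (k @ h) @ k @ l'\<close> the band \<open>k @ h\<close> sits in two
  adjacent periods \<open>h @ k\<close>. One of them can go by \<open>Heq_window\<close>; this asks
  whether the other can go as well. It refers only to the word \<open>l\<close> behind the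
  band.\<close>

definition Hred2 :: "'a syllable list \<Rightarrow> 'a syllable list \<Rightarrow> 'a syllable list \<Rightarrow> bool" where
  "Hred2 h k l \<longleftrightarrow> (\<exists>l'. l = k @ l' \<and> Heq (h @ k @ l') l')"

text \<open>Finer than H-equivalence: since \<open>Hred2\<close> splits off a prefix of the word, it
  is transported along removals of windows of other bands.\<close>

inductive Hsteps :: "'a syllable list set \<Rightarrow> 'a syllable list \<Rightarrow> 'a syllable list \<Rightarrow> bool"
  for A where
  Hsteps_refl: "Hsteps A l l"
| Hsteps_step: "Hsteps A l (p @ e @ s) \<Longrightarrow> Heq (e @ s) s \<Longrightarrow> brot c e \<Longrightarrow> c \<in> A \<Longrightarrow> Hsteps A l (p @ s)"

lemma Hsteps_Heq: "Hsteps A l l' \<Longrightarrow> S l \<Longrightarrow> Heq l l'"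
proof (induction rule: Hsteps.induct)
  case (Hsteps_step l p e s c)
  then have h: "Heq l (p @ e @ s)" by blast
  then show ?case using Heq_cong[OF Hsteps_step(2), of p] Heq_S(2)[OF h] Heq_trans by blast
qed (rule Heq_refl)

lemma Hsteps_cong: "Hsteps A l l' \<Longrightarrow> Hsteps A (x @ l) (x @ l')"
proof (induction rule: Hsteps.induct)
  case (Hsteps_step l p e s c)
  then show ?case using Hsteps.Hsteps_step[of A "x @ l" "x @ p" e s c] by simp
qed (rule Hsteps_refl)

lemma Hsteps_trans: "Hsteps A l' l'' \<Longrightarrow> Hsteps A l l' \<Longrightarrow> Hsteps A l l''"
  by (induction rule: Hsteps.induct) (auto intro: Hsteps.Hsteps_step)

lemma Hsteps_mono: "Hsteps A l l' \<Longrightarrow> A \<subseteq> A' \<Longrightarrow> Hsteps A' l l'"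
  by (induction rule: Hsteps.induct) (auto intro: Hsteps_refl Hsteps.Hsteps_step)

lemma Hsteps_single:
  "Heq (e @ s) s \<Longrightarrow> brot c e \<Longrightarrow> c \<in> A \<Longrightarrow> Hsteps A (p @ e @ s) (p @ s)"
  using Hsteps.Hsteps_step[OF Hsteps_refl] by blast

text \<open>If the doubly reduced window reached beyond the removed one, the string would lead from
  the band \<open>k @ h\<close> to \<open>c\<close> and back.\<close>

lemma Hred2_step:
  assumes b: "bnd (k @ h)" and e: "brot c e" and nr: "\<not> rot (k @ h) c"
    and s: "S ((k @ h) @ p @ e @ s)" and eq: "Heq (e @ s) s"
  shows "Hred2 h k (p @ e @ s) \<longleftrightarrow> Hred2 h k (p @ s)"
proof -
  have bb: "brot (k @ h) (k @ h)" and r: "brot (k @ h) (h @ k)"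
    using b rot_append_commute by (simp_all add: brot_def)
  have spe: "S ((k @ h) @ p @ e)" using S_prefix[of "(k @ h) @ p @ e" s] s brot_nonempty[OF e] by simp
  have bad: False if "S (e @ m @ (h @ k) @ l)" for m l
  proof -
    have "S (((k @ h) @ p) @ e @ (m @ (h @ k) @ l))"
      by (rule glue) (use spe that brot_undir[OF e] in simp_all)
    then have "S (((k @ h) @ p @ e @ m @ (h @ k)) @ l)" by simp
    then have "S ((k @ h) @ p @ e @ m @ (h @ k))" by (rule S_prefix) (use brot_nonempty[OF e] in simp)
    from no_return[OF bb r e this] nr show False by contradiction
  qed
  have ses: "S (e @ s)" using Heq_S(1)[OF eq] .
  have short: "Hred2 h k (q @ s') \<Longrightarrow> (\<exists>p'. q = k @ p' \<and> Heq (h @ k @ p' @ s') (p' @ s')) \<or>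
      (\<exists>m l. k = q @ m \<and> s' = m @ l \<and> Heq (h @ k @ l) l)" for q s'
  proof -
    assume "Hred2 h k (q @ s')"
    then obtain l where l: "q @ s' = k @ l" "Heq (h @ k @ l) l" unfolding Hred2_def by blast
    show ?thesis
    proof (cases "length k \<le> length q")
      case True
      then obtain p' where "q = k @ p'" "l = p' @ s'" using append_eq_split[OF l(1)[symmetric]] by auto
      then show ?thesis using l(2) by auto
    next
      case False
      then obtain m where "k = q @ m" "s' = m @ l" using append_eq_split[OF l(1)] by auto
      then show ?thesis using l(2) by auto
    qed
  qed
  have fwd: "Heq (h @ k @ p' @ x) (p' @ x)" if "Heq (h @ k @ p' @ y) (p' @ y)" "Heq y x" for p' x y
    using Heq_cong[OF that(2), of p'] Heq_cong[OF that(2), of "h @ k @ p'"] that(1) Heq_S[OF that(1)]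
      Heq_trans Heq_sym by (metis append.assoc)
  show ?thesis
  proof
    assume "Hred2 h k (p @ e @ s)"
    then consider p' where "p = k @ p'" "Heq (h @ k @ p' @ e @ s) (p' @ e @ s)"
      | m l where "k = p @ m" "e @ s = m @ l" "Heq (h @ k @ l) l"
      using short[of p "e @ s"] by blast
    then show "Hred2 h k (p @ s)"
    proof cases
      case 1
      then show ?thesis using fwd[OF 1(2) eq] unfolding Hred2_def by auto
    next
      case 2
      \<comment> \<open>A second copy of \<open>e\<close> stays in front when the periods of
        \<open>k @ h\<close> are reinserted behind it.\<close>
      have "S (e @ e @ s)" using extend_left[OF e ses] .
      then have "S ((e @ m) @ l)" by (simp only: 2(2) append_assoc)
      from Heq_S_append[OF Heq_sym[OF 2(3)] this] have "S (e @ m @ (h @ k) @ l)" by simp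
      from bad[OF this] show ?thesis ..
    qed
  next
    assume "Hred2 h k (p @ s)"
    then consider p' where "p = k @ p'" "Heq (h @ k @ p' @ s) (p' @ s)"
      | m l where "k = p @ m" "s = m @ l" "Heq (h @ k @ l) l"
      using short[of p s] by blast
    then show "Hred2 h k (p @ e @ s)"
    proof cases
      case 1
      then show ?thesis using fwd[OF 1(2) Heq_sym[OF eq]] unfolding Hred2_def by auto
    next
      case 2
      have "S ((e @ m) @ l)" using ses 2(2) by simp
      from Heq_S_append[OF Heq_sym[OF 2(3)] this] have "S (e @ m @ (h @ k) @ l)" by simp
      from bad[OF this] show ?thesis ..
    qed
  qed
qed

lemma Hred2_Hsteps:
  assumes "Hsteps A l l'" and s: "S ((k @ h) @ l)" and b: "Letters (k @ h) \<in> B"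
    and A: "\<And>c. c \<in> A \<Longrightarrow> Letters c \<in> B \<and> c \<noteq> k @ h"
  shows "Hred2 h k l \<longleftrightarrow> Hred2 h k l'"
  using assms(1,2)
proof (induction rule: Hsteps.induct)
  case (Hsteps_step l p e s c)
  note bn = bnd_nonempty[OF B_bnd[OF b]]
  have h: "Hsteps A ((k @ h) @ l) ((k @ h) @ p @ e @ s)" using Hsteps_cong[OF Hsteps_step(1)] .
  have "S ((k @ h) @ p @ e @ s)"
    using Heq_S(2)[OF Hsteps_Heq[OF h]] Hsteps_step(6) by simp
  moreover have "\<not> rot (k @ h) c" using A[OF Hsteps_step(4)] B_unique[OF b] by metis
  ultimately show ?case
    using Hred2_step[OF B_bnd[OF b] Hsteps_step(3)] Hsteps_step by blast
qed simp

section \<open>Reducing a path from the left\<close>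

text \<open>\<open>X\<close> is the part of the word already treated, \<open>b\<close> the next band, \<open>u\<close> the bridge after it and
  \<open>R\<close> the rest. In the first case two periods are removed: one by the skeleton and one
  by \<open>h_band\<close>.\<close>

definition twice :: "'a syllable list \<Rightarrow> 'a syllable list \<Rightarrow> 'a syllable list \<Rightarrow> 'a syllable list \<Rightarrow>
    'a syllable list \<Rightarrow> bool" where
  "twice X b u R X' \<longleftrightarrow> (\<exists>X0 h k u'. X = X0 @ h \<and> u = k @ u' \<and> b = k @ h \<and>
     Heq (h @ k @ u' @ R) (u' @ R) \<and> X' = X0 @ u')"

text \<open>A relation, because the cut \<open>b = k @ h\<close> in \<open>twice\<close> need not be
  unique. By \<open>fold_h_band\<close>, every run on a treated word ends in the value of the
  reductions, so the choice does not matter.\<close>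

definition step :: "'a syllable list \<Rightarrow> 'a syllable list \<Rightarrow> 'a syllable list \<Rightarrow> 'a syllable list \<Rightarrow>
    'a syllable list \<Rightarrow> bool" where
  "step X b u R X' \<longleftrightarrow>
     (if \<exists>X'. twice X b u R X' then twice X b u R X'
      else if Hred X b (u @ R) then X' = X @ u else X' = X @ b @ u)"

fun run :: "'a syllable list \<Rightarrow> 'a syllable list \<Rightarrow> ('a syllable list \<times> 'a syllable list) list \<Rightarrow>
    'a syllable list \<Rightarrow> bool" where
  "run t X [] X' \<longleftrightarrow> X' = X"
| "run t X ((b, u) # Q) X' \<longleftrightarrow> (\<exists>X1. step X b u (path_word t Q) X1 \<and> run t X1 Q X')"

lemma step_total: "\<exists>X'. step X b u R X'"
  unfolding step_def by (cases "\<exists>X'. twice X b u R X'") auto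

lemma run_total: "\<exists>X'. run t X Q X'"
proof (induction Q arbitrary: X)
  case (Cons q Q)
  obtain b u where q: "q = (b, u)" by force
  obtain X1 where X1: "step X b u (path_word t Q) X1" using step_total by blast
  obtain X' where "run t X1 Q X'" using Cons by blast
  with X1 q show ?case by auto
qed (simp add: exI)

lemma run_append:
  "run t X (Q1 @ Q2) X' \<longleftrightarrow> (\<exists>X1. run (path_word t Q2) X Q1 X1 \<and> run t X1 Q2 X')"
proof (induction Q1 arbitrary: X)
  case (Cons q Q1)
  obtain b u where q: "q = (b, u)" by force
  show ?case by (simp add: q path_word_append Cons) blast
qed simp

lemma step_cases:
  assumes "step X b u R X'"
  obtains X0 h k u' where "X = X0 @ h" "u = k @ u'" "b = k @ h" "Heq (h @ k @ u' @ R) (u' @ R)" "X' = X0 @ u'"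
  | "\<not> (\<exists>X'. twice X b u R X')" "Hred X b (u @ R)" "X' = X @ u"
  | "\<not> (\<exists>X'. twice X b u R X')" "\<not> Hred X b (u @ R)" "X' = X @ b @ u"
  using assms unfolding step_def by (auto simp: twice_def split: if_splits)

lemma twice_step: "twice X b u R X' \<Longrightarrow> step X b u R X'"
  by (auto simp: step_def)

text \<open>The last conjunct says that the treated part \<open>X\<close> admits the same extensions of the
  run of the next band as the preceding bridge \<open>w\<close>.\<close>

definition treated :: "'a syllable list \<Rightarrow> 'a syllable list \<Rightarrow> 'a syllable list \<Rightarrow> 'a syllable list \<Rightarrow>
    'a syllable list \<Rightarrow> ('a syllable list \<times> 'a syllable list) list \<Rightarrow> bool" where
  "treated a X w c r Q \<longleftrightarrow> (\<exists>Z. X = a @ Z) \<and> Letters a \<in> B \<and> a \<noteq> c \<and> a \<notin> fst ` set Q \<and> chain c Q \<and>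
     S (X @ path_word (c @ r) Q) \<and> bfree w \<and>
     (\<forall>h d. h @ head_band c Q = d @ h \<longrightarrow> (suffix h X \<longleftrightarrow> suffix h w))"

lemma twice_S:
  assumes "X = X0 @ h" "u = k @ u'" "b = k @ h" "bnd b"
    and eq: "Heq (h @ k @ u' @ R) (u' @ R)" and s: "S (X @ b @ u @ R)"
  shows "S (X0 @ u' @ R)" "S (X0 @ h @ k @ u' @ R)" "Heq ((h @ k) @ (h @ k) @ u' @ R) ((h @ k) @ u' @ R)"
    "brot b (h @ k)"
proof -
  show r: "brot b (h @ k)" using assms(3,4) rot_append_commute by (simp add: brot_def)
  show w: "Heq ((h @ k) @ (h @ k) @ u' @ R) ((h @ k) @ u' @ R)"
    using Heq_window[OF r] Heq_S(1)[OF eq] by simp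
  have "S (X0 @ ((h @ k) @ (h @ k) @ u' @ R))" using s assms(1-3) by simp
  from Heq_S_append[OF w this] show s2: "S (X0 @ h @ k @ u' @ R)" by simp
  from Heq_S_append[OF eq this] show "S (X0 @ u' @ R)" .
qed

text \<open>A window of \<open>b\<close> cannot overlap the different band \<open>a\<close> at the
  left end. So the target band of the path survives all reductions, as the equation defining
  \<open>is_h\<close> demands.\<close>

lemma treated_first:
  assumes i: "treated a X w c r ((b, u) # Q)" and X: "X = X0 @ g" and g: "g @ b = e @ g"
  shows "\<exists>Z. X0 = a @ Z"
proof -
  obtain Z where Z: "X = a @ Z" using i by (auto simp: treated_def)
  have b: "Letters b \<in> B" and a: "Letters a \<in> B" and ne: "a \<noteq> b" using i by (auto simp: treated_def)
  have e: "brot b e" using rot_if_conj[OF g] B_bnd[OF b] by (simp add: brot_def)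
  define l where "l = u @ path_word (c @ r) Q"
  have s: "S (X @ b @ l)" using i by (simp add: treated_def l_def)
  have "X @ b @ l = X0 @ (g @ b) @ l" using X by simp
  also have "\<dots> = X0 @ e @ (g @ l)" by (simp only: g append_assoc)
  finally have eq: "X @ b @ l = X0 @ e @ (g @ l)" .
  have "a @ (Z @ b @ l) = X0 @ e @ (g @ l)" using eq Z by simp
  moreover have "S (a @ (Z @ b @ l))" using s Z by simp
  ultimately show ?thesis using window_after_band[OF a b ne e] by blast
qed

text \<open>The runs of the next band stay inside \<open>u\<close> for a different reason in each
  case of \<open>step\<close>: \<open>run_left_of_doubly_reduced_band\<close>,
  \<open>run_left_of_reduced_band\<close> and \<open>run_left_of_band\<close>.\<close>

lemma treated_step:
  assumes i: "treated a X w c r ((b, u) # Q)" and st: "step X b u (path_word (c @ r) Q) X'"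
  shows "treated a X' u c r Q"
proof -
  define R where "R = path_word (c @ r) Q"
  define n where "n = head_band c Q"
  obtain m where m: "R = n @ m" using path_word_head unfolding R_def n_def by blast
  have b: "Letters b \<in> B" and ch: "chain c ((b, u) # Q)" and chQ: "chain c Q" and a: "Letters a \<in> B"
    and s: "S (X @ b @ u @ R)" and ab: "a \<noteq> b" and bu: "bfree u"
    using i by (auto simp: treated_def R_def)
  have n: "Letters n \<in> B" using chain_head[OF chQ] by (simp add: n_def)
  have bn: "b \<noteq> n" using chain_head_neq[OF ch] by (simp add: n_def)
  obtain Z where Z: "X = a @ Z" using i by (auto simp: treated_def)
  have "S (X' @ R) \<and> (\<exists>Z. X' = a @ Z) \<and> (\<forall>h d. h @ n = d @ h \<longrightarrow> (suffix h X' \<longleftrightarrow> suffix h u))"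
    using st[folded R_def]
  proof (cases rule: step_cases)
    case (1 X0 h k u')
    have g: "h @ b = (h @ k) @ h" using 1 by simp
    obtain Z0 where Z0: "X0 = a @ Z0" using treated_first[OF i 1(1) g] by blast
    note tw = twice_S[OF 1(1-3) B_bnd[OF b] 1(4) s]
    have eq: "Heq ((h @ k) @ u' @ n @ m) (u' @ n @ m)" using 1(4) m by simp
    have s1: "S (X0 @ u' @ n @ m)" using tw(1) m by simp
    \<comment> \<open>The words \<open>X' = X0 @ u'\<close> and \<open>u = k @ u'\<close> share only
      \<open>u'\<close>, so the bound on the run is needed with \<open>k\<close> in place of
      \<open>X0\<close> too.\<close>
    have s2: "S (k @ u' @ n @ m)"
      using S_suffix[of "X @ b" "u @ R"] s 1(2) m bnd_nonempty[OF B_bnd[OF n]] by simp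
    have "suffix g X' \<longleftrightarrow> suffix g u" if gd: "g @ n = d @ g" for g d
    proof
      assume "suffix g X'"
      then have gs: "suffix g (X0 @ u')" using 1 by simp
      then have "length g < length u'"
        using run_left_of_doubly_reduced_band[OF b n bn tw(4) eq s1 _ gd] by blast
      then have "suffix g u'" using gs suffix_length_suffix[of g "X0 @ u'" u'] by (simp add: suffixI)
      then show "suffix g u" using 1(2) suffix_appendI by blast
    next
      assume "suffix g u"
      then have gs: "suffix g (k @ u')" using 1 by simp
      then have "length g < length u'"
        using run_left_of_doubly_reduced_band[OF b n bn tw(4) eq s2 _ gd] by blast
      then have "suffix g u'" using gs suffix_length_suffix[of g "k @ u'" u'] by (simp add: suffixI)
      then show "suffix g X'" using 1(5) suffix_appendI by blast
    qed
    then show ?thesis using 1 Z0 tw(1) by auto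
  next
    case 2
    have red: "Hred X b (u @ n @ m)" using 2(2) m by simp
    have s1: "S (X @ b @ u @ n @ m)" using s m by simp
    have "suffix g X' \<longleftrightarrow> suffix g u" if gd: "g @ n = d @ g" for g d
      using run_left_of_reduced_band[OF b n bn s1 red _ gd] 2(3) suffix_appendI by blast
    moreover have "S (X' @ R)" using Hred_S[OF 2(2)] s 2(3) by simp
    ultimately show ?thesis using 2(3) Z by auto
  next
    case 3
    have s1: "S (X @ b @ u @ n @ m)" using s m by simp
    have "suffix g X' \<longleftrightarrow> suffix g u" if gd: "g @ n = d @ g" for g d
      using run_left_of_band[OF b n bn s1 _ gd] 3(3) suffix_appendI by (metis append.assoc)
    moreover have "S (X' @ R)" using s 3(3) by simp
    ultimately show ?thesis using 3(3) Z by auto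
  qed
  then show ?thesis
    using i bu unfolding treated_def R_def n_def by auto
qed

lemma treated_run:
  "treated a X w c r (Q1 @ Q2) \<Longrightarrow> run (path_word (c @ r) Q2) X Q1 X1 \<Longrightarrow>
     treated a X1 (last (w # map snd Q1)) c r Q2"
proof (induction Q1 arbitrary: X w)
  case (Cons q Q1)
  obtain b u where q: "q = (b, u)" by force
  obtain X2 where X2: "step X b u (path_word (path_word (c @ r) Q2) Q1) X2"
      "run (path_word (c @ r) Q2) X2 Q1 X1"
    using Cons.prems q by auto
  have "treated a X2 u c r (Q1 @ Q2)"
    using treated_step[of a X w c r b u "Q1 @ Q2" X2] Cons.prems q X2(1) by (simp add: path_word_append)
  from Cons.IH[OF this X2(2)] show ?case using q by simp
qed simp

lemma treated_start:
  assumes ch: "chain c ((b, u) # Q)" and s: "S (c @ r)"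
  shows "treated b (b @ u) u c r Q"
proof -
  obtain m where m: "path_word (c @ r) Q = head_band c Q @ m" using path_word_head by blast
  have S: "S ([] @ b @ u @ head_band c Q @ m)" using chain_S[OF ch s] m by simp
  have b: "Letters b \<in> B" and n: "Letters (head_band c Q) \<in> B" using ch chain_head[of c Q] by auto
  have "suffix h (b @ u) \<longleftrightarrow> suffix h u" if "h @ head_band c Q = d @ h" for h d
    using run_left_of_band[OF b n chain_head_neq[OF ch] S _ that] suffix_appendI by auto
  then show ?thesis
    using ch chain_acyclic[OF ch] S m b unfolding treated_def by auto
qed

section \<open>Independence of what follows the last band\<close>

lemma Heq_tails:
  assumes "Letters c \<in> B" "S (path_word (c @ r1) Q)" "S (path_word (c @ r2) Q)"
  shows "Heq (path_word (c @ r1) Q) (path_word (c @ r2) Q)"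
proof -
  obtain p where p: "\<And>t. path_word t Q = p @ t" using path_word_tail by blast
  show ?thesis
    using Heq_common_prefix[of p c r1 r2] assms brot_undir[OF brot_refl[OF B_bnd[OF assms(1)]]]
    unfolding p by simp
qed

lemma step_Heq:
  assumes "Heq R R'" "S (u @ R)"
  shows "step X b u R X' \<longleftrightarrow> step X b u R' X'"
proof -
  have "twice X b u R' X'" if t: "twice X b u R X'" and eq: "Heq R R'" and s: "S (u @ R)" for R R' X'
  proof -
    obtain X0 h k u' where w: "X = X0 @ h" "u = k @ u'" "b = k @ h" "Heq (h @ k @ u' @ R) (u' @ R)" "X' = X0 @ u'"
      using t by (auto simp: twice_def)
    have "Heq (u' @ R) (u' @ R')" "Heq (h @ k @ u' @ R) (h @ k @ u' @ R')"
      using Heq_cong[OF eq, of u'] Heq_cong[OF eq, of "h @ k @ u'"] Heq_S[OF w(4)] by simp_all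
    then have "Heq (h @ k @ u' @ R') (u' @ R')" using w(4) Heq_trans Heq_sym by blast
    then show ?thesis using w unfolding twice_def by blast
  qed
  moreover have "S (u @ R')" using Heq_S_append assms by blast
  ultimately have tw: "twice X b u R = twice X b u R'"
    using assms Heq_sym by blast
  have hr: "Hred X b (u @ R) = Hred X b (u @ R')"
    using Hred_Heq Heq_cong[OF assms] by blast
  show ?thesis unfolding step_def tw hr ..
qed

text \<open>The H-class of a word ignores what follows the band \<open>c\<close> in it, and
  \<open>step\<close> sees its right side only through the H-class.\<close>

lemma run_tails:
  assumes "Letters c \<in> B" "S (path_word (c @ r1) Q)" "S (path_word (c @ r2) Q)"
  shows "run (c @ r1) X Q X' \<longleftrightarrow> run (c @ r2) X Q X'"
  using assms(2,3)
proof (induction Q arbitrary: X)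
  case (Cons q Q)
  obtain b u where q: "q = (b, u)" by force
  note ne = bnd_nonempty[OF B_bnd[OF assms(1)]]
  obtain p where p: "\<And>t. path_word t Q = p @ t" using path_word_tail by blast
  have s: "S (path_word (c @ r1) Q)" "S (path_word (c @ r2) Q)" "S (u @ path_word (c @ r1) Q)"
    using Cons.prems S_suffix[of "b @ u" "path_word (c @ r1) Q"] S_suffix[of "b @ u" "path_word (c @ r2) Q"]
      S_suffix[of "b" "u @ path_word (c @ r1) Q"] q ne p by auto
  show ?case
    using Cons.IH[OF s(1,2)] step_Heq[OF Heq_tails[OF assms(1) s(1,2)] s(3)] q by simp
qed simp

text \<open>The three outcomes amount to two, one or no H-reduction behind \<open>a\<close>; in the
  first case the first of the two is \<open>Heq_window\<close>. This is how \<open>Hred2\<close> for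
  \<open>a\<close> is carried along a run.\<close>

lemma treated_step_Hsteps:
  assumes i: "treated a (a @ Z) w c r ((b, u) # Q)" and st: "step (a @ Z) b u (path_word (c @ r) Q) X'"
  obtains Z' where "X' = a @ Z'" "Hsteps {b} (Z @ path_word (c @ r) ((b, u) # Q)) (Z' @ path_word (c @ r) Q)"
proof -
  define R where "R = path_word (c @ r) Q"
  have b: "Letters b \<in> B" and s: "S ((a @ Z) @ b @ u @ R)" using i by (auto simp: treated_def R_def)
  have pw: "path_word (c @ r) ((b, u) # Q) = b @ u @ R" by (simp add: R_def)
  show thesis
    using st[folded R_def]
  proof (cases rule: step_cases)
    case (1 X0 h k u')
    have g: "h @ b = (h @ k) @ h" using 1 by simp
    obtain Z0 where Z0: "X0 = a @ Z0" using treated_first[OF i 1(1) g] by blast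
    note tw = twice_S[OF 1(1-3) B_bnd[OF b] 1(4) s]
    have Z: "Z = Z0 @ h" using 1(1) Z0 by simp
    have "Hsteps {b} (Z0 @ (h @ k) @ (h @ k) @ u' @ R) (Z0 @ (h @ k) @ u' @ R)"
      using Hsteps_single[OF tw(3) tw(4), of "{b}" Z0] by simp
    moreover have "Hsteps {b} (Z0 @ (h @ k) @ u' @ R) (Z0 @ u' @ R)"
      using Hsteps_single[of "h @ k" "u' @ R" b "{b}" Z0] 1(4) tw(4) by simp
    ultimately have "Hsteps {b} (Z0 @ (h @ k) @ (h @ k) @ u' @ R) (Z0 @ u' @ R)"
      using Hsteps_trans by blast
    then show thesis using that[of "Z0 @ u'"] 1 Z Z0 pw R_def by simp
  next
    case 2
    obtain g e X0 where g: "a @ Z = X0 @ g" "g @ b = e @ g" "Heq (e @ g @ u @ R) (g @ u @ R)"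
      using 2(2) by (auto simp: Hred_def suffix_def)
    obtain Z0 where Z0: "X0 = a @ Z0" using treated_first[OF i g(1,2)] by blast
    have e: "brot b e" using rot_if_conj[OF g(2)] B_bnd[OF b] by (simp add: brot_def)
    have Z: "Z = Z0 @ g" using g(1) Z0 by simp
    have "Z @ b @ u @ R = Z0 @ (g @ b) @ u @ R" using Z by simp
    also have "\<dots> = Z0 @ e @ (g @ u @ R)" by (simp only: g(2) append_assoc)
    finally have eq: "Z @ b @ u @ R = Z0 @ e @ (g @ u @ R)" .
    have "Hsteps {b} (Z @ b @ u @ R) (Z0 @ (g @ u @ R))"
      unfolding eq using Hsteps_single[OF g(3) e, of "{b}" Z0] by simp
    then show thesis using that[of "Z @ u"] 2 Z pw R_def by simp
  next
    case 3
    then show thesis using that[of "Z @ b @ u"] pw R_def by (simp add: Hsteps_refl)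
  qed
qed

lemma treated_run_Hsteps:
  "treated a (a @ Z) w c r Q \<Longrightarrow> run (c @ r) (a @ Z) Q X' \<Longrightarrow>
     \<exists>Z'. X' = a @ Z' \<and> Hsteps (fst ` set Q) (Z @ path_word (c @ r) Q) (Z' @ c @ r)"
proof (induction Q arbitrary: Z w)
  case (Cons q Q)
  obtain b u where q: "q = (b, u)" by force
  obtain X1 where X1: "step (a @ Z) b u (path_word (c @ r) Q) X1" "run (c @ r) X1 Q X'"
    using Cons.prems q by auto
  have i: "treated a (a @ Z) w c r ((b, u) # Q)" using Cons.prems q by simp
  obtain Z1 where Z1: "X1 = a @ Z1" "Hsteps {b} (Z @ path_word (c @ r) ((b, u) # Q)) (Z1 @ path_word (c @ r) Q)"
    using treated_step_Hsteps[OF i X1(1)] .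
  obtain Z' where Z': "X' = a @ Z'" "Hsteps (fst ` set Q) (Z1 @ path_word (c @ r) Q) (Z' @ c @ r)"
    using Cons.IH[of Z1 u] treated_step[OF i X1(1)] X1(2) Z1(1) by blast
  have "Hsteps (fst ` set (q # Q)) (Z @ path_word (c @ r) (q # Q)) (Z1 @ path_word (c @ r) Q)"
    using Hsteps_mono[OF Z1(2)] q by auto
  moreover have "Hsteps (fst ` set (q # Q)) (Z1 @ path_word (c @ r) Q) (Z' @ c @ r)"
    using Hsteps_mono[OF Z'(2)] by auto
  ultimately show ?case using Hsteps_trans Z'(1) by blast
qed (auto intro: Hsteps_refl)

text \<open>The same path treated in two contexts: after \<open>a\<close> itself, and after a word \<open>A\<close> that arose by
  treating \<open>a\<close>. If \<open>a\<close> has been reduced twice, a prefix \<open>k\<close> of the following bridge is missing.\<close>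

lemma simulate_step:
  assumes i1: "treated a (a @ k @ Z) w c r ((b, u) # Q)" and i2: "treated a' (A @ Z) w c r ((b, u) # Q)"
    and K: "k = [] \<or> (\<exists>h. a = k @ h \<and> Hred2 h k (k @ Z @ path_word (c @ r) ((b, u) # Q)))"
    and st: "step (a @ k @ Z) b u (path_word (c @ r) Q) X'"
  obtains Z' where "X' = a @ k @ Z'" "step (A @ Z) b u (path_word (c @ r) Q) (A @ Z')"
proof -
  define R where "R = path_word (c @ r) Q"
  have b: "Letters b \<in> B" and a: "Letters a \<in> B" and ab: "a \<noteq> b" and s: "S ((a @ k @ Z) @ b @ u @ R)"
    using i1 by (auto simp: treated_def R_def)
  have le: "suffix h (a @ k @ Z) \<longleftrightarrow> suffix h (A @ Z)" if "h @ b = d @ h" for h d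
    using i1 i2 that by (auto simp: treated_def)
  have tw: "(\<exists>X'. twice (a @ k @ Z) b u R X') \<longleftrightarrow> (\<exists>X'. twice (A @ Z) b u R X')"
  proof -
    have "(\<exists>X'. twice X b u R X') \<longleftrightarrow>
      (\<exists>h k' u'. suffix h X \<and> u = k' @ u' \<and> b = k' @ h \<and> Heq (h @ k' @ u' @ R) (u' @ R))" for X
      unfolding twice_def suffix_def by blast
    moreover have "suffix h (a @ k @ Z) \<longleftrightarrow> suffix h (A @ Z)" if "b = k' @ h" for h k'
      using le[of h "h @ k'"] that by simp
    ultimately show ?thesis by metis
  qed
  have hr: "Hred (a @ k @ Z) b (u @ R) \<longleftrightarrow> Hred (A @ Z) b (u @ R)"
    unfolding Hred_def using le by metis
  show thesis
    using st[folded R_def]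
  proof (cases rule: step_cases)
    case (1 X0 h k' u')
    have g: "h @ b = (h @ k') @ h" using 1 by simp
    obtain Z0 where Z0: "X0 = a @ Z0" using treated_first[OF i1 1(1) g] by blast
    have kZ: "k @ Z = Z0 @ h" using 1(1) Z0 by simp
    \<comment> \<open>The removed suffix must not reach into \<open>k\<close>, which is absent after
      \<open>A\<close>. If two periods of \<open>a\<close> can be removed,
      \<open>run_left_of_doubly_reduced_band\<close> keeps the run of \<open>b\<close> inside
      \<open>Z\<close>.\<close>
    have "length h \<le> length Z"
    proof (cases "k = []")
      case True
      then show ?thesis using arg_cong[OF kZ, of length] by simp
    next
      case False
      then obtain h0 where h0: "a = k @ h0" "Hred2 h0 k (k @ Z @ b @ u @ R)"
        using K by (auto simp: R_def)
      then have eq: "Heq ((h0 @ k) @ Z @ b @ u @ R) (Z @ b @ u @ R)"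
        by (auto simp: Hred2_def)
      have e: "brot a (h0 @ k)" using h0(1) B_bnd[OF a] rot_append_commute by (simp add: brot_def)
      have "S (k @ Z @ b @ u @ R)" using S_suffix[of a "k @ Z @ b @ u @ R"] s bnd_nonempty[OF B_bnd[OF b]] by simp
      moreover have "suffix h (k @ Z)" using kZ by (simp add: suffix_def)
      ultimately have "length h < length Z"
        using run_left_of_doubly_reduced_band[OF a b ab e eq _ _ g] by blast
      then show ?thesis by simp
    qed
    then obtain Z1 where Z1: "Z = Z1 @ h" "Z0 = k @ Z1"
      using append_eq_split_right[OF kZ] by metis
    have "twice (A @ Z) b u R (A @ Z1 @ u')"
      unfolding twice_def using 1 Z1 by (intro exI[of _ "A @ Z1"] exI[of _ h] exI[of _ k'] exI[of _ u']) simp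
    then show thesis using that[of "Z1 @ u'"] 1(5) Z0 Z1 twice_step R_def by simp
  next
    case 2
    then have "step (A @ Z) b u R (A @ Z @ u)" using tw hr by (simp add: step_def)
    then show thesis using that[of "Z @ u"] 2(3) R_def by simp
  next
    case 3
    then have "step (A @ Z) b u R (A @ Z @ b @ u)" using tw hr by (simp add: step_def)
    then show thesis using that[of "Z @ b @ u"] 3(3) R_def by simp
  qed
qed

lemma simulate_run:
  "treated a (a @ k @ Z) w c r Q \<Longrightarrow> treated a' (A @ Z) w c r Q \<Longrightarrow>
   k = [] \<or> (\<exists>h. a = k @ h \<and> Hred2 h k (k @ Z @ path_word (c @ r) Q)) \<Longrightarrow>
   run (c @ r) (a @ k @ Z) Q X' \<Longrightarrow>
   \<exists>Z'. X' = a @ k @ Z' \<and> run (c @ r) (A @ Z) Q (A @ Z')"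
proof (induction Q arbitrary: Z w)
  case (Cons q Q)
  obtain b u where q: "q = (b, u)" by force
  obtain X1 where X1: "step (a @ k @ Z) b u (path_word (c @ r) Q) X1" "run (c @ r) X1 Q X'"
    using Cons.prems q by auto
  have i1: "treated a (a @ k @ Z) w c r ((b, u) # Q)" and i2: "treated a' (A @ Z) w c r ((b, u) # Q)"
    and K: "k = [] \<or> (\<exists>h. a = k @ h \<and> Hred2 h k (k @ Z @ path_word (c @ r) ((b, u) # Q)))"
    using Cons.prems q by simp_all
  obtain Z1 where Z1: "X1 = a @ k @ Z1" "step (A @ Z) b u (path_word (c @ r) Q) (A @ Z1)"
    using simulate_step[OF i1 i2 K X1(1)] .
  obtain Z1' where Z1': "X1 = a @ Z1'"
      "Hsteps {b} ((k @ Z) @ path_word (c @ r) ((b, u) # Q)) (Z1' @ path_word (c @ r) Q)"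
    using treated_step_Hsteps[OF _ X1(1)] i1 by auto
  have Z1'eq: "Z1' = k @ Z1" using Z1(1) Z1'(1) by simp
  have a: "Letters a \<in> B" "a \<noteq> b" "Letters b \<in> B" using i1 by (auto simp: treated_def)
  have s: "S (a @ (k @ Z) @ path_word (c @ r) ((b, u) # Q))" using i1 by (simp add: treated_def)
  have K1: "k = [] \<or> (\<exists>h. a = k @ h \<and> Hred2 h k (k @ Z1 @ path_word (c @ r) Q))"
  proof (cases "k = []")
    case False
    then obtain h where h: "a = k @ h" "Hred2 h k (k @ Z @ path_word (c @ r) ((b, u) # Q))" using K by blast
    have "Hred2 h k ((k @ Z) @ path_word (c @ r) ((b, u) # Q)) \<longleftrightarrow> Hred2 h k (Z1' @ path_word (c @ r) Q)"
      by (rule Hred2_Hsteps[OF Z1'(2)]) (use s a h(1) in auto)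
    then show ?thesis using h Z1'eq by auto
  qed simp
  have "treated a (a @ k @ Z1) u c r Q" using treated_step[OF i1 X1(1)] Z1(1) by simp
  moreover have "treated a' (A @ Z1) u c r Q" using treated_step[OF i2 Z1(2)] .
  ultimately obtain Z' where "X' = a @ k @ Z'" "run (c @ r) (A @ Z1) Q (A @ Z')"
    using Cons.IH[OF _ _ K1] X1(2) Z1(1) by blast
  then show ?case using Z1(2) q by auto
qed auto

section \<open>Substitution of a path for a bridge\<close>

text \<open>This separates \<open>twice\<close> into a condition on the left and one on the right
  that is invariant under \<open>Hsteps\<close>. By the second part the prefix \<open>k\<close> of
  the right side lies in the bridge automatically, whichever bridge it is.\<close>

lemma twice_iff_Hred2:
  assumes b: "Letters b \<in> B" and n: "Letters n \<in> B" "b \<noteq> n" and s: "S (X @ b @ u @ n @ m)"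
  shows "twice X b u (n @ m) X' \<longleftrightarrow>
    (\<exists>X0 h k u'. X = X0 @ h \<and> b = k @ h \<and> u = k @ u' \<and> Hred2 h k (u @ n @ m) \<and> X' = X0 @ u')"
    and "X = X0 @ h \<Longrightarrow> b = k @ h \<Longrightarrow> Hred2 h k (u @ n @ m) \<Longrightarrow> \<exists>u'. u = k @ u'"
proof -
  show "twice X b u (n @ m) X' \<longleftrightarrow>
    (\<exists>X0 h k u'. X = X0 @ h \<and> b = k @ h \<and> u = k @ u' \<and> Hred2 h k (u @ n @ m) \<and> X' = X0 @ u')"
  proof
    assume "twice X b u (n @ m) X'"
    then obtain X0 h k u' where w: "X = X0 @ h" "u = k @ u'" "b = k @ h"
        "Heq (h @ k @ u' @ n @ m) (u' @ n @ m)" "X' = X0 @ u'"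
      unfolding twice_def by blast
    then have "Hred2 h k (u @ n @ m)" unfolding Hred2_def by (intro exI[of _ "u' @ n @ m"]) simp
    with w show "\<exists>X0 h k u'. X = X0 @ h \<and> b = k @ h \<and> u = k @ u' \<and> Hred2 h k (u @ n @ m) \<and> X' = X0 @ u'"
      by blast
  next
    assume "\<exists>X0 h k u'. X = X0 @ h \<and> b = k @ h \<and> u = k @ u' \<and> Hred2 h k (u @ n @ m) \<and> X' = X0 @ u'"
    then obtain X0 h k u' where w: "X = X0 @ h" "b = k @ h" "u = k @ u'" "Hred2 h k (u @ n @ m)" "X' = X0 @ u'"
      by blast
    then have "Heq (h @ k @ u' @ n @ m) (u' @ n @ m)" by (auto simp: Hred2_def)
    with w show "twice X b u (n @ m) X'" unfolding twice_def by blast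
  qed
  assume a: "X = X0 @ h" "b = k @ h" "Hred2 h k (u @ n @ m)"
  then obtain l where "u @ n @ m = k @ l" by (auto simp: Hred2_def)
  moreover have "S (X0 @ h @ k @ h @ u @ n @ m)" using s a by simp
  ultimately have "prefix k u"
    using double_window_prefix[of k h n X0 u m l] b n a(2) by simp
  then show "\<exists>u'. u = k @ u'" by (auto simp: prefix_def)
qed

text \<open>The word behind \<open>b\<close> before the substitution arises from the one after it by
  \<open>Hsteps\<close>, so the decision at \<open>b\<close> is the same for both. The run over
  \<open>V\<close> is given by \<open>iso\<close> only behind an intact \<open>b\<close>;
  \<open>simulate_run\<close> transfers it to what the treatment of \<open>b\<close> leaves.\<close>

lemma run_substitute_middle:
  assumes i: "treated a X w c [] ((b, u) # Qb)" and i': "treated a X w c [] (((b, v) # V) @ Qb)"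
    and V: "chain (head_band c Qb) ((b, v) # V)"
    and iso: "run (head_band c Qb) (b @ v) V (b @ u)"
    and r: "run c X ((b, u) # Qb) X'"
  shows "run c X (((b, v) # V) @ Qb) X'"
proof -
  define n where "n = head_band c Qb"
  define t where "t = path_word c Qb"
  obtain m where m: "t = n @ m" using path_word_head[of c "[]" Qb] by (auto simp: n_def t_def)
  have b: "Letters b \<in> B" and ch: "chain c ((b, u) # Qb)" and s: "S (X @ b @ u @ t)"
    using i by (auto simp: treated_def t_def)
  have n: "Letters n \<in> B" using chain_head[of c Qb] ch by (simp add: n_def)
  have bn: "b \<noteq> n" using chain_head_neq[OF ch] by (simp add: n_def)
  have St: "S (n @ m)" using S_suffix[of "X @ b @ u" t] s bnd_nonempty[OF B_bnd[OF n]] m by simp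
  have chV: "chain n ((b, v) # V)" using V by (simp add: n_def)
  define R where "R = path_word t V"
  obtain m' where m': "R = head_band n V @ m'"
    using path_word_head[of n m V] m by (auto simp: R_def)
  have s': "S (X @ b @ v @ R)"
    using i' by (simp add: treated_def t_def R_def path_word_append)
  have n': "Letters (head_band n V) \<in> B" "b \<noteq> head_band n V"
    using chain_head[of n V] chV chain_head_neq[OF chV] by auto
  have iv: "treated b (b @ v) v n m V" by (rule treated_start[OF chV St])
  have nz: "bnd n" using B_bnd[OF n] .
  have runiso: "run (n @ m) (b @ v) V (b @ u)"
  proof -
    have "chain n V" using chV by simp
    then have "S (path_word (n @ []) V)" "S (path_word (n @ m) V)"
      using chain_S[of n V "[]"] chain_S[of n V m] St brot_S[OF brot_refl[OF nz]] by simp_all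
    from run_tails[OF n this] show ?thesis using iso by (simp add: n_def)
  qed
  obtain Z' where Z': "b @ u = b @ Z'" "Hsteps (fst ` set V) (v @ path_word (n @ m) V) (Z' @ n @ m)"
    using treated_run_Hsteps[OF iv runiso] by blast
  then have hs: "Hsteps (fst ` set V) (v @ R) (u @ t)" by (simp add: R_def m)
  have svR: "S (b @ v @ R)" using S_suffix[of X "b @ v @ R"] s' bnd_nonempty[OF B_bnd[OF b]] by simp
  have e2: "Hred2 h k (v @ R) \<longleftrightarrow> Hred2 h k (u @ t)" if bk: "b = k @ h" for h k
  proof (rule Hred2_Hsteps[OF hs])
    show "S ((k @ h) @ v @ R)" "Letters (k @ h) \<in> B" using svR b bk by simp_all
    show "Letters x \<in> B \<and> x \<noteq> k @ h" if "x \<in> fst ` set V" for x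
    proof
      show "Letters x \<in> B" using chain_mem[of n V x] chV that by simp
      show "x \<noteq> k @ h" using chain_acyclic(2)[OF chV] that bk by blast
    qed
  qed
  have RneU: "v @ R \<noteq> []" using m' bnd_nonempty[OF B_bnd[OF n'(1)]] by simp
  have "S (v @ R)" using S_suffix[of "X @ b" "v @ R"] s' RneU by simp
  then have heq: "Heq (v @ R) (u @ t)" by (rule Hsteps_Heq[OF hs])
  have hr: "Hred X b (v @ R) \<longleftrightarrow> Hred X b (u @ t)" by (rule Hred_Heq[OF heq])
  have tw: "(\<exists>X0 h k v'. X = X0 @ h \<and> b = k @ h \<and> v = k @ v' \<and> Hred2 h k (v @ R)) \<longleftrightarrow>
        (\<exists>X0 h k u'. X = X0 @ h \<and> b = k @ h \<and> u = k @ u' \<and> Hred2 h k (u @ t))"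
  proof
    assume "\<exists>X0 h k v'. X = X0 @ h \<and> b = k @ h \<and> v = k @ v' \<and> Hred2 h k (v @ R)"
    then obtain X0 h k where w: "X = X0 @ h" "b = k @ h" "Hred2 h k (v @ R)" by blast
    then have ek: "Hred2 h k (u @ t)" using e2 by blast
    then have "\<exists>u'. u = k @ u'"
      using twice_iff_Hred2(2)[OF b n bn, of X u m X0 h k] s m w by simp
    then show "\<exists>X0 h k u'. X = X0 @ h \<and> b = k @ h \<and> u = k @ u' \<and> Hred2 h k (u @ t)"
      using w ek by blast
  next
    assume "\<exists>X0 h k u'. X = X0 @ h \<and> b = k @ h \<and> u = k @ u' \<and> Hred2 h k (u @ t)"
    then obtain X0 h k where w: "X = X0 @ h" "b = k @ h" "Hred2 h k (u @ t)" by blast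
    then have ek: "Hred2 h k (v @ R)" using e2 by blast
    then have "\<exists>v'. v = k @ v'"
      using twice_iff_Hred2(2)[OF b n', of X v m' X0 h k] s' m' w by simp
    then show "\<exists>X0 h k v'. X = X0 @ h \<and> b = k @ h \<and> v = k @ v' \<and> Hred2 h k (v @ R)"
      using w ek by blast
  qed
  have twu: "twice X b u t Y \<longleftrightarrow>
      (\<exists>X0 h k u'. X = X0 @ h \<and> b = k @ h \<and> u = k @ u' \<and> Hred2 h k (u @ t) \<and> Y = X0 @ u')" for Y
    using twice_iff_Hred2(1)[OF b n bn, of X u m Y] s m by simp
  have twv: "twice X b v R Y \<longleftrightarrow>
      (\<exists>X0 h k v'. X = X0 @ h \<and> b = k @ h \<and> v = k @ v' \<and> Hred2 h k (v @ R) \<and> Y = X0 @ v')" for Y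
    using twice_iff_Hred2(1)[OF b n', of X v m' Y] s' m' by simp
  have extw: "(\<exists>Y. twice X b v R Y) \<longleftrightarrow> (\<exists>Y. twice X b u t Y)"
    unfolding twu twv using tw by blast
  obtain X2 where X2: "step X b u t X2" "run c X2 Qb X'" using r by (auto simp: t_def)
  have i'': "treated a X w c [] ((b, v) # V @ Qb)" using i' by simp
  have pwR: "path_word (c @ []) (V @ Qb) = R" by (simp add: path_word_append R_def t_def)
  \<comment> \<open>\<open>A\<close> is what remains of \<open>X @ b\<close>, and \<open>k\<close>
    is the prefix of the bridge lost in a double removal, \<open>[]\<close> otherwise. The same
    \<open>A\<close> and \<open>k\<close> serve for \<open>u\<close> and for
    \<open>v\<close>.\<close>
  have "\<exists>A k Z. step X b v R (A @ Z) \<and> v = k @ Z \<and> (k = [] \<or> (\<exists>h. b = k @ h \<and> Hred2 h k (v @ R)))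
      \<and> (\<forall>Zf. u = k @ Zf \<longrightarrow> X2 = A @ Zf)"
  proof (cases "\<exists>Y. twice X b u t Y")
    case True
    then have "twice X b u t X2" using X2(1) by (simp add: step_def)
    then obtain X0 h k u' where w: "X = X0 @ h" "b = k @ h" "u = k @ u'" "Hred2 h k (u @ t)" "X2 = X0 @ u'"
      unfolding twu by blast
    have ev: "Hred2 h k (v @ R)" using w(2,4) e2 by blast
    obtain v' where v': "v = k @ v'"
      using twice_iff_Hred2(2)[OF b n', of X v m' X0 h k] s' m' w ev by auto
    have "twice X b v R (X0 @ v')" unfolding twv using w v' ev by blast
    then have "step X b v R (X0 @ v')" by (rule twice_step)
    then show ?thesis using v' w ev by (intro exI[of _ X0] exI[of _ k] exI[of _ v']) auto
  next
    case False
    then have st: "step X b v R (if Hred X b (v @ R) then X @ v else X @ b @ v)"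
      using extw by (simp add: step_def)
    have x2: "X2 = (if Hred X b (u @ t) then X @ u else X @ b @ u)"
      using X2(1) False by (auto simp: step_def)
    show ?thesis
    proof (cases "Hred X b (u @ t)")
      case True
      then show ?thesis using st x2 hr by (intro exI[of _ X] exI[of _ "[]"] exI[of _ v]) auto
    next
      case False
      then show ?thesis using st x2 hr by (intro exI[of _ "X @ b"] exI[of _ "[]"] exI[of _ v]) auto
    qed
  qed
  then obtain A k Z where AZ: "step X b v R (A @ Z)" "v = k @ Z"
      "k = [] \<or> (\<exists>h. b = k @ h \<and> Hred2 h k (v @ R))" "\<forall>Zf. u = k @ Zf \<longrightarrow> X2 = A @ Zf"
    by blast
  have "treated a (A @ Z) v c [] (V @ Qb)"
    using treated_step[OF i''] AZ(1) pwR by simp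
  then have inv0: "treated a (A @ Z) v c [] (V @ Qb)" .
  have "a \<noteq> n" using i by (cases Qb) (auto simp: treated_def n_def)
  moreover have "head_band c (V @ Qb) = head_band n V" "path_word (c @ []) (V @ Qb) = path_word (n @ m) V"
    by (simp_all add: head_band_append n_def path_word_append t_def[symmetric] m)
  ultimately have i2: "treated a (A @ Z) v n m V"
    using inv0 chV unfolding treated_def by (simp add: image_Un)
  have "\<exists>Z'. b @ u = b @ k @ Z' \<and> run (n @ m) (A @ Z) V (A @ Z')"
  proof (rule simulate_run[OF _ i2])
    show "treated b (b @ k @ Z) v n m V" using iv AZ(2) by simp
    show "run (n @ m) (b @ k @ Z) V (b @ u)" using runiso AZ(2) by simp
    show "k = [] \<or> (\<exists>h. b = k @ h \<and> Hred2 h k (k @ Z @ path_word (n @ m) V))"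
      using AZ(2,3) by (auto simp: R_def m)
  qed
  then obtain Zf where Zf: "u = k @ Zf" "run t (A @ Z) V (A @ Zf)" by (auto simp: m)
  then have "run t (A @ Z) V X2" using AZ(4) by blast
  then have "run c (A @ Z) (V @ Qb) X'" using X2(2) by (auto simp: run_append t_def)
  then show ?thesis using AZ(1) by (auto simp: path_word_append R_def t_def)
qed

text \<open>Left of \<open>b\<close> the run is unaffected, since the word to its right still begins
  with \<open>b\<close> (\<open>run_tails\<close>). If \<open>b\<close> is the leftmost band, it is
  not treated at all, and \<open>iso\<close> is already the run over \<open>V\<close>.\<close>

lemma run_substitute:
  assumes ch: "chain c (Qa @ (b, u) # Qb)" and V: "chain (head_band c Qb) ((b, v) # V)"
    and iso: "run (head_band c Qb) (b @ v) V (b @ u)"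
    and hd1: "Qa @ (b, u) # Qb = (b1, u1) # Q1" and r: "run c (b1 @ u1) Q1 X'"
    and hd2: "Qa @ ((b, v) # V) @ Qb = (b2, u2) # Q2"
  shows "run c (b2 @ u2) Q2 X'"
proof -
  define n where "n = head_band c Qb"
  define t where "t = path_word c Qb"
  obtain m where m: "t = n @ m" using path_word_head[of c "[]" Qb] by (auto simp: n_def t_def)
  have chb: "chain c ((b, u) # Qb)" using ch by (simp add: chain_append)
  then have chQb: "chain c Qb" by simp
  have n: "Letters n \<in> B" using chain_head[OF chQb] by (simp add: n_def)
  have St: "S (n @ m)" using chain_S0[OF chQb] m by (simp add: t_def)
  have chV: "chain n ((b, v) # V)" using V by (simp add: n_def)
  have ch2: "chain c (Qa @ ((b, v) # V) @ Qb)"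
    using ch V by (auto simp: chain_append head_band_append)
  have c0: "Letters c \<in> B" "S (c @ [])" using chain_last[OF ch] brot_S brot_refl B_bnd by auto
  show ?thesis
  proof (cases Qa)
    case Nil
    have "chain n V" using chV by simp
    then have "S (path_word (n @ []) V)" "S (path_word (n @ m) V)"
      using chain_S[of n V "[]"] chain_S[of n V m] St brot_S[OF brot_refl[OF B_bnd[OF n]]] by simp_all
    from run_tails[OF n this] have "run t (b @ v) V (b @ u)" using iso m by (simp add: n_def)
    then show ?thesis using r hd1 hd2 Nil by (auto simp: run_append t_def)
  next
    case (Cons q Qa')
    then have q: "q = (b1, u1)" "Q1 = Qa' @ (b, u) # Qb" "b2 = b1" "u2 = u1" "Q2 = Qa' @ ((b, v) # V) @ Qb"
      using hd1 hd2 by auto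
    have chA: "chain c ((b1, u1) # Qa' @ (b, u) # Qb)" "chain c ((b1, u1) # Qa' @ ((b, v) # V) @ Qb)"
      using ch ch2 Cons q by simp_all
    have i: "treated b1 (b1 @ u1) u1 c [] (Qa' @ (b, u) # Qb)" "treated b1 (b1 @ u1) u1 c [] (Qa' @ ((b, v) # V) @ Qb)"
      using treated_start[OF _ c0(2)] chA by blast+
    obtain X1 where X1: "run (path_word c ((b, u) # Qb)) (b1 @ u1) Qa' X1" "run c X1 ((b, u) # Qb) X'"
      using r q by (auto simp: run_append)
    define r1 where "r1 = u @ path_word c Qb"
    define r2 where "r2 = v @ path_word t V"
    have pw: "path_word c ((b, u) # Qb) = b @ r1" "path_word c (((b, v) # V) @ Qb) = b @ r2"
      by (simp_all add: r1_def r2_def path_word_append t_def)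
    have sA: "S (path_word (b @ r1) Qa')" "S (path_word (b @ r2) Qa')"
    proof -
      have "chain c (Qa' @ (b, u) # Qb)" "chain c (Qa' @ ((b, v) # V) @ Qb)" using chA by simp_all
      from this[THEN chain_S0] show "S (path_word (b @ r1) Qa')" "S (path_word (b @ r2) Qa')"
        using pw by (simp_all add: path_word_append)
    qed
    have b: "Letters b \<in> B" using chb by simp
    have X1': "run (path_word c (((b, v) # V) @ Qb)) (b1 @ u1) Qa' X1"
      using X1(1) run_tails[OF b sA] unfolding pw by blast
    define w where "w = last (u1 # map snd Qa')"
    have iu: "treated b1 X1 w c [] ((b, u) # Qb)"
      using treated_run[OF i(1), of X1] X1(1) by (simp add: w_def)
    have iv: "treated b1 X1 w c [] (((b, v) # V) @ Qb)"
      using treated_run[OF i(2), of X1] X1' by (simp add: w_def)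
    have "run c X1 (((b, v) # V) @ Qb) X'"
      by (rule run_substitute_middle[OF iu iv V iso X1(2)])
    then show ?thesis unfolding q run_append[of c _ Qa'] using X1' by blast
  qed
qed

end

section \<open>The skeleton\<close>

text \<open>Since all windows of a band lead to the same reduced word, removing one period of it can
  be encoded as leaving out its marked occurrence.\<close>

fun masked :: "'c list set \<Rightarrow> 'c list \<Rightarrow> ('c list \<times> 'c list) list \<Rightarrow> 'c list" where
  "masked M t [] = t"
| "masked M t ((b, u) # Q) = (if b \<in> M then [] else b) @ u @ masked M t Q"

text \<open>\<open>doubled w b u\<close> says that \<open>w @ b @ u\<close> contains two consecutive periods of the band \<open>b\<close>.\<close>

definition doubled :: "'c list \<Rightarrow> 'c list \<Rightarrow> 'c list \<Rightarrow> bool" where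
  "doubled w b u \<longleftrightarrow> (\<exists>h k. suffix h w \<and> prefix k u \<and> b = k @ h)"

fun doubles :: "'c list \<Rightarrow> ('c list \<times> 'c list) list \<Rightarrow> 'c list set" where
  "doubles w [] = {}"
| "doubles w ((b, u) # Q) = (if doubled w b u then {b} else {}) \<union> doubles u Q"

lemma doubles_subset: "doubles w Q \<subseteq> fst ` set Q"
  by (induction w Q rule: doubles.induct) auto

lemma masked_empty: "masked {} t Q = path_word t Q"
  by (induction Q) auto

lemma masked_tail: "\<exists>p. masked M t Q = p @ t"
proof (induction Q)
  case (Cons a Q)
  then obtain p where "masked M t Q = p @ t" by blast
  moreover obtain b u where "a = (b, u)" by force
  ultimately show ?case by (auto intro!: exI[of _ "(if b \<in> M then [] else b) @ u @ p"])
qed simp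

lemma masked_cong: "M \<inter> fst ` set Q = M' \<inter> fst ` set Q \<Longrightarrow> masked M t Q = masked M' t Q"
proof (induction Q)
  case (Cons a Q)
  obtain b u where a: "a = (b, u)" by force
  have mem: "x \<in> M \<longleftrightarrow> x \<in> M'" if "x \<in> fst ` set (a # Q)" for x using Cons.prems that by blast
  have "b \<in> M \<longleftrightarrow> b \<in> M'" by (rule mem) (simp add: a)
  moreover have "M \<inter> fst ` set Q = M' \<inter> fst ` set Q" proof -
    have "x \<in> M \<longleftrightarrow> x \<in> M'" if "x \<in> fst ` set Q" for x by (rule mem) (use that in simp)
    then show ?thesis by blast
  qed
  ultimately show ?case using Cons.IH a by simp
qed simp

lemma masked_insert:
  "d \<in> fst ` set Q \<Longrightarrow> distinct (map fst Q) \<Longrightarrow> d \<notin> M \<Longrightarrow>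
     \<exists>y m. masked M t Q = y @ d @ m @ t \<and> masked (insert d M) t Q = y @ m @ t"
proof (induction Q)
  case (Cons a Q)
  obtain b u where a: "a = (b, u)" by force
  show ?case
  proof (cases "b = d")
    case True
    obtain p where p: "masked M t Q = p @ t" using masked_tail by blast
    have "insert d M \<inter> fst ` set Q = M \<inter> fst ` set Q" using Cons.prems a True by auto
    then have "masked (insert d M) t Q = masked M t Q" by (rule masked_cong)
    then show ?thesis using a True Cons.prems p
      by (intro exI[of _ "[]"] exI[of _ "u @ p"]) simp
  next
    case False
    then obtain y m where "masked M t Q = y @ d @ m @ t" "masked (insert d M) t Q = y @ m @ t"
      using Cons a by auto
    then show ?thesis using a False
      by (intro exI[of _ "(if b \<in> M then [] else b) @ u @ y"] exI[of _ m]) simp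
  qed
qed simp

lemma doubles_mem:
  "(b1, u1) # Q = Q0 @ (b', w) # (d, u) # Q2 \<Longrightarrow> doubled w d u \<Longrightarrow> d \<in> doubles u1 Q"
proof (induction Q0 arbitrary: b1 u1 Q)
  case (Cons a Q0)
  then obtain b2 u2 Q' where Q: "Q = (b2, u2) # Q'" "(b2, u2) # Q' = Q0 @ (b', w) # (d, u) # Q2"
    by (cases Q0) auto
  from Cons.IH[OF Q(2) Cons.prems(2)] show ?case unfolding Q(1) by simp
qed auto

lemma doublesD:
  "d \<in> doubles u1 Q \<Longrightarrow> \<exists>Q0 b' w u Q2. (b1, u1) # Q = Q0 @ (b', w) # (d, u) # Q2 \<and> doubled w d u"
proof (induction u1 Q arbitrary: b1 rule: doubles.induct)
  case (2 w b u Q)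
  show ?case
  proof (cases "doubled w b u \<and> d = b")
    case True
    then show ?thesis
      by (intro exI[of _ "[]"] exI[of _ b1] exI[of _ w] exI[of _ u] exI[of _ Q]) simp
  next
    case False
    then have "d \<in> doubles u Q" using 2 by (auto split: if_splits)
    then obtain Q0 b' w' u' Q2 where "(b, u) # Q = Q0 @ (b', w') # (d, u') # Q2" "doubled w' d u'"
      using 2 by blast
    then show ?thesis by (intro exI[of _ "(b1, w) # Q0"]) auto
  qed
qed simp

lemma inter_eq_drop: "M \<inter> insert b F = D1 \<union> D \<Longrightarrow> D1 \<subseteq> {b} \<Longrightarrow> D \<subseteq> F \<Longrightarrow> b \<notin> F \<Longrightarrow> M \<inter> F = D"
  by blast

lemma inter_subset_drop: "M \<inter> insert b F \<subseteq> D1 \<union> D \<Longrightarrow> D1 \<subseteq> {b} \<Longrightarrow> b \<notin> F \<Longrightarrow> M \<inter> F \<subseteq> D"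
  by blast

lemma path_word_split: "path_word t Q = path_word [] Q @ t"
  by (induction Q) auto

lemma count_list_distinct: "(\<And>b. b \<in> set bs \<Longrightarrow> count_list bs b = 1) \<Longrightarrow> distinct bs"
proof (induction bs)
  case (Cons a bs)
  have "count_list (a # bs) a = 1" using Cons.prems[of a] by simp
  then have "a \<notin> set bs" by (simp add: count_list_0_iff)
  moreover have "count_list bs b = 1" if "b \<in> set bs" for b
    using Cons.prems[of b] that calculation by (auto split: if_splits)
  ultimately show ?case using Cons.IH by simp
qed simp

lemma distinct_count_list: "distinct bs \<Longrightarrow> b \<in> set bs \<Longrightarrow> count_list bs b = 1"
  by (induction bs) (auto simp: count_list_0_iff)

context dom_string_algebra begin

text \<open>Each omitted band is doubled, so an adjacent period remains and
  \<open>Heq_window\<close> justifies the omission. The bands are omitted from the right.\<close>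

lemma masked_Hsteps:
  assumes "chain c Q" "S (w @ path_word c Q)" "M \<inter> fst ` set Q \<subseteq> doubles w Q"
  shows "Hsteps (fst ` set Q \<inter> M) (w @ path_word c Q) (w @ masked M c Q)"
  using assms
proof (induction Q arbitrary: w)
  case (Cons q Q)
  obtain b u where q: "q = (b, u)" by force
  define R where "R = masked M c Q"
  have ch: "chain c ((b, u) # Q)" "chain c Q" and b: "Letters b \<in> B"
    using Cons.prems q by simp_all
  have nb: "b \<notin> fst ` set Q" using chain_acyclic[OF ch(1)] by simp
  have ne: "path_word c Q \<noteq> []" using path_word_split[of c Q] bnd_nonempty[OF B_bnd[OF chain_last[OF ch(2)]]] by simp
  have s: "S ((w @ b) @ u @ path_word c Q)" using Cons.prems q by simp
  have sub: "M \<inter> fst ` set Q \<subseteq> doubles u Q"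
  proof -
    have "M \<inter> insert b (fst ` set Q) \<subseteq> (if doubled w b u then {b} else {}) \<union> doubles u Q"
      using Cons.prems(3) q by simp
    from inter_subset_drop[OF this _ nb] show ?thesis by simp
  qed
  have "S (u @ path_word c Q)" using S_suffix[OF s] ne by simp
  from Hsteps_cong[OF Cons.IH[OF ch(2) this sub], of "w @ b"]
  have h1: "Hsteps (fst ` set Q \<inter> M) (w @ path_word c (q # Q)) (w @ b @ u @ R)"
    using q by (simp add: R_def)
  have h2: "Hsteps (fst ` set (q # Q) \<inter> M) (w @ path_word c (q # Q)) (w @ b @ u @ R)"
    by (rule Hsteps_mono[OF h1]) auto
  show ?case
  proof (cases "b \<in> M")
    case True
    moreover have "b \<in> fst ` set (q # Q)" using q by simp
    ultimately have "b \<in> doubles w ((b, u) # Q)" using Cons.prems(3) q by blast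
    then have "doubled w b u" using nb doubles_subset[of u Q] by (auto split: if_splits)
    then obtain h k w0 u' where d: "w = w0 @ h" "u = k @ u'" "b = k @ h"
      by (auto simp: doubled_def suffix_def prefix_def)
    have r: "brot b (h @ k)" using B_bnd[OF b] rot_append_commute d(3) by (simp add: brot_def)
    have "S (w @ b @ u @ R)" using Heq_S(2)[OF Hsteps_Heq[OF h1]] Cons.prems(2) by blast
    then have "S ((w0 @ h @ k) @ ((h @ k) @ u' @ R))" using d by simp
    then have "S ((h @ k) @ u' @ R)" by (rule S_suffix) (use brot_nonempty[OF r] in auto)
    from Hsteps_single[OF Heq_window[OF r this] r, of "fst ` set (q # Q) \<inter> M" w0]
    have "Hsteps (fst ` set (q # Q) \<inter> M) (w @ b @ u @ R) (w @ masked M c (q # Q))"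
      using True q d by (simp add: R_def)
    then show ?thesis using h2 Hsteps_trans by blast
  next
    case False
    then show ?thesis using h2 q by (simp add: R_def)
  qed
qed (simp add: Hsteps_refl)

section \<open>Positions of windows in the word of a path\<close>

lemma chain_distinct_last: "chain c Q \<Longrightarrow> distinct (map fst Q @ [c])"
proof (induction Q)
  case (Cons a Q)
  obtain b u where a: "a = (b, u)" by force
  show ?case using Cons chain_acyclic[of c b u Q] a by auto
qed simp

lemma head_band_nth: "head_band c Q2 = (map fst (Q1 @ Q2) @ [c]) ! length Q1"
  by (cases Q2) (auto simp: nth_append)

lemma chain_split_unique:
  assumes "chain c Q" "Q = Q1 @ Q2" "Q = Q1' @ Q2'" "head_band c Q2 = head_band c Q2'"
  shows "Q1 = Q1'"
proof -
  have "(map fst Q @ [c]) ! length Q1 = (map fst Q @ [c]) ! length Q1'"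
    using assms head_band_nth[of c Q2 Q1] head_band_nth[of c Q2' Q1'] by simp
  moreover have "length Q1 \<le> length Q" using assms(2) by simp
  moreover have "length Q1' \<le> length Q" using assms(3) by simp
  ultimately have "length Q1 = length Q1'"
    using nth_eq_iff_index_eq[OF chain_distinct_last[OF assms(1)], of "length Q1" "length Q1'"] by simp
  then show ?thesis using assms(2,3) by (metis append_eq_append_conv)
qed

text \<open>A window overlaps no other band and does not fit into a band-free bridge, so it must
  meet the marked occurrence of its own band. That occurrence starts after
  \<open>path_word [] Q1\<close>, and the two inequalities express the overlap.\<close>

lemma window_position:
  assumes "chain c Q" "path_word c Q = y @ e @ m" "Letters d \<in> B" "rot d e"
  shows "\<exists>Q1 Q2. Q = Q1 @ Q2 \<and> head_band c Q2 = d \<and>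
     length (path_word [] Q1) < length y + length e \<and> length y < length (path_word [] Q1) + length d"
  using assms(1,2)
proof (induction Q arbitrary: y)
  case Nil
  have e: "brot d e" using assms(3,4) B_bnd by (simp add: brot_def)
  have c: "Letters c \<in> B" using Nil by simp
  have eq: "[] @ c @ [] = y @ e @ m" using Nil by simp
  have Sc: "S ([] @ c @ [])" using brot_S[OF brot_refl[OF B_bnd[OF c]]] by simp
  have "c = d"
  proof (rule ccontr)
    assume "c \<noteq> d"
    then have "\<not> rot c d" using B_unique[OF c assms(3)] by blast
    from window_disjoint[OF Sc eq B_bnd[OF c] e this] show False
      using brot_nonempty[OF e] by (metis append_is_Nil_conv)
  qed
  moreover have "length c = length y + length e + length m" using arg_cong[OF eq, of length] by simp
  moreover have "length e > 0" using brot_nonempty[OF e] by simp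
  ultimately show ?case by (intro exI[of _ "[]"]) simp
next
  case (Cons q Q)
  obtain b u where q: "q = (b, u)" by force
  have e: "brot d e" using assms(3,4) B_bnd by (simp add: brot_def)
  have ch: "chain c ((b, u) # Q)" "chain c Q" and b: "Letters b \<in> B" and bu: "bfree u"
    using Cons.prems q by simp_all
  define R where "R = path_word c Q"
  obtain m' where m': "R = head_band c Q @ m'" using path_word_head[of c "[]" Q] by (auto simp: R_def)
  define n where "n = head_band c Q"
  have n: "Letters n \<in> B" using chain_head[OF ch(2)] by (simp add: n_def)
  have eq: "[] @ b @ (u @ R) = y @ e @ m" using Cons.prems q by (simp add: R_def)
  have s: "S ([] @ b @ (u @ R))" using chain_S0[OF ch(1)] by (simp add: R_def)
  have el: "length e = length d" "length e > 0" using brot_length[OF e] brot_nonempty[OF e] by auto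
  show ?case
  proof (cases "length y < length b")
    case True
    have "b = d"
    proof (rule ccontr)
      assume "b \<noteq> d"
      then have "\<not> rot b d" using B_unique[OF b assms(3)] by blast
      from window_disjoint[OF s eq B_bnd[OF b] e this] show False
      proof cases
        fix r assume "[] = y @ e @ r" then show False using el by simp
      next
        fix r assume "y = [] @ b @ r" then show False using True by simp
      qed
    qed
    then show ?thesis using True q el by (intro exI[of _ "[]"] exI[of _ "q # Q"]) simp
  next
    case False
    have eq': "b @ (u @ R) = y @ (e @ m)" using eq by simp
    obtain r where r: "y = b @ r" "u @ R = r @ e @ m"
      using append_eq_split[OF eq'] False by auto
    show ?thesis
    proof (cases "length u \<le> length r")
      case True
      then obtain r' where r': "r = u @ r'" "R = r' @ e @ m"
        using append_eq_split[OF r(2)] by auto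
      obtain Q1 Q2 where IH: "Q = Q1 @ Q2" "head_band c Q2 = d"
          "length (path_word [] Q1) < length r' + length e" "length r' < length (path_word [] Q1) + length d"
        using Cons.IH[OF ch(2), of r'] r'(2) by (auto simp: R_def)
      show ?thesis
        using IH r(1) r'(1) q by (intro exI[of _ "q # Q1"] exI[of _ Q2]) simp
    next
      case F1: False
      have su: "S (u @ n @ m')" using S_suffix[OF s[simplified]] m' bnd_nonempty[OF B_bnd[OF n]] by (simp add: n_def)
      have equ: "u @ n @ m' = r @ e @ m" using r(2) m' by (simp add: n_def)
      have nu: "u \<noteq> r @ e @ s" for s using bu e unfolding bfree_def by blast
      have "n = d"
      proof (rule ccontr)
        assume "n \<noteq> d"
        then have "\<not> rot n d" using B_unique[OF n assms(3)] by blast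
        from window_disjoint[OF su equ B_bnd[OF n] e this] show False
        proof cases
          fix s assume "u = r @ e @ s" then show False using nu by blast
        next
          fix s assume "r = u @ n @ s" then show False using F1 by simp
        qed
      qed
      moreover have "length u < length r + length e"
      proof (rule ccontr)
        assume "\<not> ?thesis"
        then have "length (r @ e) \<le> length u" by simp
        moreover have "(r @ e) @ m = u @ R" using r(2) by simp
        ultimately obtain s where "u = (r @ e) @ s" using append_eq_split by blast
        then show False using nu by simp
      qed
      ultimately show ?thesis
        using F1 r(1) q by (intro exI[of _ "[q]"] exI[of _ Q]) (simp add: n_def)
    qed
  qed
qed

text \<open>The first and the third period would both overlap the marked occurrence, which is only
  one period long.\<close>

lemma no_triple:
  assumes "chain c Q" "Letters d \<in> B" "rot d e" shows "path_word c Q \<noteq> y @ e @ e @ e @ m"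
proof
  assume w: "path_word c Q = y @ e @ e @ e @ m"
  obtain Q1 Q2 where 1: "Q = Q1 @ Q2" "head_band c Q2 = d"
     "length (path_word [] Q1) < length y + length e"
    using window_position[OF assms(1) w assms(2,3)] by blast
  have "path_word c Q = (y @ e @ e) @ e @ m" using w by simp
  from window_position[OF assms(1) this assms(2,3)]
  obtain Q1' Q2' where 2: "Q = Q1' @ Q2'" "head_band c Q2' = d"
     "length (y @ e @ e) < length (path_word [] Q1') + length d"
    by blast
  have "Q1 = Q1'" using chain_split_unique[OF assms(1)] 1 2 by blast
  then show False using 1 2 rot_length[OF assms(3)] by simp
qed

text \<open>Both periods overlap the marked occurrence, so it is cut as \<open>d = k @ h\<close>
  with \<open>e = h @ k\<close>. Neither \<open>h\<close> nor \<open>k\<close> reaches into a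
  neighbouring band.\<close>

lemma doubles_if_square:
  assumes ch: "chain c ((b1, u1) # Q)" and d: "Letters d \<in> B" and r: "rot d e"
    and w: "path_word c ((b1, u1) # Q) = y @ e @ e @ m"
  shows "d \<in> doubles u1 Q"
proof -
  define D where "D = path_word c ((b1, u1) # Q)"
  have e: "brot d e" using d r B_bnd by (simp add: brot_def)
  have sD: "S D" using chain_S0[OF ch] by (simp add: D_def)
  obtain Q1 Q2 where 1: "(b1, u1) # Q = Q1 @ Q2" "head_band c Q2 = d"
     "length (path_word [] Q1) < length y + length e"
    using window_position[OF ch w d r] by blast
  have "path_word c ((b1, u1) # Q) = (y @ e) @ e @ m" using w by simp
  from window_position[OF ch this d r]
  obtain Q1' Q2' where 2: "(b1, u1) # Q = Q1' @ Q2'" "head_band c Q2' = d"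
     "length (y @ e) < length (path_word [] Q1') + length d"
    by blast
  have Q1: "Q1 = Q1'" using chain_split_unique[OF ch] 1 2 by blast
  define X where "X = path_word [] Q1"
  have len: "length X < length y + length e" "length y < length X"
    using 1(3) 2(3) Q1 rot_length[OF r] by (simp_all add: X_def)
  obtain l where l: "path_word c Q2 = d @ l" using path_word_head[of c "[]" Q2] 1(2) by auto
  have DX: "D = X @ d @ l"
    using l unfolding D_def 1(1) path_word_append path_word_split[of "path_word c Q2"] X_def by simp
  have "y @ (e @ e @ m) = X @ d @ l" using w DX D_def by simp
  then obtain h where h: "X = y @ h" "e @ e @ m = h @ d @ l"
    using append_eq_split[of y "e @ e @ m" X] len by auto
  have "length h \<le> length e" using h(1) len by simp
  then obtain k where k: "e = h @ k" "d @ l = k @ e @ m"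
    using append_eq_split[OF h(2)[symmetric]] by auto
  have "length k \<le> length d" using k(1) rot_length[OF r] by simp
  then obtain h0 where h0: "d = k @ h0" "e @ m = h0 @ l"
    using append_eq_split[OF k(2)[symmetric]] by auto
  have "length h0 = length h" using h0(1) k(1) rot_length[OF r] by simp
  moreover have e1: "h0 @ l = h @ (k @ m)" using h0(2) k(1) by simp
  ultimately have "h0 = h" by (rule same_length_prefix_eq[rotated])
  moreover from this have "l = k @ m" using e1 by simp
  ultimately have hl: "h0 = h" "l = k @ m" by blast+
  have dk: "d = k @ h" using h0 hl by simp
  have hne: "h \<noteq> []" using h(1) len by auto
  have kne: "k \<noteq> []" using k(1) h(1) len by auto
  have "Q1 \<noteq> []" using h(1) hne X_def by auto
  then obtain Q0 b' w where Q0: "Q1 = Q0 @ [(b', w)]" by (metis rev_exhaust surj_pair)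
  have "l \<noteq> []" using hl kne by simp
  moreover have "l = []" if "Q2 = []" using l 1(2) that by simp
  ultimately obtain u Q2' where Q2: "Q2 = (d, u) # Q2'" using 1(2) by (cases Q2) auto
  have chs: "chain c ((b', w) # Q2)" "chain c Q2" "chain c Q2'" using ch 1(1) Q0 Q2 by (auto simp: chain_append)
  have b': "Letters b' \<in> B" "b' \<noteq> d" using chs chain_head_neq[OF chs(1)] 1(2) by auto
  define X0 where "X0 = path_word [] Q0"
  have X: "X = X0 @ b' @ w"
    unfolding X_def X0_def Q0 by (simp add: path_word_append path_word_split[of "b' @ w"])
  have "suffix h w"
  proof -
    have eq: "X0 @ b' @ (w @ d @ l) = y @ e @ (e @ m)" using DX X w D_def by simp
    have s: "S (X0 @ b' @ (w @ d @ l))" using sD DX X by simp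
    have nr: "\<not> rot b' d" using B_unique[OF b'(1) d] b'(2) by blast
    from window_disjoint[OF s eq B_bnd[OF b'(1)] e nr] show ?thesis
    proof cases
      fix r assume "X0 = y @ e @ r" then show ?thesis using len X by simp
    next
      fix r assume "y = X0 @ b' @ r"
      then have "w = r @ h" using X h(1) by simp
      then show ?thesis by (auto simp: suffix_def)
    qed
  qed
  moreover have "prefix k u"
  proof -
    define n where "n = head_band c Q2'"
    obtain m' where m': "path_word c Q2' = n @ m'"
      using path_word_head[of c "[]" Q2'] by (auto simp: n_def)
    have n: "Letters n \<in> B" "d \<noteq> n"
      using chain_head[OF chs(3)] chain_head_neq[of c d u Q2'] chs(2) Q2 by (simp_all add: n_def)
    have lu: "l = u @ n @ m'" using l Q2 m' by simp
    have "S (y @ h @ k @ h @ u @ n @ m')" using sD DX h(1) dk lu by simp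
    moreover have "u @ n @ m' = k @ m" using lu hl by simp
    ultimately show ?thesis using double_window_prefix[of k h n y u m' m] d n dk by simp
  qed
  ultimately have "doubled w d u" using dk unfolding doubled_def by blast
  moreover have "(b1, u1) # Q = Q0 @ (b', w) # (d, u) # Q2'" using 1(1) Q0 Q2 by simp
  ultimately show ?thesis using doubles_mem by blast
qed

text \<open>Cubes are excluded by \<open>no_triple\<close>, and squares come from doubled bands by
  \<open>doubles_if_square\<close>. So the skeleton removes one period of each doubled band and
  nothing else.\<close>

lemma band_mult_path_word:
  assumes ch: "chain c ((b1, u1) # Q)" and d: "Letters d \<in> B"
  defines "N \<equiv> band_mult \<Lambda> (Letters d) (Letters (path_word c ((b1, u1) # Q)))"
  shows "N \<le> 2" "N = 2 \<longleftrightarrow> d \<in> doubles u1 Q"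
proof -
  have b1: "Letters b1 \<in> B" and c: "Letters c \<in> B" using ch chain_last[OF ch] by simp_all
  have ne: "b1 \<noteq> []" "c \<noteq> []" using bnd_nonempty B_bnd b1 c by auto
  have s: "S (path_word c ((b1, u1) # Q))" using chain_S0[OF ch] .
  have "length (path_word c ((b1, u1) # Q)) \<ge> 2"
    using ne path_word_split[of c Q] by (cases b1; cases c) auto
  from band_mult_occ[OF B_bnd[OF d] s this]
  obtain y e m where o: "rot d e" "path_word c ((b1, u1) # Q) = y @ pow e N @ m"
    unfolding occ_def N_def by blast
  show N2: "N \<le> 2"
  proof (rule ccontr)
    assume "\<not> N \<le> 2"
    then obtain j where "N = Suc (Suc (Suc j))" by (metis add_2_eq_Suc less_imp_Suc_add not_le)
    then have "path_word c ((b1, u1) # Q) = y @ e @ e @ e @ (pow e j @ m)" using o(2) by simp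
    then show False using no_triple[OF ch d o(1)] by blast
  qed
  show "N = 2 \<longleftrightarrow> d \<in> doubles u1 Q"
  proof
    assume "N = 2"
    then have "path_word c ((b1, u1) # Q) = y @ e @ e @ m" using o(2) by (simp add: numeral_2_eq_2)
    then show "d \<in> doubles u1 Q" using doubles_if_square[OF ch d o(1)] by blast
  next
    assume "d \<in> doubles u1 Q"
    then obtain Q0 b' w u Q2 where Q: "(b1, u1) # Q = Q0 @ (b', w) # (d, u) # Q2" "doubled w d u"
      using doublesD by blast
    obtain h k w0 u' where hk: "w = w0 @ h" "u = k @ u'" "d = k @ h"
      using Q(2) by (auto simp: doubled_def suffix_def prefix_def)
    define y where "y = path_word [] Q0 @ b' @ w0"
    define m where "m = u' @ path_word c Q2"
    have "path_word c ((b1, u1) # Q) = path_word [] Q0 @ b' @ w @ d @ u @ path_word c Q2"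
      unfolding Q(1) path_word_append by (subst path_word_split) simp
    then have eq: "path_word c ((b1, u1) # Q) = y @ pow (h @ k) 2 @ m"
      by (simp add: y_def m_def hk numeral_2_eq_2)
    have "chain c ((b', w) # (d, u) # Q2)" using ch unfolding Q(1) chain_append by blast
    then have "bnd b'" using B_bnd by simp
    then have "y \<noteq> []" "m \<noteq> []"
      using bnd_nonempty ne path_word_split[of c Q2] by (auto simp: y_def m_def)
    then have "2 \<le> N"
      using band_mult_ge[OF B_bnd[OF d], of y "h @ k" 2 m] s eq rot_append_commute[of k h]
      unfolding N_def eq hk(3) by simp
    then show "N = 2" using N2 by simp
  qed
qed

section \<open>Evaluation of the skeleton\<close>

lemma masked_S:
  assumes "chain c ((b1, u1) # Q)" "M \<subseteq> doubles u1 Q"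
  shows "S (b1 @ u1 @ masked M c Q)"
proof -
  have ch: "chain c Q" and c: "Letters c \<in> B" using assms(1) chain_last[OF assms(1)] by simp_all
  have s: "S (b1 @ u1 @ path_word c Q)" using chain_S0[OF assms(1)] by simp
  have "S (u1 @ path_word c Q)"
    using S_suffix[OF s] path_word_split[of c Q] bnd_nonempty[OF B_bnd[OF c]] by simp
  moreover have "M \<inter> fst ` set Q \<subseteq> doubles u1 Q" using assms(2) by blast
  ultimately have "Hsteps (fst ` set Q \<inter> M) (u1 @ path_word c Q) (u1 @ masked M c Q)"
    using masked_Hsteps[OF ch] by blast
  from Hsteps_Heq[OF Hsteps_cong[OF this, of b1]] show ?thesis using s Heq_S(2) by simp
qed

lemma band_red_masked:
  assumes ch: "chain c ((b1, u1) # Q)" and M: "insert d M \<subseteq> doubles u1 Q" "d \<notin> M"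
  shows "band_red \<Lambda> (Letters d) (Letters (b1 @ u1 @ masked M c Q)) =
    Some (Letters (b1 @ u1 @ masked (insert d M) c Q))"
proof -
  have dQ: "d \<in> fst ` set Q" using M doubles_subset[of u1 Q] by auto
  have chQ: "chain c Q" using ch by simp
  obtain y m where ym: "masked M c Q = y @ d @ m @ c" "masked (insert d M) c Q = y @ m @ c"
    using masked_insert[OF dQ chain_distinct[OF chQ] M(2)] by blast
  have d: "bnd d" using chain_mem[OF chQ dQ] B_bnd by blast
  have "S ((b1 @ u1 @ y) @ d @ (m @ c))" "S ((b1 @ u1 @ y) @ (m @ c))"
    using masked_S[OF ch, of M] masked_S[OF ch, of "insert d M"] M ym by simp_all
  moreover have "b1 \<noteq> []" "c \<noteq> []" using ch chain_last[OF ch] B_bnd bnd_nonempty by auto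
  ultimately show ?thesis
    using band_red_Some[OF brot_refl[OF d], of "b1 @ u1 @ y" "m @ c"] ym by simp
qed

lemma band_red_seq_masked:
  assumes ch: "chain c ((b1, u1) # Q)"
  shows "distinct ds \<Longrightarrow> M \<union> set ds \<subseteq> doubles u1 Q \<Longrightarrow> M \<inter> set ds = {} \<Longrightarrow>
    band_red_seq \<Lambda> (map Letters ds) (Letters (b1 @ u1 @ masked M c Q)) =
      Some (Letters (b1 @ u1 @ masked (M \<union> set ds) c Q))"
proof (induction ds arbitrary: M)
  case (Cons d ds)
  have "insert d M \<subseteq> doubles u1 Q" "d \<notin> M" using Cons.prems by auto
  note red = band_red_masked[OF ch this]
  have "insert d M \<union> set ds \<subseteq> doubles u1 Q" "insert d M \<inter> set ds = {}" "distinct ds"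
    using Cons.prems by auto
  from Cons.IH[OF this(3,1,2)] show ?case using red by simp
qed simp

text \<open>An admissible order lists every doubled band exactly once, and each reduction omits one
  marked occurrence. All orders therefore give the same word, and the choice in
  \<open>skeleton\<close> is determined.\<close>

lemma skeleton_path_word:
  assumes ch: "chain c ((b1, u1) # Q)"
  shows "skeleton \<Lambda> B (Letters (path_word c ((b1, u1) # Q))) =
    Letters (b1 @ u1 @ masked (doubles u1 Q) c Q)"
proof -
  define y :: "('v, 'a) str" where "y = Letters (path_word c ((b1, u1) # Q))"
  define P where "P = (\<lambda>bs. set bs \<subseteq> bands_in \<Lambda> B y \<and>
                (\<forall>b\<in>bands_in \<Lambda> B y. count_list bs b = band_mult \<Lambda> b y - 1))"
  have chQ: "chain c Q" using ch by simp
  have yM: "y = Letters (b1 @ u1 @ masked {} c Q)" by (simp add: y_def masked_empty)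
  have inB: "\<exists>d. b = Letters d \<and> Letters d \<in> B" if "b \<in> B" for b
    using reps that is_bandD unfolding band_reps_def by blast
  have mult: "band_mult \<Lambda> b y - 1 = (if b \<in> Letters ` doubles u1 Q then 1 else 0)"
    if bi: "b \<in> bands_in \<Lambda> B y" for b
  proof -
    obtain d where d: "b = Letters d" "Letters d \<in> B" using inB bi by (auto simp: bands_in_def)
    have "band_mult \<Lambda> b y > 0" using bi by (simp add: bands_in_def)
    moreover have "b \<in> Letters ` doubles u1 Q \<longleftrightarrow> d \<in> doubles u1 Q" using d by auto
    ultimately show ?thesis using band_mult_path_word[OF ch d(2)] d(1) y_def by auto
  qed
  have sub: "Letters ` doubles u1 Q \<subseteq> bands_in \<Lambda> B y"
  proof
    fix b :: "('v, 'a) str" assume "b \<in> Letters ` doubles u1 Q"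
    then obtain d where d: "b = Letters d" "d \<in> doubles u1 Q" by blast
    then have dB: "Letters d \<in> B" using chain_mem[OF chQ] doubles_subset by blast
    have "band_mult \<Lambda> b y = 2" using band_mult_path_word(2)[OF ch dB] d y_def by simp
    then show "b \<in> bands_in \<Lambda> B y" using d dB by (simp add: bands_in_def)
  qed
  have res: "band_red_seq \<Lambda> bs y = Some (Letters (b1 @ u1 @ masked (doubles u1 Q) c Q))" if Pb: "P bs" for bs
  proof -
    have cnt: "count_list bs b = (if b \<in> Letters ` doubles u1 Q then 1 else 0)" if "b \<in> bands_in \<Lambda> B y" for b
      using Pb mult that unfolding P_def by simp
    have seteq: "set bs = Letters ` doubles u1 Q"
    proof
      show "set bs \<subseteq> Letters ` doubles u1 Q"
      proof
        fix b :: "('v, 'a) str" assume "b \<in> set bs"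
        moreover from this have "b \<in> bands_in \<Lambda> B y" using Pb unfolding P_def by blast
        ultimately show "b \<in> Letters ` doubles u1 Q" using cnt by (metis count_list_0_iff)
      qed
      show "Letters ` doubles u1 Q \<subseteq> set bs"
      proof
        fix b :: "('v, 'a) str" assume "b \<in> Letters ` doubles u1 Q"
        then have "count_list bs b = 1" using cnt sub by auto
        then show "b \<in> set bs" using count_notin[of b bs] by fastforce
      qed
    qed
    have "distinct bs"
    proof (rule count_list_distinct)
      fix b :: "('v, 'a) str" assume "b \<in> set bs"
      then show "count_list bs b = 1" using cnt seteq sub by auto
    qed
    moreover have bs: "bs = map Letters (map lts bs)"
      by (rule sym, simp, rule map_idI) (use seteq in auto)
    ultimately have "distinct (map lts bs)" by (metis distinct_map)
    moreover have "set (map lts bs) = doubles u1 Q" using seteq by force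
    ultimately have "band_red_seq \<Lambda> (map Letters (map lts bs)) y =
        Some (Letters (b1 @ u1 @ masked (doubles u1 Q) c Q))"
      using band_red_seq_masked[OF ch, of "map lts bs" "{}"] unfolding yM by simp
    then show ?thesis using bs by simp
  qed
  have "finite (doubles u1 Q)" by (rule finite_subset[OF doubles_subset]) simp
  then obtain ds where ds: "set ds = doubles u1 Q" "distinct ds" using finite_distinct_list by blast
  have "P (map Letters ds)"
    unfolding P_def
  proof (intro conjI ballI)
    show "set (map Letters ds) \<subseteq> bands_in \<Lambda> B y" using sub ds by simp
    fix b :: "('v, 'a) str" assume b: "b \<in> bands_in \<Lambda> B y"
    have "distinct (map Letters ds)" using ds(2) by (simp add: distinct_map inj_on_def)
    then show "count_list (map Letters ds) b = band_mult \<Lambda> b y - 1"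
      using mult[OF b] ds(1) distinct_count_list[of "map Letters ds" b] count_notin[of b "map Letters ds"]
      by (auto split: if_splits)
  qed
  then have "\<exists>bs. P bs \<and> band_red_seq \<Lambda> bs y = Some (Letters (b1 @ u1 @ masked (doubles u1 Q) c Q))"
    using res by (intro exI conjI)
  moreover have "z = Letters (b1 @ u1 @ masked (doubles u1 Q) c Q)"
    if "\<exists>bs. P bs \<and> band_red_seq \<Lambda> bs y = Some z" for z
    using that by (elim exE conjE) (simp add: res)
  ultimately have "(SOME z. \<exists>bs. P bs \<and> band_red_seq \<Lambda> bs y = Some z) =
      Letters (b1 @ u1 @ masked (doubles u1 Q) c Q)"
    by (rule some_equality)
  then have "skeleton \<Lambda> B y = Letters (b1 @ u1 @ masked (doubles u1 Q) c Q)"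
    unfolding skeleton_def P_def conj_assoc .
  then show ?thesis by (simp add: y_def)
qed

section \<open>Comparison with the reductions of the skeleton\<close>

text \<open>\<open>run\<close> decides with the unreduced word on the right, \<open>h_band\<close>
  with the word after the skeleton; these are linked by \<open>Hsteps\<close>, which preserves the
  H-class and \<open>Hred2\<close>. Whether \<open>b\<close> lies in \<open>M\<close> tells if the
  skeleton has already taken a period of \<open>b\<close>.\<close>

lemma fold_h_band:
  "treated a X w c [] Q \<Longrightarrow> M \<inter> fst ` set Q = doubles w Q \<Longrightarrow> run c X Q X' \<Longrightarrow>
     fold (h_band \<Lambda> B) (map (\<lambda>q. Letters (fst q)) Q) (Letters (X @ masked M c Q)) = Letters (X' @ c)"
proof (induction Q arbitrary: X w)
  case (Cons q Q)
  obtain b u where q: "q = (b, u)" by force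
  have i: "treated a X w c [] ((b, u) # Q)" using Cons.prems q by simp
  obtain X1 where X1: "step X b u (path_word c Q) X1" "run c X1 Q X'" using Cons.prems q by auto
  define R where "R = path_word c Q"
  define RM where "RM = masked M c Q"
  have ch: "chain c ((b, u) # Q)" "chain c Q" and b: "Letters b \<in> B" and bw: "bfree w"
    and s: "S (X @ b @ u @ R)" and a: "Letters a \<in> B"
    using i by (auto simp: treated_def R_def)
  have ane: "a \<noteq> []" "b \<noteq> []" using B_bnd a b bnd_nonempty by auto
  have cne: "c \<noteq> []" using bnd_nonempty[OF B_bnd[OF chain_last[OF ch(2)]]] .
  have ne: "R \<noteq> []" "RM \<noteq> []"
    using path_word_split[of c Q] masked_tail[of M c Q] cne by (auto simp: R_def RM_def)
  have Xne: "X \<noteq> []" using i ane by (auto simp: treated_def)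
  have le: "suffix h X \<longleftrightarrow> suffix h w" if "h @ b = d @ h" for h d
    using i that by (auto simp: treated_def)
  have nb: "b \<notin> fst ` set Q" using chain_acyclic[OF ch(1)] by simp
  have bM: "b \<in> M \<longleftrightarrow> doubled w b u"
  proof -
    have "b \<in> fst ` set (q # Q)" using q by simp
    then have "b \<in> M \<longleftrightarrow> b \<in> doubles w ((b, u) # Q)" using Cons.prems(2) q by blast
    moreover have "b \<notin> doubles u Q" using nb doubles_subset by blast
    ultimately show ?thesis by simp
  qed
  have MQ: "M \<inter> fst ` set Q = doubles u Q"
  proof -
    have "M \<inter> insert b (fst ` set Q) = (if doubled w b u then {b} else {}) \<union> doubles u Q"
      using Cons.prems(2) q by simp
    from inter_eq_drop[OF this _ doubles_subset nb] show ?thesis by simp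
  qed
  have suR: "S (u @ R)" using S_suffix[of "X @ b" "u @ R"] s ne by simp
  have hs: "Hsteps (fst ` set Q \<inter> M) (u @ R) (u @ RM)"
    unfolding R_def RM_def by (rule masked_Hsteps[OF ch(2)]) (use suR MQ R_def in auto)
  have heq: "Heq (u @ R) (u @ RM)" by (rule Hsteps_Heq[OF hs suR])
  have sM: "S (X @ b @ u @ RM)" using Heq_S_append[OF heq, of "X @ b"] s by simp
  have sb: "S (b @ u @ R)" using S_suffix[OF s] ane by simp
  have e2: "Hred2 h k (u @ R) \<longleftrightarrow> Hred2 h k (u @ RM)" if bk: "b = k @ h" for h k
  proof (rule Hred2_Hsteps[OF hs])
    show "S ((k @ h) @ u @ R)" "Letters (k @ h) \<in> B" using sb b bk by simp_all
    show "Letters x \<in> B \<and> x \<noteq> k @ h" if "x \<in> fst ` set Q \<inter> M" for x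
    proof
      show "Letters x \<in> B" using chain_mem[OF ch(2)] that by blast
      show "x \<noteq> k @ h" using nb that bk by blast
    qed
  qed
  have hr: "Hred X b (u @ R) \<longleftrightarrow> Hred X b (u @ RM)" by (rule Hred_Heq[OF heq])
  have bb: "brot b b" using brot_refl[OF B_bnd[OF b]] .
  have plain: "h_band \<Lambda> B (Letters b) (Letters (X @ b @ u @ RM)) =
      Letters (if Hred X b (u @ RM) then X @ u @ RM else X @ b @ u @ RM)"
    using h_band_word[OF bb b sM Xne] ne by simp
  have "h_band \<Lambda> B (Letters b) (Letters (X @ masked M c (q # Q))) = Letters (X1 @ RM)"
    using X1(1)[folded R_def]
  proof (cases rule: step_cases)
    case (1 X0 h k u')
    have g: "h @ b = (h @ k) @ h" using 1 by simp
    obtain Z0 where Z0: "X0 = a @ Z0" using treated_first[OF i 1(1) g] by blast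
    have "Hred2 h k (u @ R)" unfolding Hred2_def 1(2) using 1(4) by (intro exI[of _ "u' @ R"]) simp
    then have "Hred2 h k (u @ RM)" using e2 1(3) by blast
    then have eq: "Heq (h @ k @ u' @ RM) (u' @ RM)" using 1(2) by (auto simp: Hred2_def)
    \<comment> \<open>Here \<open>b\<close> is doubled: the skeleton has taken one period, and
      \<open>h_band\<close> takes the other at the window \<open>h @ k\<close>.\<close>
    have "suffix h X" using 1(1) by (simp add: suffix_def)
    then have "doubled w b u" using le[OF g] 1(2,3) unfolding doubled_def by auto
    then have word: "X @ masked M c (q # Q) = X0 @ (h @ k) @ (u' @ RM)"
      using bM q 1 by (simp add: RM_def)
    note tw = twice_S[OF 1(1-3) B_bnd[OF b] eq sM]
    have "Hred X0 (h @ k) (u' @ RM)"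
      unfolding Hred_def using eq by (intro exI[of _ "[]"] exI[of _ "h @ k"]) simp
    then show ?thesis
      using h_band_word[OF tw(4) b, of X0 "u' @ RM"] tw(2) word ne Z0 ane 1(5) by simp
  next
    case 2
    show ?thesis
    proof (cases "b \<in> M")
      case False
      then show ?thesis using plain 2 hr q by (simp add: RM_def)
    next
      case True
      then obtain h k w0 u' where d: "w = w0 @ h" "u = k @ u'" "b = k @ h"
        using bM by (auto simp: doubled_def suffix_def prefix_def)
      have g: "h @ b = (h @ k) @ h" using d by simp
      have "suffix h X" using le[OF g] d(1) by (simp add: suffix_def)
      then obtain X0 where X0: "X = X0 @ h" by (auto simp: suffix_def)
      obtain Z0 where Z0: "X0 = a @ Z0" using treated_first[OF i X0 g] by blast
      have word: "X @ masked M c (q # Q) = X0 @ (h @ k) @ (u' @ RM)"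
        using True q d X0 by (simp add: RM_def)
      have r: "brot b (h @ k)" using B_bnd[OF b] rot_append_commute d(3) by (simp add: brot_def)
      have sw: "S (X0 @ (h @ k) @ (u' @ RM))"
        using Hred_S[of X b "u @ RM"] 2(2) hr sM X0 d by simp
      \<comment> \<open>The skeleton has already removed the one period that \<open>step\<close>
        removes. If \<open>h_band\<close> could remove another, sliding its window along the run
        would give a cut of \<open>b\<close> witnessing \<open>twice\<close>.\<close>
      have "\<not> Hred X0 (h @ k) (u' @ RM)"
      proof
        assume "Hred X0 (h @ k) (u' @ RM)"
        then obtain X00 g e where ge: "X0 = X00 @ g" "g @ h @ k = e @ g"
            "Heq (e @ g @ u' @ RM) (g @ u' @ RM)"
          by (auto simp: Hred_def suffix_def)
        have e: "brot b e" using rot_if_conj[OF ge(2)] r brot_rot by blast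
        have "(g @ h) @ b = (g @ h @ k) @ h" using d(3) by simp
        also have "\<dots> = e @ (g @ h)" by (simp only: ge(2) append_assoc)
        finally have g2: "(g @ h) @ b = e @ (g @ h)" .
        have "suffix (g @ h) X" using X0 ge(1) by (simp add: suffix_def)
        then have sw: "suffix (g @ h) w" using le[OF g2] by blast
        \<comment> \<open>Otherwise the band-free bridge \<open>w\<close> would contain the window
          \<open>e\<close>.\<close>
        have "length (g @ h) < length e"
        proof (rule ccontr)
          assume "\<not> ?thesis"
          then obtain r where "g @ h = e @ r" using append_eq_split[OF g2[symmetric]] by auto
          then obtain z where "w = z @ e @ r" using sw by (auto simp: suffix_def)
          then show False using bw e unfolding bfree_def by blast
        qed
        moreover have "(g @ h) @ k = e @ g" using ge(2) by simp
        ultimately obtain k2 where k2: "e = (g @ h) @ k2" "k = k2 @ g"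
          using append_eq_split[of "g @ h" k e g] by auto
        have bk2: "b = k2 @ (g @ h)" using d(3) k2(2) by simp
        have "Hred2 (g @ h) k2 (u @ RM)"
          unfolding Hred2_def using ge(3) d(2) k2 by (intro exI[of _ "g @ u' @ RM"]) simp
        then have "Hred2 (g @ h) k2 (u @ R)" using e2[OF bk2] by blast
        then have "Heq ((g @ h) @ k2 @ (g @ u') @ R) ((g @ u') @ R)"
          using d(2) k2(2) by (auto simp: Hred2_def)
        then have "twice X b u R (X00 @ (g @ u'))"
          unfolding twice_def using X0 ge(1) d(2) k2(2) bk2
          by (intro exI[of _ X00] exI[of _ "g @ h"] exI[of _ k2] exI[of _ "g @ u'"]) simp
        then show False using 2(1) by blast
      qed
      then show ?thesis
        using h_band_word[OF r b sw] word Z0 ane ne 2(3) X0 d by simp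
    qed
  next
    case 3
    \<comment> \<open>A doubled band always admits an H-reduction, one of its two adjacent periods
      being redundant.\<close>
    have "b \<notin> M"
    proof
      assume "b \<in> M"
      then obtain h k w0 u' where d: "w = w0 @ h" "u = k @ u'" "b = k @ h"
        using bM by (auto simp: doubled_def suffix_def prefix_def)
      have g: "h @ b = (h @ k) @ h" using d by simp
      have sh: "suffix h X" using le[OF g] d(1) by (simp add: suffix_def)
      then obtain X0 where X0: "X = X0 @ h" by (auto simp: suffix_def)
      have r: "brot b (h @ k)" using B_bnd[OF b] rot_append_commute d(3) by (simp add: brot_def)
      have "S ((X0 @ h @ k) @ ((h @ k) @ u' @ R))" using s X0 d by simp
      then have "S ((h @ k) @ u' @ R)" by (rule S_suffix) (use brot_nonempty[OF r] in auto)
      from Heq_window[OF r this] have "Heq ((h @ k) @ h @ u @ R) (h @ u @ R)" using d(2) by simp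
      then have "Hred X b (u @ R)" unfolding Hred_def using g sh by blast
      then show False using 3(2) by blast
    qed
    then show ?thesis using plain 3 hr q by (simp add: RM_def)
  qed
  moreover have "treated a X1 u c [] Q" using treated_step[OF i, of X1] X1(1) by simp
  then have "fold (h_band \<Lambda> B) (map (\<lambda>q. Letters (fst q)) Q) (Letters (X1 @ RM)) = Letters (X' @ c)"
    unfolding RM_def using Cons.IH[OF _ MQ X1(2)] by blast
  ultimately show ?case using q by simp
qed simp

end

section \<open>Paths of bridges\<close>

definition pairs :: "('v, 'a) bridge list \<Rightarrow> ('a syllable list \<times> 'a syllable list) list" where
  "pairs L = map (\<lambda>u. (lts (btgt u), lts (bstr u))) L"

context dom_string_algebra begin

lemma B_Letters: "b \<in> B \<Longrightarrow> Letters (lts b) = b"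
  using reps is_bandD unfolding band_reps_def by fastforce

lemma trivial_left:
  assumes "S w"
  shows "\<exists>y. lts y = [] \<and> str_prod \<Lambda> [y, Letters w] = Some (Letters w)"
proof -
  have "w \<noteq> []" "arrow_of (hd w) \<in> arrows \<Lambda>" using assms by (auto simp: S_iff)
  then have "syl_tgt \<Lambda> (hd w) \<in> vertices \<Lambda>" "syl_eps \<Lambda> (hd w) \<in> {1, -1}"
    using ends signs by (cases "hd w"; force)+
  then show ?thesis
    using assms by (intro exI[of _ "Triv (syl_tgt \<Lambda> (hd w)) (syl_eps \<Lambda> (hd w))"])
      (simp add: S_def del: is_string.simps(2))
qed

lemma trivial_right:
  assumes "S w"
  shows "\<exists>y. lts y = [] \<and> is_string \<Lambda> y \<and> str_mult \<Lambda> (Letters w) y = Some (Letters w)"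
proof -
  have "w \<noteq> []" "arrow_of (last w) \<in> arrows \<Lambda>" using assms by (auto simp: S_iff)
  then have "syl_src \<Lambda> (last w) \<in> vertices \<Lambda>" "syl_sigma \<Lambda> (last w) \<in> {1, -1}"
    using ends signs by (cases "last w"; force)+
  then show ?thesis
    using assms by (intro exI[of _ "Triv (syl_src \<Lambda> (last w)) (- syl_sigma \<Lambda> (last w))"])
      (auto simp: S_def simp del: is_string.simps(2))
qed

lemma str_prod_factor:
  assumes s: "S (x @ e @ y)" and e: "e \<noteq> []"
  shows "\<exists>y2 y1. str_prod \<Lambda> [y2, Letters e, y1] = Some (Letters (x @ e @ y))"
proof -
  have se: "S (e @ y)" "S e" using S_suffix[OF s] S_factor[OF s] e by auto
  obtain y1 where y1: "is_string \<Lambda> y1" "str_mult \<Lambda> (Letters e) y1 = Some (Letters (e @ y))"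
  proof (cases "y = []")
    case True
    then show ?thesis using trivial_right[OF se(2)] that by auto
  next
    case False
    then have "S y" using S_suffix[OF se(1)] by simp
    then show ?thesis using that[of "Letters y"] se by (simp add: S_def del: is_string.simps(2))
  qed
  obtain y2 where y2: "str_mult \<Lambda> y2 (Letters (e @ y)) = Some (Letters (x @ e @ y))"
  proof (cases "x = []")
    case True
    then show ?thesis using trivial_left[OF se(1)] that se(1) by (auto simp: S_def simp del: is_string.simps(2))
  next
    case False
    then have "S x" using S_prefix[OF s] by simp
    then show ?thesis using that[of "Letters x"] s se by (simp add: S_def del: is_string.simps(2))
  qed
  show ?thesis using y1 y2 by (intro exI[of _ y2] exI[of _ y1]) (simp del: is_string.simps)
qed

lemma bfree_if_band_free:
  assumes "band_free \<Lambda> u" shows "bfree (lts u)"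
  unfolding bfree_def
proof
  assume "\<exists>d e x y. brot d e \<and> lts u = x @ e @ y"
  then obtain d e x y where e: "brot d e" "lts u = x @ e @ y" by blast
  then have u: "u = Letters (x @ e @ y)" using brot_nonempty[OF e(1)] by (cases u) auto
  then have "S (x @ e @ y)" using assms by (simp add: band_free_def S_def)
  then obtain y2 y1 where "str_prod \<Lambda> [y2, Letters e, y1] = Some u"
    using str_prod_factor[OF _ brot_nonempty[OF e(1)]] u by blast
  moreover have "is_band \<Lambda> (Letters d)" "cyc_perm (Letters d) (Letters e)"
    using e(1) by (simp_all add: brot_def bnd_def cyc_perm_Letters)
  ultimately show False using assms unfolding band_free_def by blast
qed

text \<open>The last part prolongs the product on the right. A bridge of length 0 is tied by its
  vertex and sign only to the leftmost syllable of the source band, so the product remains defined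
  when \<open>m\<close> follows.\<close>

lemma weak_bridgeD:
  assumes u: "weak_bridge \<Lambda> B u"
  shows "bsrc u \<in> B" "btgt u \<in> B" "bfree (lts (bstr u))"
    "S (lts (btgt u) @ lts (bstr u) @ lts (bsrc u))"
    "\<not> (lts (btgt u) = lts (bsrc u) \<and> lts (bstr u) = [])"
    "str_prod \<Lambda> [btgt u, bstr u, bsrc u] = Some (Letters (lts (btgt u) @ lts (bstr u) @ lts (bsrc u)))"
    "S (lts (bsrc u) @ m) \<Longrightarrow> S (lts (btgt u) @ lts (bstr u) @ lts (bsrc u) @ m) \<Longrightarrow>
       Option.bind (str_mult \<Lambda> (bstr u) (Letters (lts (bsrc u) @ m))) (str_mult \<Lambda> (btgt u)) =
         Some (Letters (lts (btgt u) @ lts (bstr u) @ lts (bsrc u) @ m))"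
proof -
  show B: "bsrc u \<in> B" "btgt u \<in> B" using u by (simp_all add: weak_bridge_def)
  show "bfree (lts (bstr u))" using u by (simp add: weak_bridge_def bfree_if_band_free)
  define s where "s = lts (bsrc u)"
  define t where "t = lts (btgt u)"
  have st: "bsrc u = Letters s" "btgt u = Letters t" using B_Letters[OF B(1)] B_Letters[OF B(2)] by (simp_all add: s_def t_def)
  then have Bst: "Letters s \<in> B" "Letters t \<in> B" using B by simp_all
  have ne: "s \<noteq> []" "t \<noteq> []" using bnd_nonempty B_bnd Bst by auto
  obtain y where y: "str_prod \<Lambda> [btgt u, bstr u, bsrc u] = Some y" using u by (auto simp: weak_bridge_def)
  from str_prod_SomeD[OF y] have l: "lts y = t @ lts (bstr u) @ s" "is_string \<Lambda> y" "is_string \<Lambda> (bstr u)"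
    by (auto simp: st)
  then have yl: "y = Letters (t @ lts (bstr u) @ s)" using ne by (cases y) auto
  show p: "str_prod \<Lambda> [btgt u, bstr u, bsrc u] = Some (Letters (lts (btgt u) @ lts (bstr u) @ lts (bsrc u)))"
    using y yl by (simp add: s_def t_def)
  show ss: "S (lts (btgt u) @ lts (bstr u) @ lts (bsrc u))" using S_if_str_prod[OF p] .
  have mid: "\<exists>z. str_mult \<Lambda> (bstr u) (Letters s) = Some z"
    using y by (auto simp: st bind_eq_Some_conv split: if_splits simp del: is_string.simps)
  have triv: "v = syl_tgt \<Lambda> (hd s) \<and> i = syl_eps \<Lambda> (hd s)" if "bstr u = Triv v i" for v i
    using mid that by (auto split: if_splits)
  show "\<not> (lts (btgt u) = lts (bsrc u) \<and> lts (bstr u) = [])"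
  proof
    assume a: "lts (btgt u) = lts (bsrc u) \<and> lts (bstr u) = []"
    then obtain v i where v: "bstr u = Triv v i" using l(3) by (cases "bstr u") auto
    then have "bstr u = Triv (str_tgt \<Lambda> (bsrc u)) (str_eps \<Lambda> (bsrc u))" using triv by (simp add: st)
    moreover have "bsrc u = btgt u" using a st by simp
    ultimately show False using u by (simp add: weak_bridge_def)
  qed
  assume m: "S (lts (bsrc u) @ m)" "S (lts (btgt u) @ lts (bstr u) @ lts (bsrc u) @ m)"
  have m': "S (s @ m)" "S (t @ lts (bstr u) @ s @ m)" using m by (simp_all add: s_def t_def)
  have "S (lts (bstr u) @ s @ m)" using S_suffix[OF m'(2)] ne by simp
  moreover have "S t" using S_prefix[OF m'(2)] ne by simp
  moreover have "str_mult \<Lambda> (bstr u) (Letters (s @ m)) = Some (Letters (lts (bstr u) @ s @ m))"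
  proof (cases "bstr u")
    case (Triv v i)
    then show ?thesis using triv[OF Triv] l(3) m' ne by (simp add: S_def del: is_string.simps(2))
  next
    case (Letters w)
    then show ?thesis using l(3) m' calculation by (simp add: S_def del: is_string.simps(2))
  qed
  ultimately show "Option.bind (str_mult \<Lambda> (bstr u) (Letters (lts (bsrc u) @ m))) (str_mult \<Lambda> (btgt u)) =
         Some (Letters (lts (btgt u) @ lts (bstr u) @ lts (bsrc u) @ m))"
    using m' st by (simp add: S_def s_def[symmetric] t_def[symmetric] del: is_string.simps(2))
qed

lemma bridge_list_chain:
  assumes "L \<noteq> []" "\<forall>u\<in>set L. weak_bridge \<Lambda> B u" "successively (\<lambda>v u. btgt u = bsrc v) L"
  defines "s \<equiv> bsrc (last L)"
  shows "chain (lts s) (pairs L)"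
    "str_prod \<Lambda> (concat (map (\<lambda>u. [btgt u, bstr u]) L) @ [s]) = Some (Letters (path_word (lts s) (pairs L)))"
proof -
  have "chain (lts s) (pairs L) \<and> str_prod \<Lambda> (concat (map (\<lambda>u. [btgt u, bstr u]) L) @ [s]) =
    Some (Letters (path_word (lts s) (pairs L)))"
    using assms(1-3) unfolding s_def
  proof (induction L rule: list_nonempty_induct)
    case (single u)
    then have u: "weak_bridge \<Lambda> B u" by simp
    note w = weak_bridgeD[OF u]
    have "Letters (lts (bsrc u)) \<in> B" "Letters (lts (btgt u)) \<in> B" using w(1,2) B_Letters by simp_all
    then show ?case using w by (auto simp: pairs_def simp del: str_prod.simps(3))
  next
    case (cons u L)
    then obtain v L' where L: "L = v # L'" by (cases L) auto
    have u: "weak_bridge \<Lambda> B u" "btgt v = bsrc u" using cons.prems L by auto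
    note w = weak_bridgeD[OF u(1)]
    define s where "s = bsrc (last L)"
    have IH: "chain (lts s) (pairs L)"
      "str_prod \<Lambda> (concat (map (\<lambda>u. [btgt u, bstr u]) L) @ [s]) = Some (Letters (path_word (lts s) (pairs L)))"
      using cons L unfolding s_def by auto
    have hd: "head_band (lts s) (pairs L) = lts (bsrc u)" using L u(2) by (simp add: pairs_def)
    have "Letters (lts (btgt u)) \<in> B" using w(2) B_Letters by simp
    then have ch: "chain (lts s) (pairs (u # L))"
      using IH(1) w(3,4,5) hd by (auto simp: pairs_def)
    obtain m where m: "path_word (lts s) (pairs L) = lts (bsrc u) @ m"
      using path_word_head[of "lts s" "[]" "pairs L"] hd by auto
    have "S (lts (bsrc u) @ m)" using chain_S0[OF IH(1)] m by simp
    moreover have "S (lts (btgt u) @ lts (bstr u) @ lts (bsrc u) @ m)"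
      using chain_S0[OF ch] m by (simp add: pairs_def)
    ultimately have "Option.bind (str_mult \<Lambda> (bstr u) (Letters (lts (bsrc u) @ m))) (str_mult \<Lambda> (btgt u)) =
         Some (Letters (lts (btgt u) @ lts (bstr u) @ lts (bsrc u) @ m))"
      by (rule w(7))
    then have "str_prod \<Lambda> (btgt u # bstr u # concat (map (\<lambda>u. [btgt u, bstr u]) L) @ [s]) =
        Some (Letters (path_word (lts s) (pairs (u # L))))"
      using IH(2) L m by (simp add: pairs_def)
    then show ?case using ch L by (simp add: s_def)
  qed
  then show "chain (lts s) (pairs L)"
    "str_prod \<Lambda> (concat (map (\<lambda>u. [btgt u, bstr u]) L) @ [s]) = Some (Letters (path_word (lts s) (pairs L)))"
    by auto
qed

lemma bridge_path_chain:
  assumes "bridge_path (weak_bridge \<Lambda> B) P"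
  shows "chain (lts (path_src P)) (pairs (rev P))"
    "path_string \<Lambda> P = Some (Letters (path_word (lts (path_src P)) (pairs (rev P))))"
proof -
  have "rev P \<noteq> []" "\<forall>u\<in>set (rev P). weak_bridge \<Lambda> B u" "successively (\<lambda>v u. btgt u = bsrc v) (rev P)"
    using assms by (auto simp: bridge_path_def successively_rev)
  from bridge_list_chain[OF this] show "chain (lts (path_src P)) (pairs (rev P))"
    "path_string \<Lambda> P = Some (Letters (path_word (lts (path_src P)) (pairs (rev P))))"
    using \<open>rev P \<noteq> []\<close> by (simp_all add: path_src_def path_string_def last_rev)
qed

lemma foldr_skeleton:
  assumes P: "bridge_path (weak_bridge \<Lambda> B) P" and Q: "pairs (rev P) = (b1, u1) # Q"
    and r: "run (lts (path_src P)) (b1 @ u1) Q X'"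
  shows "foldr (h_band \<Lambda> B) (map btgt (butlast P))
      (skeleton \<Lambda> B (Letters (path_word (lts (path_src P)) (pairs (rev P))))) = Letters (X' @ lts (path_src P))"
proof -
  define c where "c = lts (path_src P)"
  have ch: "chain c ((b1, u1) # Q)" using bridge_path_chain(1)[OF P] Q by (simp add: c_def)
  have i: "treated b1 (b1 @ u1) u1 c [] Q"
    by (rule treated_start[OF ch]) (use brot_S[OF brot_refl[OF B_bnd[OF chain_last[OF ch]]]] in simp)
  have "doubles u1 Q \<inter> fst ` set Q = doubles u1 Q" using doubles_subset by blast
  from fold_h_band[OF i this r[folded c_def]]
  have f: "fold (h_band \<Lambda> B) (map (\<lambda>q. Letters (fst q)) Q) (Letters (b1 @ u1 @ masked (doubles u1 Q) c Q)) =
      Letters (X' @ c)" by simp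
  have tl: "Q = pairs (tl (rev P))" using Q by (cases "rev P") (auto simp: pairs_def)
  have "Letters (lts (btgt u)) = btgt u" if "u \<in> set P" for u
    using P that B_Letters weak_bridgeD(2) by (auto simp: bridge_path_def)
  moreover have "set (tl (rev P)) \<subseteq> set P"
    using P list.set_sel(2)[of "rev P"] by (auto simp: bridge_path_def)
  ultimately have "map (\<lambda>q. Letters (fst q)) Q = map btgt (tl (rev P))"
    unfolding tl pairs_def by auto
  \<comment> \<open>\<open>Q\<close> lists the bands from the left, without the target of the path,
    and \<open>foldr\<close> applies the entry at the end of \<open>butlast P\<close> first; so the
    two orders agree.\<close>
  also have "\<dots> = rev (map btgt (butlast P))" using butlast_rev[of "rev P"] by (simp add: rev_map)
  finally have e: "map (\<lambda>q. Letters (fst q)) Q = rev (map btgt (butlast P))" .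
  show ?thesis
    using f unfolding e Q c_def[symmetric] skeleton_path_word[OF ch] foldr_conv_fold .
qed

lemma is_h_iff_run:
  assumes P: "bridge_path (weak_bridge \<Lambda> B) P" and Q: "pairs (rev P) = (b1, u1) # Q"
    and r: "run (lts (path_src P)) (b1 @ u1) Q X'"
  shows "is_h \<Lambda> B P x \<longleftrightarrow> bsrc x = path_src P \<and> btgt x = path_tgt P \<and>
     str_prod \<Lambda> [path_tgt P, bstr x, path_src P] = Some (Letters (X' @ lts (path_src P)))"
  unfolding is_h_def bridge_path_chain(2)[OF P] using foldr_skeleton[OF assms] by auto

lemma pairs_rev_Cons:
  assumes "bridge_path A P"
  obtains b u Q where "pairs (rev P) = (b, u) # Q" "b = lts (path_tgt P)"
proof -
  have "P \<noteq> []" using assms by (simp add: bridge_path_def)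
  then have "rev P = last P # rev (butlast P)"
    using rev_append[of "butlast P" "[last P]"] by simp
  then have "pairs (rev P) = (lts (path_tgt P), lts (bstr (last P))) # pairs (rev (butlast P))"
    by (simp only: pairs_def path_tgt_def list.map)
  then show thesis using that by blast
qed

section \<open>Substitution into paths of bridges\<close>

lemma bridge_path_subst:
  assumes P: "bridge_path A (P1 @ [w] @ P2)" and V: "bridge_path A V"
    and e: "path_src V = bsrc w" "path_tgt V = btgt w"
  shows "bridge_path A (P1 @ V @ P2)" "path_src (P1 @ V @ P2) = path_src (P1 @ [w] @ P2)"
    "path_tgt (P1 @ V @ P2) = path_tgt (P1 @ [w] @ P2)"
proof -
  have V': "V \<noteq> []" "bsrc (hd V) = bsrc w" "btgt (last V) = btgt w"
    using V e by (simp_all add: bridge_path_def path_src_def path_tgt_def)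
  show "bridge_path A (P1 @ V @ P2)"
    using P V V' by (auto simp: bridge_path_def successively_append_iff successively_Cons)
  show "path_src (P1 @ V @ P2) = path_src (P1 @ [w] @ P2)"
    using V' by (cases P1) (auto simp: path_src_def)
  show "path_tgt (P1 @ V @ P2) = path_tgt (P1 @ [w] @ P2)"
    using V' by (cases "P2 = []") (auto simp: path_tgt_def)
qed

lemma is_h_subst:
  assumes P: "bridge_path (weak_bridge \<Lambda> B) (P1 @ [w] @ P2)" and hP: "is_h \<Lambda> B (P1 @ [w] @ P2) x"
    and V: "bridge_path (weak_bridge \<Lambda> B) V" and hV: "is_h \<Lambda> B V w"
  shows "is_h \<Lambda> B (P1 @ V @ P2) x"
proof -
  have ends: "path_src V = bsrc w" "path_tgt V = btgt w" using hV by (simp_all add: is_h_def)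
  note sub = bridge_path_subst[OF P V ends]
  define c where "c = lts (path_src (P1 @ [w] @ P2))"
  define b where "b = lts (btgt w)"
  define u where "u = lts (bstr w)"
  define s where "s = lts (bsrc w)"
  define Qa where "Qa = pairs (rev P2)"
  define Qb where "Qb = pairs (rev P1)"
  have prP: "pairs (rev (P1 @ [w] @ P2)) = Qa @ (b, u) # Qb"
    by (simp add: pairs_def Qa_def Qb_def b_def u_def)
  obtain v V' where V': "pairs (rev V) = (b, v) # V'"
    using pairs_rev_Cons[OF V] ends(2) b_def by metis
  have prP': "pairs (rev (P1 @ V @ P2)) = Qa @ ((b, v) # V') @ Qb"
    using V' by (simp add: pairs_def Qa_def Qb_def)
  have ch: "chain c (Qa @ (b, u) # Qb)" using bridge_path_chain(1)[OF P] prP by (simp add: c_def)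
  have hb: "head_band c Qb = s"
  proof (cases P1 rule: rev_cases)
    case Nil
    then show ?thesis by (simp add: Qb_def c_def s_def pairs_def path_src_def)
  next
    case (snoc P1' z)
    then have "btgt z = bsrc w" using P by (simp add: bridge_path_def successively_append_iff)
    then show ?thesis using snoc by (simp add: Qb_def pairs_def s_def)
  qed
  have chV: "chain (head_band c Qb) ((b, v) # V')"
    using bridge_path_chain(1)[OF V] V' ends(1) by (simp add: hb s_def)
  obtain XV where XV: "run s (b @ v) V' XV" using run_total by blast
  have "str_prod \<Lambda> [btgt w, bstr w, bsrc w] = Some (Letters (XV @ s))"
    using is_h_iff_run[OF V V', of XV w] XV ends hV by (simp add: s_def)
  \<comment> \<open>Cancelling the source band \<open>s\<close> turns the hypothesis
    \<open>hV\<close> into a statement about the run over \<open>V'\<close>.\<close>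
  from str_prod_lts[OF this] have "XV = b @ u" by (simp add: b_def u_def s_def)
  then have iso: "run (head_band c Qb) (b @ v) V' (b @ u)" using XV hb by simp
  obtain b1 u1 Q1 where Q1: "pairs (rev (P1 @ [w] @ P2)) = (b1, u1) # Q1" using pairs_rev_Cons[OF P] .
  obtain b2 u2 Q2 where Q2: "pairs (rev (P1 @ V @ P2)) = (b2, u2) # Q2" using pairs_rev_Cons[OF sub(1)] .
  obtain X' where X': "run c (b1 @ u1) Q1 X'" using run_total by blast
  have "run c (b2 @ u2) Q2 X'"
    using run_substitute[OF ch chV iso _ X', of b2 u2 Q2] prP prP' Q1 Q2 by simp
  then have r2: "run (lts (path_src (P1 @ V @ P2))) (b2 @ u2) Q2 X'" using sub(2) by (simp add: c_def)
  show ?thesis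
    using is_h_iff_run[OF sub(1) Q2 r2, of x] is_h_iff_run[OF P Q1 X'[unfolded c_def], of x] hP sub(2,3) by simp
qed

lemma weak_bridge_is_h:
  assumes "weak_bridge \<Lambda> B w" shows "bridge_path (weak_bridge \<Lambda> B) [w]" "is_h \<Lambda> B [w] w"
proof -
  show P: "bridge_path (weak_bridge \<Lambda> B) [w]" using assms by (simp add: bridge_path_def)
  have Q: "pairs (rev [w]) = (lts (btgt w), lts (bstr w)) # []" by (simp add: pairs_def)
  have "run (lts (path_src [w])) (lts (btgt w) @ lts (bstr w)) [] (lts (btgt w) @ lts (bstr w))" by simp
  from is_h_iff_run[OF P Q this, of w] show "is_h \<Lambda> B [w] w"
    using weak_bridgeD(6)[OF assms] by (simp add: path_src_def path_tgt_def del: str_prod.simps(3))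
qed

lemma weak_bridge_path_length:
  assumes "bridge_path (weak_bridge \<Lambda> B) P"
  shows "length P \<le> card (lts ` B)"
proof -
  note ch = bridge_path_chain(1)[OF assms]
  have "B \<subseteq> {b. is_band \<Lambda> b}" using reps unfolding band_reps_def by blast
  then have "finite B" using domestic unfolding domestic_def by (rule finite_subset)
  moreover have "fst ` set (pairs (rev P)) \<subseteq> lts ` B"
    using chain_mem[OF ch] by force
  ultimately have "card (set (map fst (pairs (rev P)))) \<le> card (lts ` B)"
    by (intro card_mono) auto
  then show ?thesis
    using distinct_card[OF chain_distinct[OF ch]] by (simp add: pairs_def)
qed

lemma weak_arch_bridge_decomposition:
  assumes "weak_arch_bridge \<Lambda> B u"
  shows "\<exists>P. bridge_path (arch_bridge \<Lambda> B) P \<and> is_h \<Lambda> B P u"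
proof -
  define A where "A = (\<lambda>P. bridge_path (weak_bridge \<Lambda> B) P \<and> is_h \<Lambda> B P u)"
  obtain P0 where "A P0" using assms unfolding weak_arch_bridge_def A_def by blast
  moreover have "\<forall>P. A P \<longrightarrow> length P < Suc (card (lts ` B))"
    using weak_bridge_path_length unfolding A_def by (simp add: less_Suc_eq_le)
  ultimately obtain P where P: "A P" "\<And>P'. A P' \<Longrightarrow> length P' \<le> length P"
    using ex_has_greatest_nat[of A P0 length "Suc (card (lts ` B))"] by blast
  have wP: "bridge_path (weak_bridge \<Lambda> B) P" "is_h \<Lambda> B P u" using P(1) by (simp_all add: A_def)
  have "arch_bridge \<Lambda> B w" if w: "w \<in> set P" for w
  proof (rule ccontr)
    assume "\<not> arch_bridge \<Lambda> B w"
    moreover have ww: "weak_bridge \<Lambda> B w" using wP(1) w by (simp add: bridge_path_def)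
    then have "weak_arch_bridge \<Lambda> B w" using weak_bridge_is_h unfolding weak_arch_bridge_def by blast
    ultimately obtain V where V: "bridge_path (weak_bridge \<Lambda> B) V" "length V \<ge> 2" "is_h \<Lambda> B V w"
      unfolding arch_bridge_def by blast
    obtain P1 P2 where P12: "P = P1 @ [w] @ P2" using split_list[OF w] by auto
    have "path_src V = bsrc w" "path_tgt V = btgt w" using V(3) by (simp_all add: is_h_def)
    from bridge_path_subst(1)[OF wP(1)[unfolded P12] V(1) this]
      is_h_subst[OF wP(1)[unfolded P12] wP(2)[unfolded P12] V(1,3)]
    have "A (P1 @ V @ P2)" by (simp add: A_def)
    then have "length (P1 @ V @ P2) \<le> length P" by (rule P(2))
    then show False using V(2) P12 by simp
  qed
  then have "bridge_path (arch_bridge \<Lambda> B) P" using wP(1) by (simp add: bridge_path_def)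
  then show ?thesis using wP(2) by blast
qed

end

theorem proposition7p4:
  fixes \<Lambda> :: "('v, 'a) presentation"
    and B :: "('v, 'a) str set"
    and u :: "('v, 'a) bridge"
  assumes "string_algebra TYPE('k::alg_closed_field) \<Lambda>"
    and "sign_choice \<Lambda>"
    and "domestic \<Lambda>"
    and "band_reps \<Lambda> B"
    and "weak_arch_bridge \<Lambda> B u"
  shows "\<exists>P. bridge_path (arch_bridge \<Lambda> B) P \<and> is_h \<Lambda> B P u"
proof -
  interpret dom_string_algebra \<Lambda> B
  proof
    show "src \<Lambda> a \<in> vertices \<Lambda> \<and> tgt \<Lambda> a \<in> vertices \<Lambda>" if "a \<in> arrows \<Lambda>" for a
      using assms(1) that by (simp add: string_algebra_def)
    show "sgn_src \<Lambda> a \<in> {1, -1} \<and> sgn_tgt \<Lambda> a \<in> {1, -1}" if "a \<in> arrows \<Lambda>" for a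
      using assms(2) that by (simp add: sign_choice_def)
    show "\<exists>m. \<forall>p. quiver_path \<Lambda> p \<and> length p \<ge> m \<longrightarrow> (\<exists>r\<in>relations \<Lambda>. sublist r p)"
      using assms(1) by (simp add: string_algebra_def)
  qed (fact assms)+
  show ?thesis using assms(5) by (rule weak_arch_bridge_decomposition)
qed

end
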